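(* Let $N,n\ge1$ be integers, $1\le p\le\infty$, $1\le q<\infty$, $0<\alpha<n$. Then $\Lambda^{p,q}_\alpha(\mathbb B_N)\subset H^p(\mathbb B_N)$. For a function $f\in H^p(\mathbb B_N)$ the following conditions are equivalent: $(\mathcal R)$ $f\in\Lambda^{p,q}_\alpha(\mathbb B_N)$; $(\Delta)$ $\displaystyle\left(\int_0^1\left[\frac{\|\Delta^n_tf\|_p}{t^\alpha}\right]^q\frac{dt}{t}\right)^{1/q}<\infty$; $(\omega^-)$ $\displaystyle\left(\int_0^1\left[\frac{\omega^-_n(\delta,f)_p}{\delta^\alpha}\right]^q\frac{d\delta}{\delta}\right)^{1/q}<\infty$; $(\omega)$ $\displaystyle\left(\int_0^1\left[\frac{\omega_n(\delta,f)_p}{\delta^\alpha}\right]^q\frac{d\delta}{\delta}\right)^{1/q}<\infty$; $(\omega^+)$ $\displaystyle\left(\int_0^1\left[\frac{\omega^+_n(\delta,f)_p}{\delta^\alpha}\right]^q\frac{d\delta}{\delta}\right)^{1/q}<\infty$.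
   Context: $\mathbb B_N$ is the unit ball of $\mathbb C^N$, $\mathbb S_N=\partial\mathbb B_N$, $\sigma$ is the normalized Lebesgue measure on $\mathbb S_N$, and $H(\mathbb B_N)$ is the space of holomorphic functions on $\mathbb B_N$. For a Borel function $g$ on $\mathbb B_N$ and $0<r<1$, $M_p(r,g)=\left(\int_{\mathbb S_N}|g(r\zeta)|^p\,d\sigma(\zeta)\right)^{1/p}$ for $p<\infty$ and $M_\infty(r,g)=\operatorname{ess\,sup}_{\zeta\in\mathbb S_N}|g(r\zeta)|$. $H^p(\mathbb B_N)$ is the space of $f\in H(\mathbb B_N)$ with $\|f\|_p:=\sup_{0<r<1}M_p(r,f)<\infty$. For $\beta\in\mathbb R$ and $q<\infty$, $\|g\|_{p,q,\beta}=\left(2N\int_0^1M_p^q(r,g)(1-r^2)^{q\beta-1}r^{2N-1}\,dr\right)^{1/q}$. If $f\in H(\mathbb B_N)$ has homogeneous expansion $f=\sum_{k\ge0}f_k$, then $\mathcal R^sf=\sum_{k\ge1}k^sf_k$. The Besov-Lipschitz space $\Lambda^{p,q}_\alpha(\mathbb B_N)$ consists of those $f\in H(\mathbb B_N)$ with $\|\mathcal R^sf\|_{p,q,s-\alpha}<\infty$, where $s$ is the smallest integer greater than $\alpha$. Differences: for $t\in\mathbb R$, $\Delta^1_tf(z)=f(e^{it}z)-f(z)$ and $\Delta^n_tf=\Delta^1_t(\Delta^{n-1}_tf)$ for $n\ge2$. For a linear operator $U$ mapping $\mathbb B_N$ to $\mathbb B_N$, $\Delta^1_Uf(z)=f(Uz)-f(z)$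 and $\Delta^n_Uf=\Delta^1_U(\Delta^{n-1}_Uf)$ for $n\ge2$. Let $\mathcal U$ be the group of unitary transformations of $\mathbb C^N$, $\mathcal L$ the semigroup of all linear operators from $\mathbb B_N$ to $\mathbb B_N$, and $I$ the identity. The moduli of continuity are $$\omega_n(\delta,f)_p=\sup_{\|U-I\|<\delta,\,U\in\mathcal U}\|\Delta^n_Uf\|_p,\quad \omega^-_n(\delta,f)_p=\sup_{|t|<\delta}\|\Delta^n_tf\|_p,\quad \omega^+_n(\delta,f)_p=\sup_{\|U-I\|<\delta,\,U\in\mathcal L}\|\Delta^n_Uf\|_p.$$ *)

theory Defs
  imports "HOL-Analysis.Analysis" "HOL-Probability.Essential_Supremum"
begin

text \<open>
  The space $C^N$ is \<open>complex ^ 'N\<close> with \<open>N = CARD('N)\<close>; its norm is the Hermitian (Euclidean) norm,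
  and \<open>ball 0 1\<close>, \<open>sphere 0 1\<close> are the unit ball and the unit sphere.
  Functions on the ball are total functions whose values outside the ball are never inspected.
  All norms are extended nonnegative reals, so that membership in a space means finiteness.
\<close>

definition enn_powr :: "ennreal \<Rightarrow> real \<Rightarrow> ennreal" where
  \<comment> \<open>only used with positive exponents\<close>
  "enn_powr x a = (if x = \<infinity> then \<infinity> else ennreal (enn2real x powr a))"

subsection \<open>Holomorphic functions and homogeneous expansions\<close>

definition holomorphic_several :: "(complex ^ 'N \<Rightarrow> complex) \<Rightarrow> (complex ^ 'N) set \<Rightarrow> bool" where
  \<comment> \<open>for open \<open>S\<close>: the Frechet derivative exists and is complex linear at every point\<close>
  "holomorphic_several f S \<longleftrightarrow>
     (\<forall>z\<in>S. \<exists>D. (f has_derivative D) (at z) \<and> (\<forall>c v. D (c *s v) = c * D v))"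

definition homogeneous_poly :: "nat \<Rightarrow> (complex ^ 'N \<Rightarrow> complex) \<Rightarrow> bool" where
  "homogeneous_poly k P \<longleftrightarrow>
     (\<exists>c :: ('N \<Rightarrow> nat) \<Rightarrow> complex.
        \<forall>z. P z = (\<Sum>a | (\<Sum>i\<in>UNIV. a i) = k. c a * (\<Prod>i\<in>UNIV. (z $ i) ^ a i)))"

definition homogeneous_expansion ::
    "(complex ^ 'N \<Rightarrow> complex) \<Rightarrow> (nat \<Rightarrow> complex ^ 'N \<Rightarrow> complex) \<Rightarrow> bool" where
  "homogeneous_expansion f F \<longleftrightarrow>
     (\<forall>k. homogeneous_poly k (F k)) \<and> (\<forall>z\<in>ball 0 1. (\<lambda>k. F k z) sums f z)"

definition hom_part :: "(complex ^ 'N \<Rightarrow> complex) \<Rightarrow> nat \<Rightarrow> complex ^ 'N \<Rightarrow> complex" where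
  \<comment> \<open>the expansion is unique, and it exists if \<open>f\<close> is holomorphic on the unit ball\<close>
  "hom_part f = (THE F. homogeneous_expansion f F)"

definition radial_deriv :: "real \<Rightarrow> (complex ^ 'N \<Rightarrow> complex) \<Rightarrow> complex ^ 'N \<Rightarrow> complex" where
  \<comment> \<open>the sum over all degrees \<open>Suc k \<ge> 1\<close>\<close>
  "radial_deriv s f z = (\<Sum>k. complex_of_real (real (Suc k) powr s) * hom_part f (Suc k) z)"

subsection \<open>Integral means and norms\<close>

definition sphere_measure :: "(complex ^ 'N) measure" where
  \<comment> \<open>normalized surface measure on the unit sphere: the image of the uniform distribution on the
      unit ball under the radial projection \<open>z \<mapsto> z / norm z\<close>; the origin is a null set\<close>
  "sphere_measure = restrict_space (distr (uniform_measure lborel (ball 0 1)) borel sgn) (sphere 0 1)"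

definition int_mean :: "ennreal \<Rightarrow> real \<Rightarrow> (complex ^ 'N \<Rightarrow> complex) \<Rightarrow> ennreal" where
  "int_mean p r g =
     (if p = \<infinity> then esssup sphere_measure (\<lambda>\<zeta>. ennreal (norm (g (r *\<^sub>R \<zeta>))))
      else enn_powr (\<integral>\<^sup>+\<zeta>. ennreal (norm (g (r *\<^sub>R \<zeta>)) powr enn2real p) \<partial>sphere_measure)
             (1 / enn2real p))"

definition hardy_norm :: "ennreal \<Rightarrow> (complex ^ 'N \<Rightarrow> complex) \<Rightarrow> ennreal" where
  "hardy_norm p f = (SUP r\<in>{0<..<1}. int_mean p r f)"

definition hardy_space :: "ennreal \<Rightarrow> (complex ^ 'N \<Rightarrow> complex) set" where
  "hardy_space p = {f. holomorphic_several f (ball 0 1) \<and> hardy_norm p f < \<infinity>}"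

definition mixed_norm :: "ennreal \<Rightarrow> real \<Rightarrow> real \<Rightarrow> (complex ^ 'N \<Rightarrow> complex) \<Rightarrow> ennreal" where
  "mixed_norm p q \<beta> g =
     enn_powr
       (ennreal (2 * real CARD('N)) *
        (\<integral>\<^sup>+r\<in>{0<..<1}. enn_powr (int_mean p r g) q *
             ennreal ((1 - r\<^sup>2) powr (q * \<beta> - 1) * r ^ (2 * CARD('N) - 1)) \<partial>lborel))
       (1 / q)"

definition besov_lipschitz :: "ennreal \<Rightarrow> real \<Rightarrow> real \<Rightarrow> (complex ^ 'N \<Rightarrow> complex) set" where
  "besov_lipschitz p q \<alpha> =
     (let s = real_of_int (LEAST m::int. \<alpha> < real_of_int m)
      in {f. holomorphic_several f (ball 0 1) \<and> mixed_norm p q (s - \<alpha>) (radial_deriv s f) < \<infinity>})"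

subsection \<open>Differences and moduli of continuity\<close>

definition diff_op :: "(complex ^ 'N \<Rightarrow> complex ^ 'N) \<Rightarrow> (complex ^ 'N \<Rightarrow> complex) \<Rightarrow>
    complex ^ 'N \<Rightarrow> complex" where
  "diff_op U f z = f (U z) - f z"

definition diff_rot :: "real \<Rightarrow> (complex ^ 'N \<Rightarrow> complex) \<Rightarrow> complex ^ 'N \<Rightarrow> complex" where
  "diff_rot t f z = f (exp (\<i> * complex_of_real t) *s z) - f z"

definition ball_operators :: "(complex ^ 'N \<Rightarrow> complex ^ 'N) set" where
  "ball_operators = {U. Vector_Spaces.linear (*s) (*s) U \<and> U ` ball 0 1 \<subseteq> ball 0 1}"

definition unitary_operators :: "(complex ^ 'N \<Rightarrow> complex ^ 'N) set" where
  \<comment> \<open>linear maps preserving the Hermitian inner product\<close>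
  "unitary_operators = {U. Vector_Spaces.linear (*s) (*s) U \<and>
     (\<forall>z w. (\<Sum>i\<in>UNIV. U z $ i * cnj (U w $ i)) = (\<Sum>i\<in>UNIV. z $ i * cnj (w $ i)))}"

definition modulus :: "nat \<Rightarrow> real \<Rightarrow> (complex ^ 'N \<Rightarrow> complex) \<Rightarrow> ennreal \<Rightarrow> ennreal" where
  "modulus n \<delta> f p =
     (SUP U\<in>{U \<in> unitary_operators. onorm (\<lambda>z. U z - z) < \<delta>}. hardy_norm p ((diff_op U ^^ n) f))"

definition modulus_minus :: "nat \<Rightarrow> real \<Rightarrow> (complex ^ 'N \<Rightarrow> complex) \<Rightarrow> ennreal \<Rightarrow> ennreal" where
  "modulus_minus n \<delta> f p = (SUP t\<in>{t. \<bar>t\<bar> < \<delta>}. hardy_norm p ((diff_rot t ^^ n) f))"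

definition modulus_plus :: "nat \<Rightarrow> real \<Rightarrow> (complex ^ 'N \<Rightarrow> complex) \<Rightarrow> ennreal \<Rightarrow> ennreal" where
  "modulus_plus n \<delta> f p =
     (SUP U\<in>{U \<in> ball_operators. onorm (\<lambda>z. U z - z) < \<delta>}. hardy_norm p ((diff_op U ^^ n) f))"

definition smoothness_integral :: "real \<Rightarrow> real \<Rightarrow> (real \<Rightarrow> ennreal) \<Rightarrow> ennreal" where
  \<comment> \<open>the integral of \<open>(\<phi> t / t powr \<alpha>) powr q\<close> over the unit interval with respect to \<open>dt / t\<close>,
      raised to the power \<open>1 / q\<close>\<close>
  "smoothness_integral q \<alpha> \<phi> =
     enn_powr (\<integral>\<^sup>+t\<in>{0<..<1}. enn_powr (\<phi> t / ennreal (t powr \<alpha>)) q * ennreal (1 / t) \<partial>lborel)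
       (1 / q)"

end

theory Submission
  imports Defs "HOL-Complex_Analysis.Complex_Analysis"
begin

text \<open>
  For every exponent \<open>p\<close>, the proof uses only that the \<open>L\<^sup>p\<close> norm on the sphere is a norm on continuous
  functions, is dominated by the supremum and is invariant under orthogonal maps (\<open>sphere_norm\<close>). Such a norm
  of an average is at most the supremum of the norms (\<open>mean_le_average\<close>). Applied to the mean value property and
  to Cauchy's formula in a complex parameter, this principle yields all estimates: the means of a holomorphic
  function increase with the radius (\<open>mean_mono\<close>), the radial derivative \<open>R\<close> costs the inverse distance of the
  radii (\<open>mean_Rad_Cauchy\<close>), and composition with an arbitrary linear contraction does not increase the means
  (\<open>mean_contraction\<close>), because a contraction that is not unitary is the centre of a complex disc of
  contractions. Schwarz' lemma in the pencil \<open>1 + l (U - 1)\<close> then shows that a difference along \<open>U\<close> of a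
  function that extends to a ball of radius \<open>exp \<tau>\<close> has mean at most of the order \<open>d / \<tau>\<close> times the mean of
  the extension near the boundary of that ball, if \<open>d\<close> bounds the norm of \<open>U - 1\<close> (\<open>mean_diff_near_identity\<close>, \<open>mean_diff_op_room\<close>).

  From derivatives to moduli. Let \<open>D\<^sub>j\<close> be the dilation by \<open>exp (- 2\<^sup>-\<^sup>j)\<close>, so that \<open>D\<^sub>j\<close> is the square of
  \<open>D\<^sub>j\<^sub>+\<^sub>1\<close>. The function \<open>f\<close> is the sum of \<open>f - (1 - D\<^sub>0)\<^sup>s f\<close> and of the pieces \<open>(1 - D\<^sub>j)\<^sup>s f - (1 - D\<^sub>j\<^sub>+\<^sub>1)\<^sup>s f\<close>. A
  piece is divisible by \<open>(1 - D\<^sub>j\<^sub>+\<^sub>1)\<^sup>s\<close>, so its mean is at most of the order \<open>2\<^sup>-\<^sup>j\<^sup>s\<close> times the mean of \<open>R\<^sup>s f\<close> at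
  scale \<open>j\<close>; it is also divisible by \<open>D\<^sub>j\<^sub>+\<^sub>1\<close>, so it extends to a ball larger by \<open>2\<^sup>-\<^sup>j\<close>, and its \<open>n\<close>-fold difference
  with displacement \<open>2\<^sup>-\<^sup>k\<close> gains the factor \<open>2\<^sup>-\<^sup>(\<^sup>k\<^sup>-\<^sup>j\<^sup>)\<^sup>n\<close> for \<open>j < k\<close>. After multiplication by \<open>2\<^sup>k\<^sup>\<alpha>\<close>, the sum over
  the pieces is a convolution with a two-sided geometric sequence, because \<open>0 < \<alpha> < n\<close>, and such a convolution
  preserves \<open>\<ell>\<^sup>q\<close> (\<open>summable_geom_convolution\<close>, \<open>moduli_from_scaled_mean\<close>). The same sum bounds \<open>f\<close> itself, which
  gives the inclusion in the Hardy space.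

  From moduli to derivatives. Each of the four conditions controls differences along rotations by \<open>exp (i u)\<close> with
  one step \<open>u\<close> comparable to each \<open>2\<^sup>-\<^sup>k\<close>. Such a difference is \<open>(i u)\<^sup>n R\<^sup>n f\<close> up to an error of size
  \<open>u\<^sup>n\<^sup>+\<^sup>1\<close> times the mean of \<open>R\<^sup>n\<^sup>+\<^sup>1 f\<close>, and the latter is at most \<open>2\<^sup>k\<^sup>+\<^sup>1\<close> times the mean of \<open>R\<^sup>n f\<close> at the next dyadic
  radius. With \<open>u\<close> a small multiple of \<open>2\<^sup>-\<^sup>k\<close> the error is absorbed by iteration, the a priori growth of the
  derivatives of a function in the Hardy space removing the last term (\<open>scaled_mean_from_rotations\<close>). A discrete
  Hardy inequality passes from the order \<open>n\<close> to the order \<open>s \<le> n\<close> (\<open>scaled_mean_lower_orders\<close>).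

  The integrals in the mixed norm and in the moduli are compared with sums over dyadic scales. For the
  mixed norm this uses that the means are monotone (\<open>weighted_integral_dyadic\<close>); for the rotational differences,
  which are not monotone in the step, a good step is selected in each dyadic interval
  (\<open>smoothness_integral_sample\<close>). That \<open>R\<close> agrees with the derivative defined by the homogeneous expansion requires
  that the Taylor coefficients on slices are polynomials (\<open>homogeneous_poly_slice_coeff\<close>, \<open>radial_deriv_eq\<close>).
\<close>

section \<open>Orthogonal invariance of the surface measure\<close>

lemma nn_integral_lborel_shift:
  fixes g :: "'a::euclidean_space \<Rightarrow> ennreal"
  assumes [measurable]: "g \<in> borel_measurable borel"
  shows "(\<integral>\<^sup>+x. g (x + c) \<partial>lborel) = (\<integral>\<^sup>+x. g x \<partial>lborel)"
proof -
  have "(\<integral>\<^sup>+x. g x \<partial>lborel) = (\<integral>\<^sup>+x. g x \<partial>distr lborel borel ((+) c))"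
    by (simp add: lborel_distr_plus)
  also have "\<dots> = (\<integral>\<^sup>+x. g (c + x) \<partial>lborel)" by (subst nn_integral_distr) auto
  finally show ?thesis by (simp add: add.commute)
qed

text \<open>Haar uniqueness in the case at hand: the image measure and Lebesgue measure are both invariant under
  translations, so each of them is determined by its value on one set, and the ball is mapped to itself.\<close>

lemma lborel_distr_orthogonal:
  fixes U :: "'a::euclidean_space \<Rightarrow> 'a"
  assumes U: "orthogonal_transformation U"
  shows "distr lborel borel U = lborel"
proof (rule measure_eqI)
  show "sets (distr lborel borel U) = sets lborel" by simp
next
  fix A assume "A \<in> sets (distr lborel borel U)"
  then have A [measurable]: "A \<in> sets borel" by simp
  have linU: "linear U" and nU: "\<And>x. norm (U x) = norm x"
    using U by (auto simp: orthogonal_transformation)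
  have [measurable]: "U \<in> borel_measurable borel"
    using linU by (intro borel_measurable_continuous_onI linear_continuous_on) (simp add: linear_conv_bounded_linear)
  define B where "B = (ball 0 1 :: 'a set)"
  have [measurable]: "B \<in> sets borel" by (simp add: B_def)
  have Bsym: "indicator B (- x) = (indicator B x :: ennreal)" for x by (auto simp: B_def indicator_def)
  have BU: "indicator B (U x) = (indicator B x :: ennreal)" for x by (auto simp: B_def indicator_def nU)
  let ?l = "\<lambda>A. emeasure lborel (A :: 'a set)"
  have B0: "?l B \<noteq> 0"
    using open_not_negligible[of B] by (auto simp: B_def negligible_iff_emeasure0)
  have Bfin: "?l B \<noteq> \<infinity>" using emeasure_bounded_finite[of B] by (simp add: B_def less_top)
  \<comment> \<open>Both iterated integrals of \<open>(x, y) \<mapsto> 1\<^sub>A (U x + y) 1\<^sub>B (U x)\<close> are computed by shifting the inner variable.\<close>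
  have "(\<integral>\<^sup>+x. \<integral>\<^sup>+y. indicator A (U x + y) * indicator B (U x) \<partial>lborel \<partial>lborel)
      = (\<integral>\<^sup>+x. ?l A * indicator B (U x) \<partial>lborel)"
  proof (rule nn_integral_cong)
    fix x :: 'a
    have "(\<integral>\<^sup>+y. indicator A (U x + y) * indicator B (U x) \<partial>lborel)
        = (\<integral>\<^sup>+y. indicator A (y + U x) \<partial>lborel) * (indicator B (U x) :: ennreal)"
      by (subst nn_integral_multc) (auto simp: add.commute)
    also have "(\<integral>\<^sup>+y. indicator A (y + U x) \<partial>lborel) = ?l A"
      by (subst nn_integral_lborel_shift[where g = "indicator A"]) auto
    finally show "(\<integral>\<^sup>+y. indicator A (U x + y) * indicator B (U x) \<partial>lborel) = ?l A * indicator B (U x)" .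
  qed
  also have "\<dots> = ?l A * ?l B"
    by (simp add: BU nn_integral_cmult)
  finally have 1: "(\<integral>\<^sup>+x. \<integral>\<^sup>+y. indicator A (U x + y) * indicator B (U x) \<partial>lborel \<partial>lborel) = ?l A * ?l B" .
  have "(\<integral>\<^sup>+x. \<integral>\<^sup>+y. indicator A (U x + y) * indicator B (U x) \<partial>lborel \<partial>lborel)
      = (\<integral>\<^sup>+y. \<integral>\<^sup>+x. indicator A (U x + y) * indicator B (U x) \<partial>lborel \<partial>lborel)"
    by (rule lborel_pair.Fubini'[symmetric]) measurable
  also have "\<dots> = (\<integral>\<^sup>+y. \<integral>\<^sup>+x. indicator A (U x) * indicator B (U x - y) \<partial>lborel \<partial>lborel)"
  proof (rule nn_integral_cong)
    fix y :: 'a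
    obtain w where w: "y = U w" using orthogonal_transformation_surj[OF U] by (metis surj_def)
    have "(\<integral>\<^sup>+x. indicator A (U x) * indicator B (U x - y) \<partial>lborel)
        = (\<integral>\<^sup>+x. indicator A (U (x + w)) * (indicator B (U (x + w) - y) :: ennreal) \<partial>lborel)"
      by (subst nn_integral_lborel_shift[where g = "\<lambda>x. indicator A (U x) * indicator B (U x - y)"]) auto
    then show "(\<integral>\<^sup>+x. indicator A (U x + y) * indicator B (U x) \<partial>lborel)
       = (\<integral>\<^sup>+x. indicator A (U x) * (indicator B (U x - y) :: ennreal) \<partial>lborel)"
      by (simp add: linear_add[OF linU] w)
  qed
  also have "\<dots> = (\<integral>\<^sup>+x. \<integral>\<^sup>+y. indicator A (U x) * indicator B (U x - y) \<partial>lborel \<partial>lborel)"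
    by (rule lborel_pair.Fubini') measurable
  also have "\<dots> = (\<integral>\<^sup>+x. indicator A (U x) * ?l B \<partial>lborel)"
  proof (rule nn_integral_cong)
    fix x :: 'a
    have "(\<integral>\<^sup>+y. indicator A (U x) * indicator B (U x - y) \<partial>lborel)
      = indicator A (U x) * (\<integral>\<^sup>+y. (indicator B (U x - y) :: ennreal) \<partial>lborel)"
      by (subst nn_integral_cmult) auto
    also have "(\<integral>\<^sup>+y. (indicator B (U x - y) :: ennreal) \<partial>lborel) = (\<integral>\<^sup>+y. indicator B (y + (- U x)) \<partial>lborel)"
      using Bsym[of "U x - _"] by simp
    also have "\<dots> = ?l B"
      by (subst nn_integral_lborel_shift[where g = "indicator B"]) auto
    finally show "(\<integral>\<^sup>+y. indicator A (U x) * indicator B (U x - y) \<partial>lborel) = indicator A (U x) * ?l B" .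
  qed
  also have "\<dots> = emeasure (distr lborel borel U) A * ?l B"
  proof -
    have "(\<integral>\<^sup>+x. indicator A (U x) \<partial>lborel) = emeasure (distr lborel borel U) A"
      by (simp add: nn_integral_distr flip: nn_integral_indicator)
    then show ?thesis by (simp add: nn_integral_multc)
  qed
  finally have "emeasure (distr lborel borel U) A * ?l B = ?l A * ?l B" using 1 by simp
  then show "emeasure (distr lborel borel U) A = emeasure lborel A"
    using B0 Bfin using ennreal_mult_cancel_left[of "?l B" "emeasure (distr lborel borel U) A" "?l A"] by (auto simp: mult.commute[of _ "?l B"])
qed

lemma sets_sphere_measure: "sets (sphere_measure :: (complex^'N) measure) = sets (restrict_space borel (sphere 0 1))"
  by (simp add: sphere_measure_def sets_restrict_space)

lemma space_sphere_measure: "space (sphere_measure :: (complex^'N) measure) = sphere 0 1"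
  by (simp add: sphere_measure_def space_restrict_space)

lemma borel_measurable_sgn_euclidean [measurable]:
  "(sgn :: 'a::euclidean_space \<Rightarrow> 'a) \<in> borel_measurable borel"
  unfolding sgn_div_norm[abs_def] by measurable

lemma emeasure_sphere_measure:
  fixes A :: "(complex^'N) set"
  assumes A: "A \<in> sets borel" "A \<subseteq> sphere 0 1"
  shows "emeasure sphere_measure A = emeasure lborel {x \<in> ball 0 1. sgn x \<in> A} / emeasure lborel (ball 0 1 :: (complex^'N) set)"
proof -
  have "emeasure sphere_measure A = emeasure (distr (uniform_measure lborel (ball 0 1)) borel sgn) A"
    unfolding sphere_measure_def using A by (intro emeasure_restrict_space) auto
  also have "\<dots> = emeasure (uniform_measure lborel (ball 0 1)) (sgn -` A)"
    using A by (subst emeasure_distr) (auto intro!: measurableI measurable_sets_borel)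
  also have "\<dots> = emeasure lborel (ball 0 1 \<inter> sgn -` A) / emeasure lborel (ball 0 1 :: (complex^'N) set)"
    using A measurable_sets[OF borel_measurable_sgn_euclidean, of A] by (subst emeasure_uniform_measure) auto
  finally show ?thesis by (simp add: Int_def vimage_def)
qed

lemma emeasure_sphere_measure_space:
  "emeasure (sphere_measure :: (complex^'N) measure) (sphere 0 1) \<le> 1"
proof -
  have "emeasure lborel {x \<in> ball 0 1 :: (complex^'N) set. sgn x \<in> sphere 0 1} \<le> emeasure lborel (ball 0 1 :: (complex^'N) set)"
    by (intro emeasure_mono) auto
  then show ?thesis
    using open_not_negligible[of "ball 0 1 :: (complex^'N) set"]
    by (subst emeasure_sphere_measure)
      (auto intro!: divide_le_posI_ennreal simp: negligible_iff_emeasure0 zero_less_iff_neq_zero)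
qed

lemma sgn_orthogonal: "orthogonal_transformation U \<Longrightarrow> sgn (U x) = U (sgn x)"
  by (auto simp: orthogonal_transformation sgn_div_norm linear_cmul)

lemma measurable_orthogonal_sphere:
  assumes U: "orthogonal_transformation (U :: complex^'N \<Rightarrow> complex^'N)"
  shows "U \<in> measurable sphere_measure sphere_measure"
proof -
  have "continuous_on (sphere 0 1) U"
    using U by (intro linear_continuous_on) (simp add: orthogonal_transformation linear_conv_bounded_linear)
  then have "U \<in> borel_measurable (restrict_space borel (sphere 0 1))"
    by (rule borel_measurable_continuous_on_restrict)
  then have "U \<in> measurable (restrict_space borel (sphere 0 1)) (restrict_space borel (sphere 0 1))"
    using U by (intro measurable_restrict_space2) (auto simp: orthogonal_transformation space_restrict_space)
  then show ?thesis by (simp cong: measurable_cong_sets add: sets_sphere_measure)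
qed

lemma distr_sphere_measure_orthogonal:
  assumes U: "orthogonal_transformation (U :: complex^'N \<Rightarrow> complex^'N)"
  shows "distr sphere_measure sphere_measure U = sphere_measure"
proof (rule measure_eqI)
  show "sets (distr sphere_measure sphere_measure U) = sets sphere_measure" by simp
next
  fix A :: "(complex^'N) set" assume "A \<in> sets (distr sphere_measure sphere_measure U)"
  then have "A \<in> sets (restrict_space borel (sphere 0 1))" by (simp add: sets_sphere_measure)
  then have A: "A \<in> sets borel" "A \<subseteq> sphere 0 1"
    by (auto simp: sets_restrict_space)
  have linU: "linear U" and nU: "\<And>x. norm (U x) = norm x"
    using U by (auto simp: orthogonal_transformation)
  have mU [measurable]: "U \<in> borel_measurable borel"
    using linU by (intro borel_measurable_continuous_onI linear_continuous_on) (simp add: linear_conv_bounded_linear)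
  have UA: "U -` A \<in> sets borel" using measurable_sets[OF mU A(1)] by simp
  have eq: "U -` A \<inter> sphere 0 1 = U -` A" using A(2) by (auto simp: nU subset_eq dist_norm)
  have sub: "U -` A \<subseteq> sphere 0 1" using eq by blast
  have m: "{x \<in> ball 0 1. sgn x \<in> A} \<in> sets borel"
  proof -
    have "{x \<in> ball 0 1. sgn x \<in> A} = ball 0 1 \<inter> sgn -` A" by auto
    then show ?thesis using measurable_sets[OF borel_measurable_sgn_euclidean A(1)] by auto
  qed
  have "emeasure (distr sphere_measure sphere_measure U) A = emeasure sphere_measure (U -` A)"
    using A measurable_orthogonal_sphere[OF U]
    by (subst emeasure_distr) (auto simp: space_sphere_measure eq sets_sphere_measure sets_restrict_space)
  also have "\<dots> = emeasure lborel {x \<in> ball 0 1. sgn x \<in> U -` A} / emeasure lborel (ball 0 1 :: (complex^'N) set)"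
    by (rule emeasure_sphere_measure[OF UA sub])
  also have "{x \<in> ball 0 1. sgn x \<in> U -` A} = U -` {x \<in> ball 0 1. sgn x \<in> A}"
    by (auto simp: sgn_orthogonal[OF U] nU)
  also have "emeasure lborel \<dots> = emeasure (distr lborel borel U) {x \<in> ball 0 1. sgn x \<in> A}"
    using m by (subst emeasure_distr) auto
  also have "\<dots> = emeasure lborel {x \<in> ball 0 1. sgn x \<in> A}"
    by (simp add: lborel_distr_orthogonal[OF U])
  also have "\<dots> / emeasure lborel (ball 0 1 :: (complex^'N) set) = emeasure sphere_measure A"
    by (rule emeasure_sphere_measure[OF A, symmetric])
  finally show "emeasure (distr sphere_measure sphere_measure U) A = emeasure sphere_measure A" .
qed

section \<open>The norm of \<open>L\<^sup>p\<close> of the sphere on continuous functions\<close>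

text \<open>Convexity up to the boundary point 0, where the convexity of \<open>powr\<close> on the open half-line says nothing.\<close>

lemma powr_convex_nonneg:
  fixes x y t :: real
  assumes "1 \<le> P" "0 \<le> x" "0 \<le> y" "0 \<le> t" "t \<le> 1"
  shows "((1 - t) * x + t * y) powr P \<le> (1 - t) * x powr P + t * y powr P"
proof -
  have le: "s powr P \<le> s" if "0 \<le> s" "s \<le> 1" for s :: real
    using powr_mono'[of 1 P s] that assms(1) by (cases "s = 0") auto
  have aux: "(s * x) powr P \<le> s * x powr P" if "0 \<le> x" "0 \<le> s" "s \<le> 1" for s x :: real
    using le[of s] that by (simp add: powr_mult mult_right_mono)
  show ?thesis
  proof (cases "x = 0 \<or> y = 0")
    case True
    then show ?thesis using aux[of y t] aux[of x "1 - t"] assms by auto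
  next
    case False
    then show ?thesis
      using convex_onD[OF powr_convex[OF assms(1)], of t x y] assms by auto
  qed
qed

lemma borel_measurable_sphere_measure:
  fixes g :: "complex^'N \<Rightarrow> complex"
  assumes "continuous_on (sphere 0 1) g"
  shows "g \<in> borel_measurable sphere_measure"
  using borel_measurable_continuous_on_restrict[OF assms]
  by (simp cong: measurable_cong_sets add: sets_sphere_measure)

lemma enn_powr_mono: "0 \<le> a \<Longrightarrow> x \<le> y \<Longrightarrow> enn_powr x a \<le> enn_powr y a"
  unfolding enn_powr_def
  by (auto intro!: ennreal_leI powr_mono2 enn2real_mono simp: top.extremum_uniqueI less_top)

lemma enn_powr_ennreal: "0 \<le> x \<Longrightarrow> enn_powr (ennreal x) a = ennreal (x powr a)"
  by (simp add: enn_powr_def)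

lemma enn_powr_less_top_iff: "enn_powr x a < \<infinity> \<longleftrightarrow> x < \<infinity>"
  by (simp add: enn_powr_def less_top)

lemma enn2real_ge_1: "1 \<le> p \<Longrightarrow> p \<noteq> \<infinity> \<Longrightarrow> 1 \<le> enn2real p"
  by (cases p) auto

text \<open>The norm as a real number; on continuous functions the mean is finite, so nothing is lost.\<close>

definition Lp_norm :: "ennreal \<Rightarrow> (complex^'N \<Rightarrow> complex) \<Rightarrow> real" where
  "Lp_norm p g = enn2real (int_mean p 1 g)"

lemma Lp_norm_nonneg [simp]: "0 \<le> Lp_norm p g"
  by (simp add: Lp_norm_def)

lemma int_mean_unit: "int_mean p r g = int_mean p 1 (\<lambda>z. g (r *\<^sub>R z))"
  by (simp add: int_mean_def)

lemma int_mean_bound: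
  fixes g :: "complex^'N \<Rightarrow> complex"
  assumes p: "1 \<le> p" and g: "continuous_on (sphere 0 1) g"
    and B: "\<And>z. norm z = 1 \<Longrightarrow> norm (g z) \<le> B" and B0: "0 \<le> B"
  shows "int_mean p 1 g \<le> ennreal B"
proof (cases "p = \<infinity>")
  case True
  note [measurable] = borel_measurable_sphere_measure[OF g]
  show ?thesis using B
    by (auto simp: True int_mean_def space_sphere_measure intro!: esssup_I AE_I2 ennreal_leI)
next
  case False
  define P where "P = enn2real p"
  have P: "1 \<le> P" unfolding P_def by (rule enn2real_ge_1[OF p False])
  have "(\<integral>\<^sup>+z. ennreal (norm (g z) powr P) \<partial>sphere_measure) \<le> (\<integral>\<^sup>+z. ennreal (B powr P) \<partial>(sphere_measure :: (complex^'N) measure))"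
    using B P by (intro nn_integral_mono) (auto simp: space_sphere_measure intro!: ennreal_leI powr_mono2)
  also have "\<dots> \<le> ennreal (B powr P)"
    using mult_left_mono[OF emeasure_sphere_measure_space, of "ennreal (B powr P)"]
    by (simp add: space_sphere_measure)
  finally have "enn_powr (\<integral>\<^sup>+z. ennreal (norm (g z) powr P) \<partial>sphere_measure) (1/P) \<le> enn_powr (ennreal (B powr P)) (1/P)"
    using P by (intro enn_powr_mono) auto
  also have "\<dots> = ennreal B" using P B0 by (simp add: enn_powr_ennreal powr_powr)
  finally show ?thesis using False by (simp add: int_mean_def P_def)
qed

lemma continuous_sphere_bounded:
  fixes g :: "complex^'N \<Rightarrow> complex"
  assumes "continuous_on (sphere 0 1) g"
  obtains B where "0 \<le> B" "\<And>z. norm z = 1 \<Longrightarrow> norm (g z) \<le> B"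
proof -
  have "bounded (g ` sphere 0 1)"
    using assms by (intro compact_imp_bounded compact_continuous_image) auto
  then obtain B where "0 < B" "\<forall>y\<in>g ` sphere 0 1. norm y \<le> B" unfolding bounded_pos by auto
  then show ?thesis by (intro that[of B]) (auto simp: dist_norm)
qed

lemma int_mean_Lp_norm:
  fixes g :: "complex^'N \<Rightarrow> complex"
  assumes p: "1 \<le> p" and g: "continuous_on (sphere 0 1) g"
  shows "int_mean p 1 g = ennreal (Lp_norm p g)"
proof -
  obtain B where "0 \<le> B" "\<And>z. norm z = 1 \<Longrightarrow> norm (g z) \<le> B"
    using continuous_sphere_bounded[OF g] by blast
  then have "int_mean p 1 g \<le> ennreal B" by (intro int_mean_bound p g)
  then have "int_mean p 1 g < top" using ennreal_less_top le_less_trans by blast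
  then show ?thesis by (simp add: Lp_norm_def ennreal_enn2real)
qed

lemma Lp_norm_bound:
  fixes g :: "complex^'N \<Rightarrow> complex"
  assumes p: "1 \<le> p" and g: "continuous_on (sphere 0 1) g"
    and B: "\<And>z. norm z = 1 \<Longrightarrow> norm (g z) \<le> B" and B0: "0 \<le> B"
  shows "Lp_norm p g \<le> B"
  using int_mean_bound[OF assms] B0 by (simp add: int_mean_Lp_norm[OF p g])

lemma Lp_norm_cmult_le:
  fixes g :: "complex^'N \<Rightarrow> complex"
  assumes p: "1 \<le> p" and g: "continuous_on (sphere 0 1) g"
  shows "Lp_norm p (\<lambda>z. c * g z) \<le> norm c * Lp_norm p g"
proof -
  have cg: "continuous_on (sphere 0 1) (\<lambda>z. c * g z)" using g by (intro continuous_intros)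
  note [measurable] = borel_measurable_sphere_measure[OF g]
  have "int_mean p 1 (\<lambda>z. c * g z) \<le> ennreal (norm c) * int_mean p 1 g"
  proof (cases "p = \<infinity>")
    case True
    have "AE z in sphere_measure. ennreal (norm (c * g z)) \<le> ennreal (norm c) * int_mean p 1 g"
      using esssup_AE[of "\<lambda>z. ennreal (norm (g z))" sphere_measure]
      by eventually_elim (simp add: True int_mean_def norm_mult ennreal_mult mult_left_mono)
    then show ?thesis by (simp add: True int_mean_def esssup_I)
  next
    case False
    define P where "P = enn2real p"
    have P: "1 \<le> P" unfolding P_def by (rule enn2real_ge_1[OF p False])
    define I where "I = (\<integral>\<^sup>+z. ennreal (norm (g z) powr P) \<partial>sphere_measure)"
    have m: "int_mean p 1 g = enn_powr I (1/P)" using False by (simp add: int_mean_def I_def P_def)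
    have fin: "I < \<infinity>" using int_mean_Lp_norm[OF p g] unfolding m by (metis enn_powr_less_top_iff ennreal_less_top infinity_ennreal_def)
    have "(\<integral>\<^sup>+z. ennreal (norm (c * g z) powr P) \<partial>sphere_measure) = ennreal (norm c powr P) * I"
      unfolding I_def by (subst nn_integral_cmult[symmetric]) (auto simp: norm_mult powr_mult ennreal_mult)
    also have "\<dots> = ennreal (norm c powr P * enn2real I)"
      using fin by (simp add: ennreal_mult ennreal_enn2real)
    finally have "int_mean p 1 (\<lambda>z. c * g z) = ennreal ((norm c powr P * enn2real I) powr (1/P))"
      using False by (simp add: int_mean_def P_def[symmetric] enn_powr_ennreal)
    also have "\<dots> = ennreal (norm c * (enn2real I) powr (1/P))"
      using P by (simp add: powr_mult powr_powr)
    also have "\<dots> = ennreal (norm c) * int_mean p 1 g"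
      using less_imp_neq[OF fin] by (simp add: m enn_powr_def ennreal_mult)
    finally show ?thesis by simp
  qed
  then have "ennreal (Lp_norm p (\<lambda>z. c * g z)) \<le> ennreal (norm c * Lp_norm p g)"
    by (simp add: int_mean_Lp_norm p g cg ennreal_mult)
  then show ?thesis by (subst (asm) ennreal_le_iff) simp_all
qed

text \<open>Minkowski's inequality from convexity: \<open>|g + h| / (a + b)\<close> is at most a convex combination of \<open>|g| / a\<close>
  and \<open>|h| / b\<close>, where \<open>a\<close> and \<open>b\<close> are the norms.\<close>

lemma Lp_norm_triangle:
  fixes g :: "complex^'N \<Rightarrow> complex"
  assumes p: "1 \<le> p" and g: "continuous_on (sphere 0 1) g" and h: "continuous_on (sphere 0 1) h"
  shows "Lp_norm p (\<lambda>z. g z + h z) \<le> Lp_norm p g + Lp_norm p h"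
proof -
  have gh: "continuous_on (sphere 0 1) (\<lambda>z. g z + h z)" using g h by (intro continuous_intros)
  note [measurable] = borel_measurable_sphere_measure[OF g] borel_measurable_sphere_measure[OF h]
  show ?thesis
  proof (cases "p = \<infinity>")
    case True
    have "AE z in sphere_measure. ennreal (norm (g z + h z)) \<le> int_mean p 1 g + int_mean p 1 h"
      using esssup_AE[of "\<lambda>z. ennreal (norm (g z))" sphere_measure] esssup_AE[of "\<lambda>z. ennreal (norm (h z))" sphere_measure]
    proof eventually_elim
      case (elim z)
      have "ennreal (norm (g z + h z)) \<le> ennreal (norm (g z)) + ennreal (norm (h z))"
        by (simp flip: ennreal_plus add: ennreal_leI norm_triangle_ineq)
      then show ?case using add_mono[OF elim] by (simp add: True int_mean_def)
    qed
    then have "int_mean p 1 (\<lambda>z. g z + h z) \<le> int_mean p 1 g + int_mean p 1 h"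
      by (simp add: True int_mean_def esssup_I)
    then show ?thesis
      by (simp add: int_mean_Lp_norm p g h gh flip: ennreal_plus)
  next
    case False
    define P where "P = enn2real p"
    have P: "1 \<le> P" unfolding P_def by (rule enn2real_ge_1[OF p False])
    define I where "I = (\<lambda>g :: complex^'N \<Rightarrow> complex. \<integral>\<^sup>+z. ennreal (norm (g z) powr P) \<partial>sphere_measure)"
    have m: "int_mean p 1 g = enn_powr (I g) (1/P)" for g using False by (simp add: int_mean_def I_def P_def)
    have le: "I g \<le> ennreal (a powr P)" if "continuous_on (sphere 0 1) g" "Lp_norm p g \<le> a" for g a
    proof -
      have fin: "I g < \<infinity>" using int_mean_Lp_norm[OF p that(1)] unfolding m by (metis enn_powr_less_top_iff ennreal_less_top infinity_ennreal_def)
      then have "Lp_norm p g = enn2real (I g) powr (1/P)" using less_imp_neq[OF fin] by (simp add: Lp_norm_def m enn_powr_def)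
      then have "enn2real (I g) = Lp_norm p g powr P" using P by (simp add: powr_powr)
      then have "I g = ennreal (Lp_norm p g powr P)" using fin by (metis ennreal_enn2real infinity_ennreal_def)
      then show ?thesis using that P by (auto intro!: ennreal_leI powr_mono2 simp: Lp_norm_def)
    qed
    \<comment> \<open>The two norms are enlarged by \<open>e\<close> so that they can be divided by.\<close>
    have "Lp_norm p (\<lambda>z. g z + h z) \<le> Lp_norm p g + Lp_norm p h + e" if "e > 0" for e :: real
    proof -
      define a b t where "a = Lp_norm p g + e/2" and "b = Lp_norm p h + e/2" and "t = b / (a + b)"
      have ab: "0 < a" "0 < b" using that by (auto simp: a_def b_def Lp_norm_def add_nonneg_pos)
      have t: "0 \<le> t" "t \<le> 1" "1 - t = a / (a + b)" using ab by (auto simp: t_def field_simps)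
      have pw: "norm (g z + h z) powr P \<le> (a+b) powr P * ((1 - t) / a powr P) * norm (g z) powr P
          + (a+b) powr P * (t / b powr P) * norm (h z) powr P" for z
      proof -
        have "norm (g z + h z) powr P \<le> (norm (g z) + norm (h z)) powr P"
          using P by (intro powr_mono2 norm_triangle_ineq) auto
        also have "norm (g z) + norm (h z) = (a + b) * ((1 - t) * (norm (g z) / a) + t * (norm (h z) / b))"
        proof -
          have "(a + b) * (1 - t) = a" "(a + b) * t = b" using ab unfolding t(3) by (auto simp: t_def)
          then have "(a + b) * ((1 - t) * (norm (g z) / a) + t * (norm (h z) / b)) = a * (norm (g z) / a) + b * (norm (h z) / b)"
            by (simp only: distrib_left mult.assoc[symmetric])
          then show ?thesis using ab by simp
        qed
        also have "\<dots> powr P = (a+b) powr P * ((1 - t) * (norm (g z) / a) + t * (norm (h z) / b)) powr P"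
          using ab t by (subst powr_mult) auto
        also have "\<dots> \<le> (a+b) powr P * ((1 - t) * (norm (g z) / a) powr P + t * (norm (h z) / b) powr P)"
          using ab t P by (intro mult_left_mono powr_convex_nonneg) auto
        finally show ?thesis using ab by (simp add: powr_divide algebra_simps)
      qed
      define c d where "c = (a+b) powr P * ((1 - t) / a powr P)" and "d = (a+b) powr P * (t / b powr P)"
      have cd: "0 \<le> c" "0 \<le> d" using t(1,2) by (auto simp: c_def d_def)
      have "c * a powr P = (a+b) powr P * (1 - t)" "d * b powr P = (a+b) powr P * t"
        using ab by (auto simp: c_def d_def)
      then have sum: "c * a powr P + d * b powr P = (a+b) powr P" by (simp add: algebra_simps)
      have "I (\<lambda>z. g z + h z) \<le> (\<integral>\<^sup>+z. ennreal c * ennreal (norm (g z) powr P)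
          + ennreal d * ennreal (norm (h z) powr P) \<partial>sphere_measure)"
        unfolding I_def
      proof (rule nn_integral_mono)
        fix z :: "complex^'N"
        show "ennreal (norm (g z + h z) powr P) \<le> ennreal c * ennreal (norm (g z) powr P)
          + ennreal d * ennreal (norm (h z) powr P)"
          using pw[of z, folded c_def d_def] cd by (simp flip: ennreal_plus ennreal_mult add: ennreal_leI)
      qed
      also have "\<dots> = ennreal c * I g + ennreal d * I h"
        unfolding I_def by (simp add: nn_integral_add nn_integral_cmult)
      also have "\<dots> \<le> ennreal c * ennreal (a powr P) + ennreal d * ennreal (b powr P)"
        using that by (intro add_mono mult_left_mono le g h) (auto simp: a_def b_def)
      also have "\<dots> = ennreal ((a+b) powr P)"
        using cd sum by (simp flip: ennreal_plus ennreal_mult)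
      finally have "enn_powr (I (\<lambda>z. g z + h z)) (1/P) \<le> enn_powr (ennreal ((a+b) powr P)) (1/P)"
        using P by (intro enn_powr_mono) auto
      then have "int_mean p 1 (\<lambda>z. g z + h z) \<le> ennreal (a + b)"
        using P ab by (simp add: m enn_powr_ennreal powr_powr)
      then have "Lp_norm p (\<lambda>z. g z + h z) \<le> a + b"
        using ab by (simp add: int_mean_Lp_norm[OF p gh] del: ennreal_plus)
      then show ?thesis by (simp add: a_def b_def)
    qed
    then show ?thesis by (rule field_le_epsilon)
  qed
qed

lemma Lp_norm_orthogonal:
  fixes g :: "complex^'N \<Rightarrow> complex"
  assumes p: "1 \<le> p" and g: "continuous_on (sphere 0 1) g" and U: "orthogonal_transformation (U :: complex^'N \<Rightarrow> complex^'N)"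
  shows "Lp_norm p (\<lambda>z. g (U z)) = Lp_norm p g"
proof -
  note mg [measurable] = borel_measurable_sphere_measure[OF g]
  note mU = measurable_orthogonal_sphere[OF U]
  note mgU [measurable] = measurable_compose[OF mU mg]
  have int: "(\<integral>\<^sup>+z. \<phi> (g (U z)) \<partial>sphere_measure) = (\<integral>\<^sup>+z. \<phi> (g z) \<partial>sphere_measure)"
    if [measurable]: "\<phi> \<in> borel_measurable borel" for \<phi> :: "complex \<Rightarrow> ennreal"
  proof -
    have "(\<integral>\<^sup>+z. \<phi> (g z) \<partial>sphere_measure) = (\<integral>\<^sup>+z. \<phi> (g z) \<partial>distr sphere_measure sphere_measure U)"
      by (simp add: distr_sphere_measure_orthogonal[OF U])
    also have "\<dots> = (\<integral>\<^sup>+z. \<phi> (g (U z)) \<partial>sphere_measure)"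
      by (rule nn_integral_distr[OF mU]) measurable
    finally show ?thesis by simp
  qed
  have "int_mean p 1 (\<lambda>z. g (U z)) = int_mean p 1 g"
  proof (cases "p = \<infinity>")
    case True
    have "emeasure sphere_measure {x \<in> space sphere_measure. z < ennreal (norm (g (U x)))}
        = emeasure sphere_measure {x \<in> space sphere_measure. z < ennreal (norm (g x))}" for z
    proof -
      let ?S = "{x \<in> space sphere_measure. z < ennreal (norm (g x))}"
      have "emeasure sphere_measure ?S = emeasure (distr sphere_measure sphere_measure U) ?S"
        by (simp add: distr_sphere_measure_orthogonal[OF U])
      also have "\<dots> = emeasure sphere_measure (U -` ?S \<inter> space sphere_measure)"
        by (rule emeasure_distr[OF mU]) measurable
      also have "U -` ?S \<inter> space sphere_measure = {x \<in> space sphere_measure. z < ennreal (norm (g (U x)))}"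
        using U by (auto simp: space_sphere_measure orthogonal_transformation)
      finally show ?thesis by simp
    qed
    moreover have "(\<lambda>x. ennreal (norm (g (U x)))) \<in> borel_measurable sphere_measure"
      "(\<lambda>x. ennreal (norm (g x))) \<in> borel_measurable sphere_measure" by measurable
    ultimately show ?thesis by (simp add: True int_mean_def esssup_eq)
  next
    case False
    then show ?thesis using int[of "\<lambda>w. ennreal (norm w powr enn2real p)"] by (simp add: int_mean_def)
  qed
  then show ?thesis by (simp add: Lp_norm_def)
qed

section \<open>Averages and Cauchy integrals over the unit interval\<close>

lemma integral_riemann_sum:
  fixes g :: "real \<Rightarrow> complex"
  assumes g: "continuous_on {0..1} g" and m: "m > 0"
    and e: "\<And>x y. x \<in> {0..1} \<Longrightarrow> y \<in> {0..1} \<Longrightarrow> \<bar>x - y\<bar> \<le> 1 / real m \<Longrightarrow> norm (g x - g y) \<le> e"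
  shows "norm (integral {0..1} g - (\<Sum>j<m. g (real j / real m)) / of_nat m) \<le> e"
proof -
  have *: "norm (integral {0..real k / real m} g - (\<Sum>j<k. g (real j / real m)) / of_nat m) \<le> real k * (e / real m)"
    if "k \<le> m" for k using that
  proof (induction k)
    case (Suc k)
    define a b where "a = real k / real m" and "b = real (Suc k) / real m"
    have ab: "0 \<le> a" "a \<le> b" "b \<le> 1" and ba: "b - a = 1 / real m"
      using Suc.prems m by (auto simp: a_def b_def field_simps)
    have cont: "continuous_on {a..b} g" "continuous_on {0..b} g"
      using ab by (auto intro!: continuous_on_subset[OF g])
    then have gi: "g integrable_on {0..b}" "g integrable_on {a..b}"
      by (auto intro!: integrable_continuous_real)
    have split: "integral {0..b} g = integral {0..a} g + integral {a..b} g"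
      using ab gi by (intro Henstock_Kurzweil_Integration.integral_combine[symmetric]) auto
    have "integral {a..b} (\<lambda>x. g x - g a) = integral {a..b} g - integral {a..b} (\<lambda>x. g a)"
      using gi by (intro Henstock_Kurzweil_Integration.integral_diff) auto
    also have "integral {a..b} (\<lambda>x. g a) = (b - a) *\<^sub>R g a" using ab by simp
    also have "\<dots> = g a / of_nat m" unfolding ba by (simp add: scaleR_conv_of_real)
    finally have "norm (integral {a..b} g - g a / of_nat m) = norm (integral {a..b} (\<lambda>x. g x - g a))" by simp
    also have "\<dots> \<le> e * (b - a)"
    proof (rule integral_bound)
      fix t assume "t \<in> {a..b}"
      then show "norm (g t - g a) \<le> e" using ab ba by (intro e) auto
    qed (use ab cont in \<open>auto intro!: continuous_intros\<close>)
    finally have 1: "norm (integral {a..b} g - g a / of_nat m) \<le> e / real m" unfolding ba by simp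
    have "integral {0..b} g - (\<Sum>j<Suc k. g (real j / real m)) / of_nat m
      = (integral {0..a} g - (\<Sum>j<k. g (real j / real m)) / of_nat m) + (integral {a..b} g - g a / of_nat m)"
      by (simp add: split add_divide_distrib a_def[symmetric])
    then have "norm (integral {0..b} g - (\<Sum>j<Suc k. g (real j / real m)) / of_nat m)
      \<le> norm (integral {0..a} g - (\<Sum>j<k. g (real j / real m)) / of_nat m) + norm (integral {a..b} g - g a / of_nat m)"
      by (simp only: norm_triangle_ineq)
    also have "\<dots> \<le> real k * (e / real m) + e / real m" using Suc 1 by (intro add_mono) (auto simp: a_def)
    finally show ?case by (simp add: algebra_simps add_divide_distrib b_def)
  qed simp
  from *[of m] m show ?thesis by simp
qed

text \<open>Riemann sums reduce statements about averages over a parameter to finite sums: they converge uniformly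
  in the remaining variables.\<close>

lemma uniform_riemann_sums:
  fixes k :: "real \<Rightarrow> 'a::metric_space \<Rightarrow> complex"
  assumes k: "continuous_on ({0..1} \<times> K) (\<lambda>(u, z). k u z)" and K: "compact K" and e: "e > 0"
  shows "\<exists>m0>0. \<forall>m\<ge>m0. \<forall>z\<in>K. norm (integral {0..1} (\<lambda>u. k u z) - (\<Sum>j<m. k (real j / real m) z) / of_nat m) \<le> e"
proof -
  have "uniformly_continuous_on ({0..1} \<times> K) (\<lambda>(u, z). k u z)"
    using k K by (intro compact_uniformly_continuous compact_Times) auto
  then obtain d where d: "d > 0" "\<And>p p'. p \<in> {0..1} \<times> K \<Longrightarrow> p' \<in> {0..1} \<times> K \<Longrightarrow> dist p' p < d \<Longrightarrow>
      dist ((\<lambda>(u, z). k u z) p') ((\<lambda>(u, z). k u z) p) < e"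
    unfolding uniformly_continuous_on_def using e by metis
  obtain m0 where m0: "inverse (real (Suc m0)) < d" using reals_Archimedean[OF d(1)] by blast
  show ?thesis
  proof (intro exI[of _ "Suc m0"] conjI allI impI ballI)
    fix m z assume m: "Suc m0 \<le> m" and z: "z \<in> K"
    have "1 / real m \<le> inverse (real (Suc m0))" using m by (simp add: field_simps)
    then have md: "1 / real m < d" using m0 by simp
    have "continuous_on {0..1} ((\<lambda>(u, z). k u z) \<circ> (\<lambda>u. (u, z)))"
      using z by (intro continuous_on_compose continuous_intros continuous_on_subset[OF k]) auto
    then have "continuous_on {0..1} (\<lambda>u. k u z)" by (simp add: o_def)
    then show "norm (integral {0..1} (\<lambda>u. k u z) - (\<Sum>j<m. k (real j / real m) z) / of_nat m) \<le> e"
    proof (rule integral_riemann_sum)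
      fix x y :: real assume "x \<in> {0..1}" "y \<in> {0..1}" "\<bar>x - y\<bar> \<le> 1 / real m"
      then show "norm (k x z - k y z) \<le> e"
        using d(2)[of "(y, z)" "(x, z)"] z md by (simp add: dist_Pair_Pair dist_norm less_imp_le)
    qed (use m in auto)
  qed auto
qed

definition circ :: "real \<Rightarrow> complex" where "circ u = exp (2 * of_real pi * \<i> * of_real u)"

lemma norm_circ [simp]: "norm (circ u) = 1"
  by (simp add: circ_def norm_exp_eq_Re)

lemma circ_nonzero [simp]: "circ u \<noteq> 0"
  by (simp add: circ_def)

lemma continuous_on_circ [continuous_intros]: "continuous_on S f \<Longrightarrow> continuous_on S (\<lambda>x. circ (f x))"
  unfolding circ_def by (intro continuous_intros)

lemma circlepath_0: "circlepath 0 r u = of_real r * circ u"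
  by (simp add: circlepath circ_def mult.assoc)

lemma Taylor_coeff_integral:
  assumes contF: "continuous_on (cball 0 r) F" and holF: "F holomorphic_on ball 0 r" and r: "0 < r"
  shows "((\<lambda>u. F (of_real r * circ u) / (of_real r * circ u) ^ k) has_integral ((deriv ^^ k) F 0 / fact k)) {0..1}"
proof -
  have "((\<lambda>u. F u / (u - 0) ^ Suc k) has_contour_integral ((2 * pi * \<i>) / (fact k) * (deriv ^^ k) F 0)) (circlepath 0 r)"
    using assms by (intro Cauchy_has_contour_integral_higher_derivative_circlepath) auto
  then have "((\<lambda>u. F (circlepath 0 r u) / (circlepath 0 r u) ^ Suc k * vector_derivative (circlepath 0 r) (at u within {0..1}))
      has_integral ((2 * pi * \<i>) / (fact k) * (deriv ^^ k) F 0)) {0..1}"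
    by (simp add: has_contour_integral_def)
  then have "((\<lambda>u. (2 * pi * \<i>) * (F (of_real r * circ u) / (of_real r * circ u) ^ k))
      has_integral ((2 * pi * \<i>) / (fact k) * (deriv ^^ k) F 0)) {0..1}"
    by (rule has_integral_eq[rotated]) (use r in \<open>simp add: vector_derivative_circlepath01 circlepath_0 circ_def[symmetric]\<close>)
  from has_integral_mult_right[OF this, of "1 / (2 * pi * \<i>)"] show ?thesis
    by (simp add: field_simps)
qed

lemma mean_value_circ:
  assumes "continuous_on (cball 0 1) F" "F holomorphic_on ball 0 1"
  shows "integral {0..1} (\<lambda>u. F (circ u)) = F 0"
  using Taylor_coeff_integral[OF assms, of 0] by (simp add: integral_unique)

section \<open>Holomorphic slices and the radial derivative\<close>

lemma norm_vector_scalar_mult [simp]: "norm (l *s z) = norm l * norm (z :: complex^'N)"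
  by (simp add: norm_vec_def L2_set_right_distrib norm_mult)

lemma scaleR_eq_smult: "r *\<^sub>R z = of_real r *s (z :: complex^'N)"
  by (simp add: vec_eq_iff scaleR_conv_of_real[symmetric])

lemma continuous_on_smult [continuous_intros]:
  fixes g :: "'a::topological_space \<Rightarrow> complex^'N"
  assumes "continuous_on S l" "continuous_on S g"
  shows "continuous_on S (\<lambda>x. l x *s g x)"
  unfolding vector_scalar_mult_def using assms by (auto intro!: continuous_intros)

text \<open>Holomorphy on all complex lines through the origin, together with joint continuity. Unlike full
  holomorphy, this class is visibly stable under the radial derivative, since only one-variable theory is
  involved; all estimates along the radius are proved in it.\<close>

definition slice_holomorphic :: "(complex^'N \<Rightarrow> complex) \<Rightarrow> bool" where
  "slice_holomorphic h \<longleftrightarrow> continuous_on (ball 0 1) h \<and>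
     (\<forall>z. (\<lambda>l. h (l *s z)) holomorphic_on {l. norm (l *s z) < 1})"

text \<open>The radial derivative \<open>\<Sum>\<^sub>j z\<^sub>j \<partial>\<^sub>j h\<close>, which multiplies the homogeneous part of degree \<open>k\<close> by \<open>k\<close>.\<close>

definition Rad :: "(complex^'N \<Rightarrow> complex) \<Rightarrow> complex^'N \<Rightarrow> complex" where
  "Rad h z = deriv (\<lambda>l. h (l *s z)) 1"

lemma open_slice: "open {l. norm (l *s (z :: complex^'N)) < 1}"
  by (intro open_Collect_less continuous_intros)

lemma slice_has_derivative:
  assumes h: "slice_holomorphic h" and l: "norm (l *s z) < 1"
  shows "((\<lambda>l. h (l *s z)) has_field_derivative deriv (\<lambda>l. h (l *s z)) l) (at l)"
  using h l holomorphic_derivI[OF _ open_slice[of z], of "\<lambda>l. h (l *s z)" l]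
  by (auto simp: slice_holomorphic_def)

lemma Rad_slice:
  assumes h: "slice_holomorphic h" and l: "norm (l *s z) < 1"
  shows "Rad h (l *s z) = l * deriv (\<lambda>l. h (l *s z)) l"
proof -
  have "((\<lambda>u. h ((u * l) *s z)) has_field_derivative deriv (\<lambda>l. h (l *s z)) (1 * l) * l) (at 1)"
    by (rule DERIV_chain2[where g = "\<lambda>u. u * l"])
      (use slice_has_derivative[OF h, of "1 * l" z] l in \<open>auto intro!: derivative_eq_intros\<close>)
  then show ?thesis unfolding Rad_def
    by (intro DERIV_imp_deriv) (simp add: vector_smult_assoc mult.commute)
qed

text \<open>In the logarithmic coordinate \<open>w\<close> on a slice the radial derivative is the ordinary derivative.\<close>

lemma slice_exp_derivative:
  assumes h: "slice_holomorphic h" and w: "norm (exp w *s z) < 1"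
  shows "((\<lambda>w. h (exp w *s z)) has_field_derivative Rad h (exp w *s z)) (at w)"
proof -
  have "((\<lambda>w. h (exp w *s z)) has_field_derivative deriv (\<lambda>l. h (l *s z)) (exp w) * exp w) (at w)"
    by (rule DERIV_chain2[where g = exp and f = "\<lambda>l. h (l *s z)"]) (use slice_has_derivative[OF h w] in auto)
  then show ?thesis by (simp add: Rad_slice[OF h w] mult.commute)
qed

lemma continuous_on_slice_param:
  fixes l :: "'a::topological_space \<Rightarrow> complex" and g :: "'a \<Rightarrow> complex^'N"
  assumes h: "continuous_on (ball 0 1) h" and "continuous_on S l" "continuous_on S g"
    and "\<And>x. x \<in> S \<Longrightarrow> norm (l x *s g x) < 1"
  shows "continuous_on S (\<lambda>x. h (l x *s g x))"
  by (rule continuous_on_compose2[OF h]) (use assms in \<open>auto intro!: continuous_intros\<close>)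

lemma norm_exp_smult_less_1:
  fixes z :: "complex^'N"
  assumes "norm w \<le> s" "exp s * norm z < 1"
  shows "norm (exp w *s z) < 1"
proof -
  have "norm (exp w) \<le> exp s" using assms(1) by (simp add: norm_exp_eq_Re order_trans[OF complex_Re_le_cmod])
  then have "norm (exp w) * norm z \<le> exp s * norm z" by (intro mult_right_mono) auto
  then show ?thesis using assms(2) by simp
qed

text \<open>Cauchy's formula for the first derivative in the logarithmic coordinate. It expresses \<open>Rad h\<close> by values of
  \<open>h\<close>, which gives continuity here and the estimate of the means later.\<close>

lemma Rad_Cauchy:
  assumes h: "slice_holomorphic h" and s: "0 < s" and z: "exp s * norm z < 1"
  shows "Rad h z = integral {0..1} (\<lambda>u. h (exp (of_real s * circ u) *s z) / (of_real s * circ u))"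
proof -
  have in1: "norm (exp w *s z) < 1" if "norm w \<le> s" for w
    by (rule norm_exp_smult_less_1[OF that z])
  have d: "((\<lambda>w. h (exp w *s z)) has_field_derivative Rad h (exp w *s z)) (at w)" if "norm w \<le> s" for w
    by (rule slice_exp_derivative[OF h in1[OF that]])
  have "continuous_on (cball 0 s) (\<lambda>w. h (exp w *s z))"
    by (intro continuous_at_imp_continuous_on ballI DERIV_isCont[OF d]) auto
  moreover have "(\<lambda>w. h (exp w *s z)) holomorphic_on ball 0 s"
    unfolding holomorphic_on_open[OF open_ball] using d by (metis mem_ball_0 less_imp_le)
  ultimately have "((\<lambda>u. h (exp (of_real s * circ u) *s z) / (of_real s * circ u) ^ 1) has_integral ((deriv ^^ 1) (\<lambda>w. h (exp w *s z)) 0 / fact 1)) {0..1}"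
    using s by (rule Taylor_coeff_integral)
  moreover have "deriv (\<lambda>w. h (exp w *s z)) 0 = Rad h z" using d[of 0] s by (simp add: DERIV_imp_deriv)
  ultimately show ?thesis by (simp add: integral_unique)
qed

lemma continuous_on_Rad:
  fixes h :: "complex^'N \<Rightarrow> complex"
  assumes h: "slice_holomorphic h"
  shows "continuous_on (ball 0 1) (Rad h)"
proof (intro continuous_at_imp_continuous_on ballI)
  fix z0 :: "complex^'N" assume "z0 \<in> ball 0 1"
  then obtain r where r: "norm z0 < r" "r < 1" using dense by auto
  have r0: "0 < r" using r norm_ge_zero[of z0] by linarith
  define s where "s = - ln r / 2"
  have s: "0 < s" using r r0 by (simp add: s_def)
  have sr: "exp s * r < 1"
  proof -
    have "exp s * r = exp (s + ln r)" using r0 by (simp add: exp_add)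
    also have "\<dots> < 1" using s by (simp add: s_def)
    finally show ?thesis .
  qed
  have in1: "exp s * norm z < 1" if "norm z < r" for z :: "complex^'N"
    by (rule less_trans[OF mult_strict_left_mono[OF that] sr]) simp
  have "continuous_on (ball 0 r) (\<lambda>z. integral (cbox 0 1) (\<lambda>u. h (exp (of_real s * circ u) *s z) / (of_real s * circ u)))"
  proof (rule integral_continuous_on_param)
    have "continuous_on (ball 0 r \<times> cbox 0 1) (\<lambda>x. h (exp (of_real s * circ (snd x)) *s fst x) / (of_real s * circ (snd x)))"
    proof (intro continuous_intros continuous_on_slice_param)
      show "continuous_on (ball 0 1) h" using h by (simp add: slice_holomorphic_def)
      fix x :: "(complex^'N) \<times> real" assume x: "x \<in> ball 0 r \<times> cbox 0 1"
      then show "norm (exp (of_real s * circ (snd x)) *s fst x) < 1"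
        using s by (intro norm_exp_smult_less_1[of _ s] in1) (auto simp: norm_mult)
    qed (use s in auto)
    then show "continuous_on (ball 0 r \<times> cbox 0 1) (\<lambda>(z, u). h (exp (of_real s * circ u) *s z) / (of_real s * circ u))"
      by (simp add: case_prod_unfold)
  qed
  then have "continuous_on (ball 0 r) (Rad h)"
    by (rule continuous_on_eq) (use Rad_Cauchy[OF h s in1] in auto)
  then show "isCont (Rad h) z0" using r by (auto simp: continuous_on_eq_continuous_at)
qed

lemma slice_holomorphic_Rad:
  assumes h: "slice_holomorphic h"
  shows "slice_holomorphic (Rad h)"
  unfolding slice_holomorphic_def
proof (intro conjI allI continuous_on_Rad[OF h])
  fix z
  have "(\<lambda>l. l * deriv (\<lambda>l. h (l *s z)) l) holomorphic_on {l. norm (l *s z) < 1}"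
    using h by (intro holomorphic_intros holomorphic_deriv open_slice) (auto simp: slice_holomorphic_def)
  then show "(\<lambda>l. Rad h (l *s z)) holomorphic_on {l. norm (l *s z) < 1}"
    by (rule holomorphic_transform) (use Rad_slice[OF h, of _ z] in auto)
qed

lemma slice_holomorphic_Rad_funpow: "slice_holomorphic h \<Longrightarrow> slice_holomorphic ((Rad ^^ m) h)"
  by (induction m) (auto intro: slice_holomorphic_Rad)

lemma slice_holomorphic_diff:
  "slice_holomorphic g \<Longrightarrow> slice_holomorphic h \<Longrightarrow> slice_holomorphic (\<lambda>z. g z - h z)"
  unfolding slice_holomorphic_def by (auto intro!: continuous_intros holomorphic_intros)

lemma slice_holomorphic_cmult: "slice_holomorphic h \<Longrightarrow> slice_holomorphic (\<lambda>z. c * h z)"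
  unfolding slice_holomorphic_def by (auto intro!: continuous_intros holomorphic_intros)

lemma slice_holomorphic_dilate:
  assumes h: "slice_holomorphic h" and c: "norm c \<le> 1"
  shows "slice_holomorphic (\<lambda>z. h (c *s z))"
  unfolding slice_holomorphic_def
proof (intro conjI allI)
  have in1: "norm (c *s z) \<le> norm z" for z :: "complex^'N"
    using mult_right_mono[OF c norm_ge_zero[of z]] by simp
  show "continuous_on (ball 0 1) (\<lambda>z. h (c *s z))"
  proof (rule continuous_on_slice_param)
    fix z :: "complex^'N" assume "z \<in> ball 0 1"
    then show "norm (c *s z) < 1" using in1[of z] by (simp add: dist_norm)
  qed (use h in \<open>auto simp: slice_holomorphic_def intro!: continuous_intros\<close>)
  fix z
  have "(\<lambda>l. h (l *s (c *s z))) holomorphic_on {l. norm (l *s (c *s z)) < 1}"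
    using h unfolding slice_holomorphic_def by blast
  moreover have "{l. norm (l *s z) < 1} \<subseteq> {l. norm (l *s (c *s z)) < 1}"
  proof
    fix l assume "l \<in> {l. norm (l *s z) < 1}"
    then have "norm (c *s (l *s z)) < 1" using in1[of "l *s z"] by simp
    then show "l \<in> {l. norm (l *s (c *s z)) < 1}" by (simp add: mult.left_commute mult.commute)
  qed
  ultimately have "(\<lambda>l. h (l *s (c *s z))) holomorphic_on {l. norm (l *s z) < 1}"
    by (rule holomorphic_on_subset)
  then show "(\<lambda>l. h (c *s (l *s z))) holomorphic_on {l. norm (l *s z) < 1}"
    by (simp add: vector_smult_assoc mult.commute)
qed

lemma Rad_diff:
  assumes "slice_holomorphic g" "slice_holomorphic h" "norm z < 1"
  shows "Rad (\<lambda>z. g z - h z) z = Rad g z - Rad h z"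
  unfolding Rad_def using slice_has_derivative[OF assms(1), of 1 z] slice_has_derivative[OF assms(2), of 1 z] assms(3)
  by (intro DERIV_imp_deriv derivative_intros) auto

lemma Rad_cmult:
  assumes "slice_holomorphic h" "norm z < 1"
  shows "Rad (\<lambda>z. c * h z) z = c * Rad h z"
  unfolding Rad_def using slice_has_derivative[OF assms(1), of 1 z] assms(2)
  by (intro DERIV_imp_deriv DERIV_cmult) auto

lemma Rad_dilate: "Rad (\<lambda>z. h (c *s z)) z = Rad h (c *s z)"
  by (simp add: Rad_def vector_smult_assoc mult.commute)

lemma Rad_cong:
  assumes "\<And>z. norm z < 1 \<Longrightarrow> g z = h z" "norm z < 1"
  shows "Rad g z = Rad h z"
proof -
  have "\<forall>\<^sub>F l in nhds 1. g (l *s z) = h (l *s z)"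
    using open_slice[of z] assms unfolding eventually_nhds
    by (intro exI[of _ "{l. norm (l *s z) < 1}"]) auto
  then show ?thesis unfolding Rad_def by (rule deriv_cong_ev) simp
qed

lemma slice_cont: "slice_holomorphic h \<Longrightarrow> continuous_on (ball 0 1) h"
  by (simp add: slice_holomorphic_def)

lemma norm_exp_le_1: "Re w \<le> 0 \<Longrightarrow> norm (exp w) \<le> 1"
  by (simp add: norm_exp_eq_Re)

lemma continuous_on_exp_flow:
  fixes h :: "complex^'N \<Rightarrow> complex"
  assumes h: "continuous_on (ball 0 1) h" and w: "Re w \<le> 0"
  shows "continuous_on ({0..1::real} \<times> ball 0 1) (\<lambda>(u, z). h (exp (of_real u * w) *s z))"
proof -
  have "continuous_on ({0..1::real} \<times> ball 0 1) (\<lambda>x. h (exp (of_real (fst x) * w) *s snd x))"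
  proof (rule continuous_on_slice_param[OF h])
    fix x :: "real \<times> (complex^'N)" assume x: "x \<in> {0..1} \<times> ball 0 1"
    have "norm (exp (of_real (fst x) * w)) \<le> 1"
      using x w by (auto simp: norm_exp_eq_Re mult_nonneg_nonpos)
    then show "norm (exp (of_real (fst x) * w) *s snd x) < 1"
      using x mult_right_mono[of "norm (exp (of_real (fst x) * w))" 1 "norm (snd x)"] by auto
  qed (auto intro!: continuous_intros)
  then show ?thesis by (simp add: case_prod_unfold)
qed

lemma exp_flow_integral:
  assumes h: "slice_holomorphic h" and w: "Re w \<le> 0" and z: "norm z < 1"
  shows "h (exp w *s z) - h z = integral {0..1} (\<lambda>u. w * Rad h (exp (of_real u * w) *s z))"
proof -
  have "((\<lambda>u. w * Rad h (exp (of_real u * w) *s z)) has_integral h (exp (of_real 1 * w) *s z) - h (exp (of_real 0 * w) *s z)) {0..1}"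
  proof (rule fundamental_theorem_of_calculus)
    fix u :: real assume u: "u \<in> {0..1}"
    have "norm (exp (of_real u * w)) \<le> 1" using u w by (auto simp: norm_exp_eq_Re mult_nonneg_nonpos)
    then have "norm (exp (of_real u * w) *s z) < 1"
      using z mult_right_mono[of "norm (exp (of_real u * w))" 1 "norm z"] by auto
    then have "((\<lambda>v. h (exp v *s z)) has_field_derivative Rad h (exp (of_real u * w) *s z)) (at (of_real u * w))"
      by (rule slice_exp_derivative[OF h])
    then have "((\<lambda>v. h (exp v *s z)) \<circ> (\<lambda>u. of_real u * w) has_vector_derivative w * Rad h (exp (of_real u * w) *s z)) (at u within {0..1})"
      by (intro field_vector_diff_chain_within) (auto intro!: derivative_eq_intros has_field_derivative_at_within simp: has_vector_derivative_def scaleR_conv_of_real)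
    then show "((\<lambda>u. h (exp (of_real u * w) *s z)) has_vector_derivative w * Rad h (exp (of_real u * w) *s z)) (at u within {0..1})"
      by (simp add: o_def)
  qed auto
  from integral_unique[OF this] show ?thesis by simp
qed

section \<open>Rotation invariant norms and means over spheres\<close>

text \<open>The only properties of the \<open>L\<^sup>p\<close> norms that matter: a norm on the continuous functions on the sphere that
  is dominated by the supremum and invariant under orthogonal maps. The exponent \<open>p\<close>, including \<open>p = \<infinity>\<close>,
  enters the proof through these properties alone.\<close>

locale sphere_norm =
  fixes X :: "(complex^'N \<Rightarrow> complex) \<Rightarrow> real"
  assumes nonneg [simp]: "0 \<le> X g"
    and triangle: "continuous_on (sphere 0 1) g \<Longrightarrow> continuous_on (sphere 0 1) h \<Longrightarrow> X (\<lambda>z. g z + h z) \<le> X g + X h"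
    and cmult_le: "continuous_on (sphere 0 1) g \<Longrightarrow> X (\<lambda>z. c * g z) \<le> norm c * X g"
    and bound: "continuous_on (sphere 0 1) g \<Longrightarrow> (\<And>z. norm z = 1 \<Longrightarrow> norm (g z) \<le> B) \<Longrightarrow> 0 \<le> B \<Longrightarrow> X g \<le> B"
    and orthogonal: "continuous_on (sphere 0 1) g \<Longrightarrow> orthogonal_transformation U \<Longrightarrow> X (\<lambda>z. g (U z)) = X g"
begin

lemma diff_le:
  assumes "continuous_on (sphere 0 1) g" "continuous_on (sphere 0 1) h"
  shows "X (\<lambda>z. g z - h z) \<le> X g + X h"
  using triangle[OF assms(1) continuous_on_minus[OF assms(2)]] cmult_le[OF assms(2), of "-1"] by simp

lemma close_le:
  assumes g: "continuous_on (sphere 0 1) g" and h: "continuous_on (sphere 0 1) h"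
    and e: "\<And>z. norm z = 1 \<Longrightarrow> norm (g z - h z) \<le> e" "0 \<le> e"
  shows "X g \<le> X h + e"
proof -
  have gh: "continuous_on (sphere 0 1) (\<lambda>z. g z - h z)" using g h by (intro continuous_intros)
  have "X g \<le> X h + X (\<lambda>z. g z - h z)" using triangle[OF h gh] by simp
  also have "X (\<lambda>z. g z - h z) \<le> e" by (rule bound[OF gh e])
  finally show ?thesis by simp
qed

lemma cong:
  assumes g: "continuous_on (sphere 0 1) g" and eq: "\<And>z. norm z = 1 \<Longrightarrow> g z = h z"
  shows "X g = X h"
proof -
  have h: "continuous_on (sphere 0 1) h" using eq by (intro continuous_on_eq[OF g]) auto
  show ?thesis using close_le[OF g h, of 0] close_le[OF h g, of 0] eq by force
qed

lemma sum_le: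
  assumes "finite I" "\<And>i. i \<in> I \<Longrightarrow> continuous_on (sphere 0 1) (g i)"
  shows "X (\<lambda>z. \<Sum>i\<in>I. g i z) \<le> (\<Sum>i\<in>I. X (g i))"
  using assms
proof (induction I)
  case empty then show ?case using bound[of "\<lambda>z. 0" 0] by simp
next
  case (insert i I)
  have "X (\<lambda>z. g i z + (\<Sum>i\<in>I. g i z)) \<le> X (g i) + X (\<lambda>z. \<Sum>i\<in>I. g i z)"
    using insert by (intro triangle continuous_intros) auto
  with insert show ?case by simp
qed

text \<open>A convexity principle: the norm of an average is at most the supremum of the norms. Riemann
  sums converge uniformly on the sphere, hence with respect to the norm.\<close>

lemma average_le:
  fixes k :: "real \<Rightarrow> complex^'N \<Rightarrow> complex"
  assumes k: "continuous_on ({0..1} \<times> sphere 0 1) (\<lambda>(u, z). k u z)"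
    and B: "\<And>u. u \<in> {0..1} \<Longrightarrow> X (k u) \<le> B"
  shows "X (\<lambda>z. integral {0..1} (\<lambda>u. k u z)) \<le> B"
proof (rule field_le_epsilon)
  fix e :: real assume e: "0 < e"
  obtain m where m: "m > 0" "\<And>z. z \<in> sphere 0 1 \<Longrightarrow>
      norm (integral {0..1} (\<lambda>u. k u z) - (\<Sum>j<m. k (real j / real m) z) / of_nat m) \<le> e"
    using uniform_riemann_sums[OF k compact_sphere e] by blast
  have ku: "continuous_on (sphere 0 1) (k u)" if "u \<in> {0..1}" for u
  proof -
    have "continuous_on (sphere 0 1) ((\<lambda>(u, z). k u z) \<circ> (\<lambda>z. (u, z)))"
      using that by (intro continuous_on_compose continuous_intros continuous_on_subset[OF k]) auto
    then show ?thesis by (simp add: o_def)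
  qed
  have km: "continuous_on (sphere 0 1) (k (real j / real m))" if "j < m" for j using that by (intro ku) auto
  have int: "continuous_on (sphere 0 1) (\<lambda>z. integral (cbox 0 1) (\<lambda>u. k u z))"
  proof (rule integral_continuous_on_param)
    have "continuous_on (sphere 0 1 \<times> cbox 0 1) ((\<lambda>(u, z). k u z) \<circ> (\<lambda>p. (snd p, fst p)))"
      by (intro continuous_on_compose continuous_intros continuous_on_subset[OF k]) auto
    then show "continuous_on (sphere 0 1 \<times> cbox 0 1) (\<lambda>(z, u). k u z)"
      by (simp add: o_def case_prod_unfold)
  qed
  have "X (\<lambda>z. integral {0..1} (\<lambda>u. k u z)) \<le> X (\<lambda>z. (\<Sum>j<m. k (real j / real m) z) / of_nat m) + e"
  proof (rule close_le)
    show "continuous_on (sphere 0 1) (\<lambda>z. integral {0..1} (\<lambda>u. k u z))" using int by simp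
    show "continuous_on (sphere 0 1) (\<lambda>z. (\<Sum>j<m. k (real j / real m) z) / of_nat m)"
      using m(1) by (intro continuous_intros km) auto
  qed (use m e in auto)
  also have "X (\<lambda>z. (\<Sum>j<m. k (real j / real m) z) / of_nat m) = X (\<lambda>z. (1 / of_nat m) * (\<Sum>j<m. k (real j / real m) z))"
    by simp
  also have "\<dots> \<le> norm (1 / of_nat m :: complex) * X (\<lambda>z. \<Sum>j<m. k (real j / real m) z)"
    by (intro cmult_le continuous_intros km) auto
  also have "\<dots> \<le> (1 / real m) * (\<Sum>j<m. X (k (real j / real m)))"
    using sum_le[of "{..<m}" "\<lambda>j. k (real j / real m)"] km
    by (simp add: norm_divide divide_right_mono)
  also have "\<dots> \<le> (1 / real m) * (\<Sum>j<m. B)"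
    by (intro mult_left_mono sum_mono B) auto
  also have "\<dots> = B" using m(1) by simp
  finally show "X (\<lambda>z. integral {0..1} (\<lambda>u. k u z)) \<le> B + e" by simp
qed

definition mean :: "real \<Rightarrow> (complex^'N \<Rightarrow> complex) \<Rightarrow> real" where
  "mean r h = X (\<lambda>z. h (r *\<^sub>R z))"

lemma continuous_on_mean:
  fixes h :: "complex^'N \<Rightarrow> complex"
  assumes "continuous_on (ball 0 1) h" "0 \<le> r" "r < 1"
  shows "continuous_on (sphere 0 1) (\<lambda>z. h (r *\<^sub>R z))"
  by (rule continuous_on_compose2[OF assms(1)]) (use assms in \<open>auto intro!: continuous_intros\<close>)

lemma mean_nonneg [simp]: "0 \<le> mean r h" by (simp add: mean_def)

lemma mean_add:
  assumes "continuous_on (ball 0 1) g" "continuous_on (ball 0 1) h" "0 \<le> r" "r < 1"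
  shows "mean r (\<lambda>z. g z + h z) \<le> mean r g + mean r h"
  unfolding mean_def using assms by (intro triangle continuous_on_mean)

lemma mean_diff:
  assumes "continuous_on (ball 0 1) g" "continuous_on (ball 0 1) h" "0 \<le> r" "r < 1"
  shows "mean r (\<lambda>z. g z - h z) \<le> mean r g + mean r h"
  unfolding mean_def using assms by (intro diff_le continuous_on_mean)

lemma mean_cmult_le:
  assumes "continuous_on (ball 0 1) h" "0 \<le> r" "r < 1"
  shows "mean r (\<lambda>z. c * h z) \<le> norm c * mean r h"
  unfolding mean_def using assms by (intro cmult_le continuous_on_mean)

lemma mean_cmult:
  assumes "continuous_on (ball 0 1) h" "0 \<le> r" "r < 1"
  shows "mean r (\<lambda>z. c * h z) = norm c * mean r h"
proof (cases "c = 0")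
  case True then show ?thesis using mean_cmult_le[OF assms, of 0] by (simp add: order_antisym)
next
  case False
  have "mean r h = mean r (\<lambda>z. (1/c) * (c * h z))" using False by simp
  also have "\<dots> \<le> norm (1/c) * mean r (\<lambda>z. c * h z)" using assms by (intro mean_cmult_le continuous_intros) auto
  finally have "norm c * mean r h \<le> mean r (\<lambda>z. c * h z)" using False by (simp add: norm_divide field_simps)
  then show ?thesis using mean_cmult_le[OF assms, of c] by simp
qed

lemma mean_sum:
  assumes "finite I" "\<And>i. i \<in> I \<Longrightarrow> continuous_on (ball 0 1) (g i)" "0 \<le> r" "r < 1"
  shows "mean r (\<lambda>z. \<Sum>i\<in>I. g i z) \<le> (\<Sum>i\<in>I. mean r (g i))"
  unfolding mean_def using assms by (intro sum_le continuous_on_mean)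

lemma mean_cong:
  assumes "continuous_on (ball 0 1) g" "0 \<le> r" "r < 1" "\<And>z. norm z < 1 \<Longrightarrow> g z = h z"
  shows "mean r g = mean r h"
  unfolding mean_def using assms by (intro cong continuous_on_mean) auto

lemma mean_scale: "mean (a * r) h = mean r (\<lambda>z. h (a *\<^sub>R z))"
  by (simp add: mean_def)

lemma mean_scale_smult: "mean (a * r) h = mean r (\<lambda>z. h (of_real a *s z))"
  by (simp add: mean_scale scaleR_eq_smult)

lemma mean_le_average:
  fixes k :: "real \<Rightarrow> complex^'N \<Rightarrow> complex"
  assumes r: "0 \<le> r" "r < 1"
    and k: "continuous_on ({0..1} \<times> ball 0 1) (\<lambda>(u, z). k u z)"
    and B: "\<And>u. u \<in> {0..1} \<Longrightarrow> mean r (k u) \<le> B"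
    and g: "\<And>z. norm z < 1 \<Longrightarrow> g z = integral {0..1} (\<lambda>u. k u z)"
    and gc: "continuous_on (ball 0 1) g"
  shows "mean r g \<le> B"
proof -
  have "mean r g = X (\<lambda>z. integral {0..1} (\<lambda>u. k u (r *\<^sub>R z)))"
    unfolding mean_def using r gc by (intro cong continuous_on_mean) (auto simp: g)
  also have "\<dots> \<le> B"
  proof (rule average_le)
    have "continuous_on ({0..1} \<times> sphere 0 1) ((\<lambda>(u, z). k u z) \<circ> (\<lambda>x. (fst x, r *\<^sub>R snd x)))"
      using r by (intro continuous_on_compose continuous_intros continuous_on_subset[OF k]) auto
    then show "continuous_on ({0..1} \<times> sphere 0 1) (\<lambda>(u, z). k u (r *\<^sub>R z))"
      by (simp add: o_def case_prod_unfold)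
  qed (use B in \<open>simp add: mean_def\<close>)
  finally show ?thesis .
qed

lemma mean_unimodular:
  assumes h: "continuous_on (ball 0 1) h" and r: "0 \<le> r" "r < 1" and l: "norm l = 1"
  shows "mean r (\<lambda>z. h (l *s z)) = mean r h"
proof -
  have "orthogonal_transformation (\<lambda>z :: complex^'N. l *s z)"
    unfolding orthogonal_transformation using l
    by (auto intro!: linearI simp: vector_add_ldistrib scaleR_eq_smult vector_smult_assoc mult.commute)
  then have "X (\<lambda>z. h (r *\<^sub>R (l *s z))) = X (\<lambda>z. h (r *\<^sub>R z))"
    by (rule orthogonal[OF continuous_on_mean[OF h r]])
  then show ?thesis by (simp add: mean_def scaleR_eq_smult vector_smult_assoc mult.commute)
qed

text \<open>The means of a function with holomorphic slices grow with the radius: on each slice, \<open>h (t z)\<close> is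
  the average of \<open>h (b z)\<close>, where \<open>b\<close> runs over the image of the unit circle under the automorphism of
  the disc that maps 0 to \<open>t\<close>; that image is the unit circle again.\<close>

lemma mean_contract_real:
  assumes h: "slice_holomorphic h" and r: "0 \<le> r" "r < 1" and t: "0 \<le> t" "t < 1"
  shows "mean r (\<lambda>z. h (of_real t *s z)) \<le> mean r h"
proof -
  define b :: "complex \<Rightarrow> complex" where "b = (\<lambda>u. (u + of_real t) / (1 + of_real t * u))"
  have nz: "1 + of_real t * u \<noteq> 0" if "norm u \<le> 1" for u :: complex
  proof
    assume "1 + of_real t * u = 0"
    then have "of_real t * u = -1" by (simp add: eq_neg_iff_add_eq_0 add.commute)
    then have "norm (of_real t * u) = 1" by simp
    then have "t * norm u = 1" using t by (simp add: norm_mult)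
    moreover have "t * norm u \<le> t * 1" using that t by (intro mult_left_mono) auto
    ultimately show False using t by simp
  qed
  have sq: "(norm (1 + of_real t * u))\<^sup>2 - (norm (u + of_real t))\<^sup>2 = (1 - t\<^sup>2) * (1 - (norm u)\<^sup>2)" for u :: complex
    unfolding cmod_power2 by (simp add: power2_eq_square algebra_simps)
  have b1: "norm (b u) \<le> 1" if "norm u \<le> 1" for u
  proof -
    have a: "t\<^sup>2 \<le> 1" by (rule power_le_one) (use t in linarith)+
    have c: "(norm u)\<^sup>2 \<le> 1" by (rule power_le_one[OF norm_ge_zero that])
    have "0 \<le> (1 - t\<^sup>2) * (1 - (norm u)\<^sup>2)"
      by (rule mult_nonneg_nonneg) (use a c in linarith)+
    then have "(norm (u + of_real t))\<^sup>2 \<le> (norm (1 + of_real t * u))\<^sup>2" using sq[of u] by linarith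
    then have "norm (u + of_real t) \<le> norm (1 + of_real t * u)" by (rule power2_le_imp_le) (rule norm_ge_zero)
    then show ?thesis using nz[OF that] by (simp add: b_def norm_divide divide_le_eq)
  qed
  have b2: "norm (b (circ u)) = 1" for u
  proof -
    have "(norm (1 + of_real t * circ u))\<^sup>2 - (norm (circ u + of_real t))\<^sup>2 = 0"
      using sq[of "circ u"] by (simp only: norm_circ one_power2 diff_self mult_zero_right)
    then have "(norm (1 + of_real t * circ u))\<^sup>2 = (norm (circ u + of_real t))\<^sup>2" by linarith
    then have "norm (circ u + of_real t) = norm (1 + of_real t * circ u)"
      using power2_eq_imp_eq norm_ge_zero by metis
    then show ?thesis using nz[of "circ u"] by (simp add: b_def norm_divide)
  qed
  have holb: "b holomorphic_on cball 0 1" unfolding b_def using nz by (intro holomorphic_intros) auto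
  have hc: "continuous_on (ball 0 1) h" using h by (rule slice_cont)
  have contk: "continuous_on ({0..1} \<times> ball 0 1) (\<lambda>x. h (b (circ (fst x)) *s snd x))"
  proof (rule continuous_on_slice_param[OF hc])
    show "continuous_on ({0..1} \<times> ball 0 1) (\<lambda>x. b (circ (fst x)))"
      by (rule continuous_on_compose2[OF holomorphic_on_imp_continuous_on[OF holb]]) (auto intro!: continuous_intros)
  qed (auto simp: b2 intro!: continuous_intros)
  show ?thesis
  proof (rule mean_le_average[OF r, of "\<lambda>u z. h (b (circ u) *s z)"])
    show "continuous_on ({0..1} \<times> ball 0 1) (\<lambda>(u, z). h (b (circ u) *s z))"
      using contk by (simp add: case_prod_unfold)
    show "mean r (\<lambda>z. h (b (circ u) *s z)) \<le> mean r h" for u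
      by (simp add: mean_unimodular[OF hc r b2])
    show "continuous_on (ball 0 1) (\<lambda>z. h (of_real t *s z))"
      using slice_cont[OF slice_holomorphic_dilate[OF h, of "of_real t"]] t by simp
    fix z :: "complex^'N" assume z: "norm z < 1"
    have bz: "norm (b u *s z) < 1" if "norm u \<le> 1" for u
      using mult_right_mono[OF b1[OF that] norm_ge_zero[of z]] z by simp
    have "(\<lambda>l. h (l *s z)) holomorphic_on {l. norm (l *s z) < 1}" using h unfolding slice_holomorphic_def by blast
    then have "((\<lambda>l. h (l *s z)) \<circ> b) holomorphic_on cball 0 1"
      by (rule holomorphic_on_compose_gen[OF holb]) (use bz in \<open>auto simp del: norm_vector_scalar_mult\<close>)
    then have hol: "(\<lambda>u. h (b u *s z)) holomorphic_on cball 0 1" by (simp add: o_def)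
    have "integral {0..1} (\<lambda>u. h (b (circ u) *s z)) = h (b 0 *s z)"
      by (rule mean_value_circ[OF holomorphic_on_imp_continuous_on[OF hol] holomorphic_on_subset[OF hol]]) auto
    then show "h (of_real t *s z) = integral {0..1} (\<lambda>u. h (b (circ u) *s z))" by (simp add: b_def)
  qed
qed

lemma mean_contract:
  assumes h: "slice_holomorphic h" and r: "0 \<le> r" "r < 1" and l: "norm l \<le> 1"
  shows "mean r (\<lambda>z. h (l *s z)) \<le> mean r h"
proof (cases "l = 0 \<or> norm l = 1")
  case True
  then show ?thesis
  proof
    assume "l = 0"
    moreover have "mean r (\<lambda>z. h (of_real 0 *s z)) \<le> mean r h"
      by (rule mean_contract_real[OF h r]) simp_all
    ultimately show ?thesis by simp
  next
    assume "norm l = 1"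
    from mean_unimodular[OF slice_cont[OF h] r this] show ?thesis by (simp only: order_refl)
  qed
next
  case False
  define t where "t = norm l"
  have t: "0 \<le> t" "t < 1" using False l by (auto simp: t_def)
  have l: "l = of_real t * (l / of_real t)" using False by (simp add: t_def)
  have "mean r (\<lambda>z. h (l *s z)) = mean r (\<lambda>z. h (of_real t *s ((l / of_real t) *s z)))"
    by (subst l) (simp only: vector_smult_assoc)
  also have "\<dots> = mean r (\<lambda>z. h (of_real t *s z))"
  proof (rule mean_unimodular[where h = "\<lambda>z. h (of_real t *s z)", OF _ r])
    show "continuous_on (ball 0 1) (\<lambda>z. h (of_real t *s z))"
      using t by (intro slice_cont slice_holomorphic_dilate[OF h]) simp
    show "norm (l / of_real t) = 1" using False by (simp add: t_def norm_divide)
  qed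
  also have "\<dots> \<le> mean r h" by (rule mean_contract_real[OF h r t])
  finally show ?thesis .
qed

lemma mean_mono:
  assumes h: "slice_holomorphic h" and r: "0 \<le> r" "r \<le> R" "R < 1"
  shows "mean r h \<le> mean R h"
proof (cases "R = 0")
  case False
  have "mean r h = mean (r / R * R) h" using False by simp
  also have "\<dots> = mean R (\<lambda>z. h (of_real (r / R) *s z))" by (rule mean_scale_smult)
  also have "\<dots> \<le> mean R h" using r False by (intro mean_contract[OF h]) (auto simp: norm_divide)
  finally show ?thesis .
qed (use r in auto)

text \<open>Displacements along the complex flow \<open>z \<mapsto> e\<^sup>w z\<close> are controlled by the radial derivative.\<close>

lemma mean_exp_flow:
  assumes h: "slice_holomorphic h" and r: "0 \<le> r" "r < 1" and w: "Re w \<le> 0"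
  shows "mean r (\<lambda>z. h (exp w *s z) - h z) \<le> norm w * mean r (Rad h)"
proof (rule mean_le_average[OF r, of "\<lambda>u z. w * Rad h (exp (of_real u * w) *s z)"])
  have Rh: "slice_holomorphic (Rad h)" by (rule slice_holomorphic_Rad[OF h])
  show "continuous_on ({0..1} \<times> ball 0 1) (\<lambda>(u, z). w * Rad h (exp (of_real u * w) *s z))"
    using continuous_on_mult_left[OF continuous_on_exp_flow[OF slice_cont[OF Rh] w], of w]
    by (simp add: case_prod_unfold)
  show "mean r (\<lambda>z. w * Rad h (exp (of_real u * w) *s z)) \<le> norm w * mean r (Rad h)" if "u \<in> {0..1}" for u
  proof -
    have e: "norm (exp (of_real u * w)) \<le> 1" using that w by (auto intro!: norm_exp_le_1 mult_nonneg_nonpos)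
    have "mean r (\<lambda>z. w * Rad h (exp (of_real u * w) *s z)) = norm w * mean r (\<lambda>z. Rad h (exp (of_real u * w) *s z))"
      by (rule mean_cmult[OF slice_cont[OF slice_holomorphic_dilate[OF Rh e]] r])
    also have "\<dots> \<le> norm w * mean r (Rad h)" by (intro mult_left_mono mean_contract[OF Rh r e]) auto
    finally show ?thesis .
  qed
  show "continuous_on (ball 0 1) (\<lambda>z. h (exp w *s z) - h z)"
    by (intro slice_cont slice_holomorphic_diff slice_holomorphic_dilate h norm_exp_le_1 w)
qed (rule exp_flow_integral[OF h w])

lemma mean_exp_flow2:
  assumes h: "slice_holomorphic h" and r: "0 \<le> r" "r < 1" and w: "Re w \<le> 0"
  shows "mean r (\<lambda>z. h (exp w *s z) - h z - w * Rad h z) \<le> (norm w)\<^sup>2 * mean r (Rad (Rad h))"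
proof (rule mean_le_average[OF r, of "\<lambda>u z. w * (Rad h (exp (of_real u * w) *s z) - Rad h z)"])
  have Rh: "slice_holomorphic (Rad h)" by (rule slice_holomorphic_Rad[OF h])
  have Rc: "continuous_on (ball 0 1) (Rad h)" by (rule slice_cont[OF Rh])
  have fl: "continuous_on ({0..1} \<times> ball 0 1) (\<lambda>x. Rad h (exp (of_real (fst x) * w) *s snd x))"
    using continuous_on_exp_flow[OF Rc w] by (simp add: case_prod_unfold)
  have sn: "continuous_on ({0..1::real} \<times> ball 0 1) (\<lambda>x. Rad h (snd x))"
    by (rule continuous_on_compose2[OF Rc]) (auto intro!: continuous_intros)
  show "continuous_on ({0..1} \<times> ball 0 1) (\<lambda>(u, z). w * (Rad h (exp (of_real u * w) *s z) - Rad h z))"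
    unfolding case_prod_unfold by (intro continuous_intros fl sn)
  show "mean r (\<lambda>z. w * (Rad h (exp (of_real u * w) *s z) - Rad h z)) \<le> (norm w)\<^sup>2 * mean r (Rad (Rad h))"
    if u: "u \<in> {0..1}" for u
  proof -
    have uw: "Re (of_real u * w) \<le> 0" using u w by (auto intro!: mult_nonneg_nonpos)
    have c: "continuous_on (ball 0 1) (\<lambda>z. Rad h (exp (of_real u * w) *s z) - Rad h z)"
      by (intro slice_cont slice_holomorphic_diff slice_holomorphic_dilate Rh norm_exp_le_1 uw)
    have "mean r (\<lambda>z. w * (Rad h (exp (of_real u * w) *s z) - Rad h z)) = norm w * mean r (\<lambda>z. Rad h (exp (of_real u * w) *s z) - Rad h z)"
      by (rule mean_cmult[OF c r])
    also have "\<dots> \<le> norm w * (norm (of_real u * w) * mean r (Rad (Rad h)))"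
      by (intro mult_left_mono mean_exp_flow[OF Rh r uw]) auto
    also have "\<dots> \<le> norm w * (norm w * mean r (Rad (Rad h)))"
      using u by (intro mult_left_mono mult_right_mono) (auto simp: norm_mult mult_left_le_one_le)
    finally show ?thesis by (simp add: power2_eq_square)
  qed
  show "continuous_on (ball 0 1) (\<lambda>z. h (exp w *s z) - h z - w * Rad h z)"
    by (intro slice_cont slice_holomorphic_diff slice_holomorphic_dilate slice_holomorphic_cmult h Rh norm_exp_le_1 w)
  fix z :: "complex^'N" assume z: "norm z < 1"
  have "continuous_on {0..1} ((\<lambda>x. Rad h (exp (of_real (fst x) * w) *s snd x)) \<circ> (\<lambda>u. (u, z)))"
    using z by (intro continuous_on_compose continuous_intros continuous_on_subset[OF fl]) auto
  then have c: "continuous_on {0..1} (\<lambda>u. Rad h (exp (of_real u * w) *s z))" by (simp add: o_def)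
  have "integral {0..1} (\<lambda>u. w * (Rad h (exp (of_real u * w) *s z) - Rad h z))
     = integral {0..1} (\<lambda>u. w * Rad h (exp (of_real u * w) *s z)) - integral {0..1} (\<lambda>u :: real. w * Rad h z)"
    unfolding right_diff_distrib
    by (intro Henstock_Kurzweil_Integration.integral_diff integrable_continuous_real continuous_intros c)
  then show "h (exp w *s z) - h z - w * Rad h z = integral {0..1} (\<lambda>u. w * (Rad h (exp (of_real u * w) *s z) - Rad h z))"
    by (simp add: exp_flow_integral[OF h w z])
qed

text \<open>A Cauchy estimate: the radial derivative costs the inverse of the logarithmic distance of the radii.\<close>

lemma mean_Rad_Cauchy:
  assumes h: "slice_holomorphic h" and s: "0 < s" and r: "0 \<le> r" "r < 1"
  shows "mean (exp (- s) * r) (Rad h) \<le> mean r h / s"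
proof -
  have le: "Re (of_real s * circ u - of_real s) \<le> 0" for u
    using s order_trans[OF complex_Re_le_cmod, of "circ u" 1] by simp
  define k where "k = (\<lambda>u z. h (exp (of_real s * circ u - of_real s) *s z) / (of_real s * circ u))"
  have k2: "k u z = (1 / (of_real s * circ u)) * h (exp (of_real s * circ u - of_real s) *s z)" for u z by (simp add: k_def)
  have hd: "slice_holomorphic (\<lambda>z. h (exp (of_real s * circ u - of_real s) *s z))" for u
    by (rule slice_holomorphic_dilate[OF h norm_exp_le_1[OF le]])
  have "mean r (\<lambda>z. Rad h (of_real (exp (- s)) *s z)) \<le> mean r h / s"
  proof (rule mean_le_average[OF r, of k])
    have "continuous_on ({0..1} \<times> ball 0 1) (\<lambda>x. h (exp (of_real s * circ (fst x) - of_real s) *s snd x) / (of_real s * circ (fst x)))"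
    proof (intro continuous_intros continuous_on_slice_param)
      fix x :: "real \<times> (complex^'N)" assume x: "x \<in> {0..1} \<times> ball 0 1"
      show "norm (exp (of_real s * circ (fst x) - of_real s) *s snd x) < 1"
        using x mult_right_mono[OF norm_exp_le_1[OF le], of "norm (snd x)" "fst x"] by auto
    qed (use s slice_cont[OF h] in auto)
    then show "continuous_on ({0..1} \<times> ball 0 1) (\<lambda>(u, z). k u z)" by (simp add: k_def case_prod_unfold)
    show "mean r (k u) \<le> mean r h / s" for u
    proof -
      have "mean r (k u) = norm (1 / (of_real s * circ u)) * mean r (\<lambda>z. h (exp (of_real s * circ u - of_real s) *s z))"
        unfolding k2[abs_def] by (rule mean_cmult[OF slice_cont[OF hd] r])
      also have "\<dots> \<le> norm (1 / (of_real s * circ u)) * mean r h"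
        by (intro mult_left_mono mean_contract[OF h r] norm_exp_le_1 le) auto
      finally show ?thesis using s by (simp add: norm_divide norm_mult)
    qed
    show "continuous_on (ball 0 1) (\<lambda>z. Rad h (of_real (exp (- s)) *s z))"
      using s by (intro slice_cont slice_holomorphic_dilate slice_holomorphic_Rad h) auto
    fix z :: "complex^'N" assume z: "norm z < 1"
    have "Rad h (of_real (exp (- s)) *s z) = integral {0..1} (\<lambda>u. h (exp (of_real s * circ u) *s (of_real (exp (- s)) *s z)) / (of_real s * circ u))"
    proof (rule Rad_Cauchy[OF h s])
      have "exp s * norm (of_real (exp (- s)) *s z) = (exp s * exp (- s)) * norm z" by simp
      also have "exp s * exp (- s) = 1" by (simp add: exp_minus)
      finally have "exp s * norm (of_real (exp (- s)) *s z) = norm z" by (simp only: mult_1)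
      then show "exp s * norm (of_real (exp (- s)) *s z) < 1" by (simp only: z)
    qed
    also have "\<dots> = integral {0..1} (\<lambda>u. k u z)"
    proof -
      have "exp (of_real s * circ u) * of_real (exp (- s)) = exp (of_real s * circ u - of_real s)" for u
        by (simp add: exp_diff exp_minus exp_of_real divide_inverse)
      then show ?thesis by (simp add: k_def vector_smult_assoc)
    qed
    finally show "Rad h (of_real (exp (- s)) *s z) = integral {0..1} (\<lambda>u. k u z)" .
  qed
  then show ?thesis by (simp only: mean_scale_smult)
qed

end

section \<open>Contractions act on the means of holomorphic functions\<close>

definition herm_inner :: "complex^'N \<Rightarrow> complex^'N \<Rightarrow> complex" where
  "herm_inner x y = (\<Sum>i\<in>UNIV. x $ i * cnj (y $ i))"

lemma herm_inner_diff_left: "herm_inner (x - y) z = herm_inner x z - herm_inner y z"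
  by (simp add: herm_inner_def left_diff_distrib sum_subtractf)

lemma herm_inner_diff_right: "herm_inner x (y - z) = herm_inner x y - herm_inner x z"
  by (simp add: herm_inner_def right_diff_distrib sum_subtractf)

lemma herm_inner_smult_left: "herm_inner (c *s x) y = c * herm_inner x y"
  by (simp add: herm_inner_def sum_distrib_left mult.assoc)

lemma herm_inner_commute: "herm_inner y x = cnj (herm_inner x y)"
  by (simp add: herm_inner_def mult.commute)

lemma Re_herm_inner: "Re (herm_inner x y) = x \<bullet> y"
  by (simp add: herm_inner_def inner_vec_def inner_complex_def)

lemma norm_herm_inner_le: "norm (herm_inner x y) \<le> norm x * norm y"
proof (cases "herm_inner x y = 0")
  case False
  define c where "c = cnj (herm_inner x y) / of_real (norm (herm_inner x y))"
  have c: "norm c = 1" using False by (simp add: c_def norm_divide)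
  have "c * herm_inner x y = of_real (norm (herm_inner x y))"
    using False by (simp add: c_def complex_norm_square[symmetric] power2_eq_square mult.commute[of "cnj _"])
  then have "norm (herm_inner x y) = Re (herm_inner (c *s x) y)" by (simp add: herm_inner_smult_left)
  also have "\<dots> \<le> norm (c *s x) * norm y" unfolding Re_herm_inner by (rule norm_cauchy_schwarz)
  finally show ?thesis by (simp add: c)
qed simp

definition adjoint_matrix :: "complex^'N^'N \<Rightarrow> complex^'N^'N" where
  "adjoint_matrix A = (\<chi> i j. cnj (A $ j $ i))"

lemma herm_inner_adjoint_matrix: "herm_inner (A *v x) y = herm_inner x (adjoint_matrix A *v y)"
proof -
  have "herm_inner (A *v x) y = (\<Sum>i\<in>UNIV. \<Sum>j\<in>UNIV. A $ i $ j * x $ j * cnj (y $ i))"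
    by (simp add: herm_inner_def matrix_vector_mult_def sum_distrib_right)
  also have "\<dots> = (\<Sum>j\<in>UNIV. \<Sum>i\<in>UNIV. A $ i $ j * x $ j * cnj (y $ i))"
    by (rule sum.swap)
  also have "\<dots> = herm_inner x (adjoint_matrix A *v y)"
    by (simp add: herm_inner_def matrix_vector_mult_def adjoint_matrix_def sum_distrib_left mult_ac)
  finally show ?thesis .
qed

lemma herm_inner_adjoint_matrix': "herm_inner x (A *v y) = herm_inner (adjoint_matrix A *v x) y"
proof -
  have "herm_inner x (A *v y) = cnj (herm_inner (A *v y) x)" by (rule herm_inner_commute)
  also have "\<dots> = cnj (herm_inner y (adjoint_matrix A *v x))" by (simp only: herm_inner_adjoint_matrix)
  also have "\<dots> = herm_inner (adjoint_matrix A *v x) y" by (rule herm_inner_commute[symmetric])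
  finally show ?thesis .
qed

lemma norm_eq_herm_inner: "(norm x)\<^sup>2 = Re (herm_inner x x)"
  by (simp add: Re_herm_inner power2_norm_eq_inner)

lemma smult_mat_vec: "A *v (c *s x) = c *s (A *v x)" for A :: "complex^'N^'N"
  by (simp add: vec_eq_iff matrix_vector_mult_def sum_distrib_left mult_ac)

lemma linear_mat_vec: "linear ((*v) (A :: complex^'N^'N))"
proof (rule linearI)
  show "A *v (x + y) = A *v x + A *v y" for x y by (rule matrix_vector_right_distrib)
  show "A *v (c *\<^sub>R x) = c *\<^sub>R (A *v x)" for c x unfolding scaleR_eq_smult by (rule smult_mat_vec)
qed

text \<open>A contraction that is not an isometry is the centre of a complex disc of contractions in the
  direction of a matrix of rank one. With \<open>D = 1 - T\<^sup>* T\<close> and \<open>D' = 1 - T T\<^sup>*\<close>, the direction is a small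
  multiple of \<open>x \<mapsto> \<langle>x, D u\<rangle> D' v\<close>; the identity \<open>D' T = T D\<close> shows that both the mixed term and the
  quadratic term of the perturbed norm are dominated by \<open>|D x|\<^sup>2 \<le> |x|\<^sup>2 - |T x|\<^sup>2\<close>.\<close>

lemma contraction_not_complex_extreme:
  fixes T :: "complex^'N^'N"
  assumes T: "\<And>x. norm (T *v x) \<le> norm x" and ne: "norm (T *v x0) \<noteq> norm x0"
  obtains A :: "complex^'N^'N" where "A \<noteq> 0"
    "\<And>l x. norm l \<le> 1 \<Longrightarrow> norm (T *v x + l *s (A *v x)) \<le> norm x"
proof -
  define S where "S = adjoint_matrix T"
  have adj: "herm_inner (T *v x) y = herm_inner x (S *v y)" "herm_inner x (T *v y) = herm_inner (S *v x) y" for x y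
    unfolding S_def by (rule herm_inner_adjoint_matrix, rule herm_inner_adjoint_matrix')
  have S: "norm (S *v y) \<le> norm y" for y
  proof (cases "S *v y = 0")
    case False
    have "(norm (S *v y))\<^sup>2 \<le> norm (herm_inner (S *v y) (S *v y))" unfolding norm_eq_herm_inner by (rule complex_Re_le_cmod)
    also have "\<dots> = norm (herm_inner (T *v (S *v y)) y)" by (simp only: adj(1))
    also have "\<dots> \<le> norm (T *v (S *v y)) * norm y" by (rule norm_herm_inner_le)
    also have "\<dots> \<le> norm (S *v y) * norm y" by (intro mult_right_mono T) simp
    finally show ?thesis using False by (simp add: power2_eq_square)
  qed simp
  define D D' where "D = (\<lambda>x. x - S *v (T *v x))" and "D' = (\<lambda>y. y - T *v (S *v y))"
  have Dadj: "herm_inner x (D y) = herm_inner (D x) y" "herm_inner x (D' y) = herm_inner (D' x) y" for x y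
    unfolding D_def D'_def herm_inner_diff_left herm_inner_diff_right by (simp_all only: adj(1)[symmetric] adj(2))
  have D'T: "D' (T *v x) = T *v (D x)" for x
    by (simp add: D_def D'_def matrix_vector_mult_diff_distrib)
  have innerS: "Re (herm_inner x (S *v (T *v x))) = (norm (T *v x))\<^sup>2" for x
    by (simp add: norm_eq_herm_inner adj(1))
  have Dx: "(norm (D x))\<^sup>2 \<le> (norm x)\<^sup>2 - (norm (T *v x))\<^sup>2" for x
  proof -
    have "(norm (D x))\<^sup>2 = (norm x)\<^sup>2 - 2 * (x \<bullet> (S *v (T *v x))) + (norm (S *v (T *v x)))\<^sup>2"
      unfolding D_def power2_norm_eq_inner by (simp add: inner_diff_left inner_diff_right inner_commute)
    also have "x \<bullet> (S *v (T *v x)) = (norm (T *v x))\<^sup>2" using innerS[of x] by (simp add: Re_herm_inner)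
    also have "(norm (S *v (T *v x)))\<^sup>2 \<le> (norm (T *v x))\<^sup>2" by (intro power_mono S) simp
    finally show ?thesis by simp
  qed
  define u where "u = x0"
  have u: "D u \<noteq> 0"
  proof
    assume "D u = 0"
    then have "x0 = S *v (T *v x0)" by (simp add: D_def u_def)
    then have "(norm x0)\<^sup>2 = (norm (T *v x0))\<^sup>2" using innerS[of x0] by (simp add: norm_eq_herm_inner)
    then show False using ne by (simp add: power2_eq_iff_nonneg)
  qed
  \<comment> \<open>If \<open>D'\<close> vanished, \<open>S\<close> would be a surjective isometry with inverse \<open>T\<close>, and \<open>T\<close> an isometry as well.\<close>
  obtain v where v: "D' v \<noteq> 0"
  proof (rule ccontr)
    assume "\<not> thesis"
    then have D'0: "D' y = 0" for y using that by blast
    have TS: "T *v (S *v y) = y" for y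
    proof -
      have "y - T *v (S *v y) = 0" using D'0[of y] by (simp only: D'_def)
      then show ?thesis by simp
    qed
    have "inj ((*v) S)" by (rule inj_on_inverseI[of _ "(*v) T"]) (rule TS)
    then have "surj ((*v) S)" by (rule linear_injective_imp_surjective[OF linear_mat_vec]) (rule refl)
    then obtain y where y: "x0 = S *v y" unfolding surj_def by blast
    have "(norm (S *v y))\<^sup>2 = (norm y)\<^sup>2" unfolding norm_eq_herm_inner by (simp add: adj(1)[symmetric] TS)
    then have "norm (S *v y) = norm y" by (simp add: power2_eq_iff_nonneg)
    then show False using ne by (simp add: y TS)
  qed
  define q where "q = 2 * (norm u * norm v) + (norm u * norm (D' v))\<^sup>2"
  have q: "0 \<le> q" by (simp add: q_def)
  \<comment> \<open>The final estimate needs \<open>c q \<le> 1\<close>, where \<open>q\<close> collects the mixed and the quadratic term.\<close>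
  define c where "c = 1 / (1 + q)"
  have c: "0 < c" "c \<le> 1" "c * q \<le> 1" using q by (auto simp: c_def field_simps)
  define A :: "complex^'N^'N" where "A = (\<chi> i j. of_real c * cnj (D u $ j) * D' v $ i)"
  have Ax: "A *v x = (of_real c * herm_inner x (D u)) *s D' v" for x
    by (simp add: A_def vec_eq_iff matrix_vector_mult_def herm_inner_def sum_distrib_left sum_distrib_right mult_ac)
  show ?thesis
  proof (rule that)
    have "herm_inner (D u) (D u) \<noteq> 0" using u norm_eq_herm_inner[of "D u"] by auto
    then have "A *v D u \<noteq> 0" using v c by (auto simp: Ax vec_eq_iff)
    then show "A \<noteq> 0" by auto
    fix l :: complex and x :: "complex^'N" assume l: "norm l \<le> 1"
    define a where "a = l * (of_real c * herm_inner x (D u))"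
    have "norm (herm_inner x (D u)) \<le> norm (D x) * norm u" unfolding Dadj by (rule norm_herm_inner_le)
    then have "norm l * (c * norm (herm_inner x (D u))) \<le> 1 * (c * (norm (D x) * norm u))"
      using l c by (intro mult_mono) auto
    then have a: "norm a \<le> c * (norm (D x) * norm u)" using c by (simp add: a_def norm_mult)
    have "norm (herm_inner (T *v x) (D' v)) \<le> norm (T *v D x) * norm v" unfolding Dadj D'T by (rule norm_herm_inner_le)
    also have "\<dots> \<le> norm (D x) * norm v" by (intro mult_right_mono T) simp
    finally have b: "norm (herm_inner (T *v x) (D' v)) \<le> norm (D x) * norm v" .
    have "(norm (T *v x + a *s D' v))\<^sup>2 = (norm (T *v x))\<^sup>2 + 2 * ((T *v x) \<bullet> (a *s D' v)) + (norm (a *s D' v))\<^sup>2"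
      unfolding power2_norm_eq_inner by (simp add: inner_add_left inner_add_right inner_commute)
    also have "(T *v x) \<bullet> (a *s D' v) \<le> norm a * norm (herm_inner (T *v x) (D' v))"
    proof -
      have "(T *v x) \<bullet> (a *s D' v) = (a *s D' v) \<bullet> (T *v x)" by (rule inner_commute)
      also have "\<dots> = Re (a * herm_inner (D' v) (T *v x))" by (simp only: Re_herm_inner[symmetric] herm_inner_smult_left)
      also have "\<dots> \<le> norm (a * herm_inner (D' v) (T *v x))" by (rule complex_Re_le_cmod)
      finally show ?thesis by (simp add: norm_mult herm_inner_commute[of "D' v"])
    qed
    also have "norm a * norm (herm_inner (T *v x) (D' v)) \<le> (c * (norm (D x) * norm u)) * (norm (D x) * norm v)"
      using c by (intro mult_mono a b) auto
    also have "(norm (a *s D' v))\<^sup>2 \<le> (c * (norm (D x) * norm u) * norm (D' v))\<^sup>2"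
      using c by (simp add: mult_right_mono[OF a] power_mono)
    finally have "(norm (T *v x + a *s D' v))\<^sup>2 \<le> (norm (T *v x))\<^sup>2 + 2 * ((c * (norm (D x) * norm u)) * (norm (D x) * norm v))
        + (c * (norm (D x) * norm u) * norm (D' v))\<^sup>2" by simp
    also have "\<dots> = (norm (T *v x))\<^sup>2 + (2 * c * (norm u * norm v) + c * (c * (norm u * norm (D' v))\<^sup>2)) * (norm (D x))\<^sup>2"
      by (simp add: power2_eq_square algebra_simps)
    also have "\<dots> \<le> (norm (T *v x))\<^sup>2 + (2 * c * (norm u * norm v) + c * (1 * (norm u * norm (D' v))\<^sup>2)) * (norm (D x))\<^sup>2"
      using c by (intro add_left_mono mult_right_mono add_mono mult_left_mono order_refl) auto
    also have "\<dots> = (norm (T *v x))\<^sup>2 + (c * q) * (norm (D x))\<^sup>2" by (simp add: q_def algebra_simps)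
    also have "\<dots> \<le> (norm (T *v x))\<^sup>2 + 1 * (norm (D x))\<^sup>2"
      using c by (intro add_left_mono mult_right_mono) auto
    also have "\<dots> \<le> (norm x)\<^sup>2" using Dx[of x] by simp
    finally have "norm (T *v x + a *s D' v) \<le> norm x" by (rule power2_le_imp_le) simp
    then show "norm (T *v x + l *s (A *v x)) \<le> norm x"
      by (simp add: Ax a_def vector_smult_assoc)
  qed
qed

definition contractions :: "(complex^'N^'N) set" where
  "contractions = {T. \<forall>x. norm (T *v x) \<le> norm x}"

lemma compact_contractions: "compact (contractions :: (complex^'N^'N) set)"
  unfolding compact_eq_bounded_closed
proof
  have "norm T \<le> real CARD('N) * real CARD('N)" if "T \<in> contractions" for T :: "complex^'N^'N"
  proof -
    have e: "norm (T $ i $ j) \<le> 1" for i j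
    proof -
      have "T $ i $ j = (T *v axis j 1) $ i" by (simp add: matrix_vector_mult_def axis_def if_distrib cong: if_cong)
      also have "norm \<dots> \<le> norm (T *v axis j 1)" by (rule Finite_Cartesian_Product.norm_nth_le)
      also have "\<dots> \<le> norm (axis j (1::complex))" using that unfolding contractions_def by blast
      finally show ?thesis by simp
    qed
    have "norm T \<le> (\<Sum>i\<in>UNIV. norm (T $ i))" by (simp add: norm_vec_def L2_set_le_sum)
    also have "\<dots> \<le> (\<Sum>i\<in>(UNIV :: 'N set). real CARD('N))"
    proof (rule sum_mono)
      fix i
      have "norm (T $ i) \<le> (\<Sum>j\<in>UNIV. norm (T $ i $ j))" by (simp add: norm_vec_def[of "T $ i"] L2_set_le_sum)
      also have "\<dots> \<le> (\<Sum>j\<in>(UNIV :: 'N set). 1)" by (intro sum_mono e)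
      finally show "norm (T $ i) \<le> real CARD('N)" by simp
    qed
    finally show ?thesis by simp
  qed
  then show "bounded (contractions :: (complex^'N^'N) set)" unfolding bounded_iff by blast
  have "contractions = (\<Inter>x. {T :: complex^'N^'N. norm (T *v x) \<le> norm x})" by (auto simp: contractions_def)
  also have "closed \<dots>"
    unfolding matrix_vector_mult_def by (intro closed_INT ballI closed_Collect_le continuous_intros)
  finally show "closed (contractions :: (complex^'N^'N) set)" .
qed

lemma holomorphic_several_line:
  assumes f: "holomorphic_several f S"
  shows "(\<lambda>l. f (a + l *s b)) holomorphic_on {l. a + l *s b \<in> S}"
  unfolding holomorphic_on_def
proof
  fix l assume "l \<in> {l. a + l *s b \<in> S}"
  then obtain D where D: "(f has_derivative D) (at (a + l *s b))" "\<And>c v. D (c *s v) = c * D v"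
    using f unfolding holomorphic_several_def by blast
  have "((\<lambda>l. a + l *s b) has_derivative (\<lambda>l. l *s b)) (at l)"
  proof -
    have "bounded_linear (\<lambda>l. l *s b)"
      by (rule bounded_linear_intro[where K = "norm b"])
        (simp_all add: vector_sadd_rdistrib scaleR_eq_smult vector_smult_assoc scaleR_conv_of_real)
    then show ?thesis by (auto intro!: derivative_eq_intros bounded_linear_imp_has_derivative)
  qed
  from has_derivative_compose[OF this D(1)] have "((\<lambda>l. f (a + l *s b)) has_field_derivative D b) (at l)"
    by (simp add: has_field_derivative_def D(2) mult_commute_abs)
  then show "(\<lambda>l. f (a + l *s b)) field_differentiable at l within {l. a + l *s b \<in> S}"
    by (meson field_differentiable_at_within field_differentiable_def)
qed

lemma holomorphic_several_continuous: "holomorphic_several f S \<Longrightarrow> continuous_on S f"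
  unfolding holomorphic_several_def
  by (intro continuous_at_imp_continuous_on ballI) (meson has_derivative_continuous)

lemma holomorphic_several_slice:
  assumes "holomorphic_several f (ball 0 1)"
  shows "slice_holomorphic f"
  unfolding slice_holomorphic_def
proof (intro conjI allI)
  show "continuous_on (ball 0 1) f" by (rule holomorphic_several_continuous[OF assms])
  fix z
  show "(\<lambda>l. f (l *s z)) holomorphic_on {l. norm (l *s z) < 1}"
    using holomorphic_several_line[OF assms, of 0 z] by simp
qed

definition smult_matrix :: "complex \<Rightarrow> complex^'N^'N \<Rightarrow> complex^'N^'N" where
  "smult_matrix l A = (\<chi> i. l *s A $ i)"

lemma smult_matrix_vec: "smult_matrix l A *v x = l *s (A *v x)"
  by (simp add: smult_matrix_def vec_eq_iff matrix_vector_mult_def sum_distrib_left mult_ac)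

lemma norm_smult_matrix: "norm (smult_matrix l A) = norm l * norm A"
  by (simp add: smult_matrix_def norm_vec_def[of "vec_lambda _"] norm_vec_def[of A] L2_set_right_distrib)

lemma continuous_on_mat_vec:
  "continuous_on (S :: ((complex^'N^'N) \<times> (complex^'N)) set) (\<lambda>p. fst p *v snd p)"
  unfolding matrix_vector_mult_def by (intro continuous_intros)

context sphere_norm
begin

text \<open>Composition with a linear contraction does not increase the means. The quantity
  \<open>mean r (h \<circ> T) + e |T|\<^sup>2\<close> with the Frobenius norm attains its maximum over all contractions at some \<open>T\<close>.
  It has the strict submean value property on complex discs, so \<open>T\<close> is not the centre of a disc of
  contractions; then \<open>T\<close> is unitary, and composition with it preserves the mean.\<close>

lemma mean_contraction_matrix:
  assumes h: "holomorphic_several h (ball 0 1)" and r: "0 \<le> r" "r < 1" and T0: "T0 \<in> contractions"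
  shows "mean r (\<lambda>z. h (T0 *v z)) \<le> mean r h"
proof -
  have hc: "continuous_on (ball 0 1) h" by (rule holomorphic_several_continuous[OF h])
  have inb: "norm (T *v z) < 1" if "T \<in> contractions" "norm z < 1" for T z
    using that by (auto simp: contractions_def intro: le_less_trans)
  have hT: "continuous_on (ball 0 1) (\<lambda>z. h (T *v z))" if "T \<in> contractions" for T
    by (rule continuous_on_compose2[OF hc linear_continuous_on])
      (use inb[OF that] in \<open>auto simp: linear_conv_bounded_linear[symmetric] linear_mat_vec\<close>)
  obtain C where C: "\<And>T :: complex^'N^'N. T \<in> contractions \<Longrightarrow> norm T \<le> C"
    using compact_imp_bounded[OF compact_contractions] unfolding bounded_iff by blast
  have contm: "continuous_on contractions (\<lambda>T. mean r (\<lambda>z. h (T *v z)))"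
  proof -
    have "continuous_on (contractions \<times> sphere 0 1) (\<lambda>p. h (r *\<^sub>R (fst p *v snd p)))"
    proof (rule continuous_on_compose2[OF hc])
      show "(\<lambda>p :: (complex^'N^'N) \<times> (complex^'N). r *\<^sub>R (fst p *v snd p)) ` (contractions \<times> sphere 0 1) \<subseteq> ball 0 1"
      proof clarsimp
        fix T :: "complex^'N^'N" and z :: "complex^'N" assume "T \<in> contractions" "norm z = 1"
        then have "norm (T *v z) \<le> 1" by (metis (mono_tags) contractions_def mem_Collect_eq)
        then show "\<bar>r\<bar> * norm (T *v z) < 1" using r mult_left_mono[of "norm (T *v z)" 1 r] by simp
      qed
    qed (intro continuous_intros continuous_on_mat_vec)
    then have uc: "uniformly_continuous_on (contractions \<times> sphere 0 1) (\<lambda>p. h (r *\<^sub>R (fst p *v snd p)))"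
      by (intro compact_uniformly_continuous compact_Times compact_contractions) auto
    show ?thesis unfolding continuous_on_iff
    proof (intro ballI allI impI)
      fix T :: "complex^'N^'N" and e :: real assume T: "T \<in> contractions" and e: "0 < e"
      obtain d where d: "d > 0" "\<And>p p'. p \<in> contractions \<times> sphere 0 1 \<Longrightarrow> p' \<in> contractions \<times> sphere 0 1 \<Longrightarrow>
          dist p' p < d \<Longrightarrow> dist (h (r *\<^sub>R (fst p' *v snd p'))) (h (r *\<^sub>R (fst p *v snd p))) < e / 2"
        using uc e unfolding uniformly_continuous_on_def by (metis half_gt_zero)
      have le: "mean r (\<lambda>z. h (T1 *v z)) \<le> mean r (\<lambda>z. h (T2 *v z)) + e / 2"
        if "T1 \<in> contractions" "T2 \<in> contractions" "dist T1 T2 < d" for T1 T2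
        unfolding mean_def
      proof (rule close_le)
        fix z :: "complex^'N" assume "norm z = 1"
        then show "norm (h (T1 *v (r *\<^sub>R z)) - h (T2 *v (r *\<^sub>R z))) \<le> e / 2"
          using d(2)[of "(T2, z)" "(T1, z)"] that
          by (simp add: dist_Pair_Pair dist_norm scaleR_eq_smult smult_mat_vec less_imp_le)
      qed (use that e r in \<open>auto intro: continuous_on_mean[OF hT]\<close>)
      show "\<exists>d>0. \<forall>T'\<in>contractions. dist T' T < d \<longrightarrow> dist (mean r (\<lambda>z. h (T' *v z))) (mean r (\<lambda>z. h (T *v z))) < e"
      proof (intro exI[of _ d] conjI ballI impI d(1))
        fix T' :: "complex^'N^'N" assume "T' \<in> contractions" "dist T' T < d"
        then show "dist (mean r (\<lambda>z. h (T' *v z))) (mean r (\<lambda>z. h (T *v z))) < e"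
          using le[of T' T] le[of T T'] T e by (simp add: dist_commute dist_real_def abs_less_iff)
      qed
    qed
  qed
  have key: "mean r (\<lambda>z. h (T0 *v z)) \<le> mean r h + e * C\<^sup>2" if e: "e > 0" for e :: real
  proof -
    define E where "E = (\<lambda>T. mean r (\<lambda>z. h (T *v z)) + e * (norm T)\<^sup>2)"
    have "continuous_on contractions E" unfolding E_def by (intro continuous_intros contm)
    then obtain T where T: "T \<in> contractions" and Tmax: "\<And>T'. T' \<in> contractions \<Longrightarrow> E T' \<le> E T"
      using continuous_attains_sup[OF compact_contractions, of E] T0 by blast
    have iso: "norm (T *v x) = norm x" for x
    proof (rule ccontr)
      assume ne: "norm (T *v x) \<noteq> norm x"
      obtain A where A: "A \<noteq> 0" "\<And>l x. norm l \<le> 1 \<Longrightarrow> norm (T *v x + l *s (A *v x)) \<le> norm x"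
      proof (rule contraction_not_complex_extreme[OF _ ne])
        show "norm (T *v x) \<le> norm x" for x using T by (simp add: contractions_def)
      qed (rule that)
      define P where "P = (\<lambda>l. T + smult_matrix l A)"
      have Pv: "P l *v z = T *v z + l *s (A *v z)" for l z
        by (simp add: P_def matrix_vector_mult_add_rdistrib smult_matrix_vec)
      have P: "P l \<in> contractions" if "norm l \<le> 1" for l
        using A(2)[OF that] by (simp add: contractions_def Pv)
      have Pm: "P (- l) = T - smult_matrix l A" for l
        by (simp add: P_def smult_matrix_def vec_eq_iff)
      \<comment> \<open>Averaging over opposite points makes the parallelogram law available for the Frobenius norm.\<close>
      define k where "k = (\<lambda>u z. (1/2) * (h (P (circ u) *v z) + h (P (- circ u) *v z)))"
      have hk: "continuous_on ({0..1} \<times> ball 0 1) (\<lambda>p. h (P (s * circ (fst p)) *v snd p))" if "norm s = 1" for s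
      proof (rule continuous_on_compose2[OF hc])
        show "continuous_on ({0..1} \<times> ball 0 1) (\<lambda>p. P (s * circ (fst p)) *v snd p)"
          unfolding Pv unfolding matrix_vector_mult_def by (intro continuous_intros)
        show "(\<lambda>p. P (s * circ (fst p)) *v snd p) ` ({0..1} \<times> ball 0 1) \<subseteq> ball 0 1"
          using that by (auto intro!: inb P simp: norm_mult)
      qed
      have "mean r (\<lambda>z. h (T *v z)) \<le> E T - e * (norm T)\<^sup>2 - e * (norm A)\<^sup>2"
      proof (rule mean_le_average[OF r, of k])
        show "continuous_on ({0..1} \<times> ball 0 1) (\<lambda>(u, z). k u z)"
          unfolding k_def case_prod_unfold
          using hk[of 1] hk[of "-1"] by (intro continuous_intros) auto
        show "mean r (k u) \<le> E T - e * (norm T)\<^sup>2 - e * (norm A)\<^sup>2" for u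
        proof -
          have c: "P (circ u) \<in> contractions" "P (- circ u) \<in> contractions" by (auto intro: P)
          have "mean r (k u) = (1/2) * mean r (\<lambda>z. h (P (circ u) *v z) + h (P (- circ u) *v z))"
            unfolding k_def using mean_cmult[of "\<lambda>z. h (P (circ u) *v z) + h (P (- circ u) *v z)" r "1/2"] r hT c
            by (simp add: continuous_on_add norm_divide)
          also have "\<dots> \<le> (1/2) * (mean r (\<lambda>z. h (P (circ u) *v z)) + mean r (\<lambda>z. h (P (- circ u) *v z)))"
            by (intro mult_left_mono mean_add r hT c) auto
          also have "mean r (\<lambda>z. h (P (circ u) *v z)) \<le> E T - e * (norm (P (circ u)))\<^sup>2"
            using Tmax[OF c(1)] by (simp add: E_def)
          also have "mean r (\<lambda>z. h (P (- circ u) *v z)) \<le> E T - e * (norm (P (- circ u)))\<^sup>2"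
            using Tmax[OF c(2)] by (simp add: E_def)
          also have "(norm (P (circ u)))\<^sup>2 = 2 * ((norm T)\<^sup>2 + (norm A)\<^sup>2) - (norm (P (- circ u)))\<^sup>2"
          proof -
            have "(norm (smult_matrix (circ u) A))\<^sup>2 = (norm A)\<^sup>2" by (simp add: norm_smult_matrix)
            then show ?thesis
              unfolding Pm unfolding P_def power2_norm_eq_inner
              by (simp add: inner_add_left inner_add_right inner_diff_left inner_diff_right inner_commute)
          qed
          finally show ?thesis by (simp add: algebra_simps)
        qed
        show "continuous_on (ball 0 1) (\<lambda>z. h (T *v z))" by (rule hT[OF T])
        fix z :: "complex^'N" assume z: "norm z < 1"
        have inP: "norm (P l *v z) < 1" if "norm l \<le> 1" for l using inb[OF P[OF that] z] .
        have hol: "(\<lambda>l. h (P l *v z)) holomorphic_on cball 0 1"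
          using inP unfolding Pv by (intro holomorphic_on_subset[OF holomorphic_several_line[OF h]]) auto
        have hol2: "(\<lambda>l. h (P (- l) *v z)) holomorphic_on cball 0 1"
        proof -
          have "((\<lambda>l. h (P l *v z)) \<circ> uminus) holomorphic_on cball 0 1"
            by (intro holomorphic_on_compose_gen[OF _ hol] holomorphic_intros) auto
          then show ?thesis by (simp add: o_def)
        qed
        have "(\<lambda>l. (1/2) * (h (P l *v z) + h (P (- l) *v z))) holomorphic_on cball 0 1"
          by (intro holomorphic_intros hol hol2)
        then have "integral {0..1} (\<lambda>u. (1/2) * (h (P (circ u) *v z) + h (P (- circ u) *v z))) = (1/2) * (h (P 0 *v z) + h (P (- 0) *v z))"
          by (intro mean_value_circ[where F = "\<lambda>l. (1/2) * (h (P l *v z) + h (P (- l) *v z))"])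
            (auto intro: holomorphic_on_imp_continuous_on holomorphic_on_subset)
        then show "h (T *v z) = integral {0..1} (\<lambda>u. k u z)"
          by (simp add: k_def Pv)
      qed
      then have "e * (norm A)\<^sup>2 \<le> 0" by (simp add: E_def)
      then show False using e A(1) by (simp add: mult_le_0_iff)
    qed
    have "mean r (\<lambda>z. h (T *v z)) = mean r h"
    proof -
      have "orthogonal_transformation ((*v) T)"
        unfolding orthogonal_transformation using iso linear_mat_vec by blast
      from orthogonal[OF continuous_on_mean[OF hc r] this] show ?thesis
        by (simp add: mean_def scaleR_eq_smult smult_mat_vec)
    qed
    then have "E T \<le> mean r h + e * C\<^sup>2" using e C[OF T] by (simp add: E_def power_mono)
    moreover have "mean r (\<lambda>z. h (T0 *v z)) \<le> E T0" using e by (simp add: E_def)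
    ultimately show ?thesis using Tmax[OF T0] by linarith
  qed
  show ?thesis
  proof (rule field_le_epsilon)
    fix e :: real assume e: "0 < e"
    have "e / (1 + C\<^sup>2) * C\<^sup>2 \<le> e"
      using e by (simp add: divide_le_eq add_pos_nonneg algebra_simps)
    then show "mean r (\<lambda>z. h (T0 *v z)) \<le> mean r h + e"
      using key[of "e / (1 + C\<^sup>2)"] e by (simp add: add_pos_nonneg)
  qed
qed

lemma mean_contraction:
  assumes h: "holomorphic_several h (ball 0 1)" and r: "0 \<le> r" "r < 1"
    and S: "Vector_Spaces.linear (*s) (*s) S" and le: "\<And>z. norm (S z) \<le> norm z"
  shows "mean r (\<lambda>z. h (S z)) \<le> mean r h"
proof -
  have S: "matrix S *v z = S z" for z by (rule matrix_works[OF S])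
  then show ?thesis
    using mean_contraction_matrix[OF h r, of "matrix S"] le by (simp add: contractions_def)
qed

end

section \<open>Differences along operators close to the identity\<close>

lemma Cauchy_circ:
  assumes contF: "continuous_on (cball 0 R) F" and holF: "F holomorphic_on ball 0 R" and w: "norm w < R"
  shows "((\<lambda>u. F (of_real R * circ u) * (of_real R * circ u / (of_real R * circ u - w))) has_integral F w) {0..1}"
proof -
  have "((\<lambda>u. F u / (u - w)) has_contour_integral (2 * of_real pi * \<i> * F w)) (circlepath 0 R)"
    using assms by (intro Cauchy_integral_circlepath) auto
  then have "((\<lambda>u. F (circlepath 0 R u) / (circlepath 0 R u - w) * vector_derivative (circlepath 0 R) (at u within {0..1}))
      has_integral (2 * of_real pi * \<i> * F w)) {0..1}"
    by (simp add: has_contour_integral_def)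
  then have "((\<lambda>u. (2 * of_real pi * \<i>) * (F (of_real R * circ u) * (of_real R * circ u / (of_real R * circ u - w))))
      has_integral (2 * of_real pi * \<i> * F w)) {0..1}"
    by (rule has_integral_eq[rotated]) (simp add: vector_derivative_circlepath01 circlepath_0 circ_def[symmetric])
  from has_integral_mult_right[OF this, of "1 / (2 * of_real pi * \<i>)"] show ?thesis
    by simp
qed

text \<open>The Cauchy formula at 1 minus the one at 0, for a function that vanishes at 0.\<close>

lemma Schwarz_circ:
  assumes contF: "continuous_on (cball 0 R) F" and holF: "F holomorphic_on ball 0 R" and F0: "F 0 = 0" and R: "1 < R"
  shows "integral {0..1} (\<lambda>u. F (of_real R * circ u) / (of_real R * circ u - 1)) = F 1"
proof -
  have "((\<lambda>u. F (of_real R * circ u) * (of_real R * circ u / (of_real R * circ u - 1))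
      - F (of_real R * circ u) * (of_real R * circ u / (of_real R * circ u - 0))) has_integral F 1 - F 0) {0..1}"
    using R by (intro has_integral_diff Cauchy_circ[OF contF holF]) auto
  moreover have "F (of_real R * circ u) * (of_real R * circ u / (of_real R * circ u - 1))
      - F (of_real R * circ u) * (of_real R * circ u / (of_real R * circ u - 0)) = F (of_real R * circ u) / (of_real R * circ u - 1)" for u
  proof -
    define w where "w = of_real R * circ u"
    have "norm w = R" using R by (simp add: w_def norm_mult)
    then have "w \<noteq> 0" "w - 1 \<noteq> 0" using R by auto
    then have "F w * (w / (w - 1)) - F w * (w / (w - 0)) = F w / (w - 1)" by (simp add: field_simps)
    then show ?thesis by (simp only: w_def)
  qed
  ultimately have "((\<lambda>u. F (of_real R * circ u) / (of_real R * circ u - 1)) has_integral F 1 - F 0) {0..1}"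
    by (simp only:)
  then show ?thesis by (simp add: F0 integral_unique)
qed

lemma smult_linear: "Vector_Spaces.linear (*s) (*s) U \<Longrightarrow> U (c *s z) = c *s U z"
  by (simp add: Vector_Spaces.linear_iff)

lemma linear_pencil:
  assumes U: "Vector_Spaces.linear (*s) (*s) U"
  shows "Vector_Spaces.linear (*s) (*s) (\<lambda>z. c *s (z + l *s (U z - z)))"
proof -
  interpret U: Vector_Spaces.linear "(*s)" "(*s)" U by (rule U)
  show ?thesis
    by unfold_locales (simp_all add: U.add U.scale vector_add_ldistrib vector_ssub_ldistrib vector_smult_assoc mult_ac algebra_simps)
qed

lemma holomorphic_several_linear:
  fixes S :: "complex^'m \<Rightarrow> complex^'n"
  assumes f: "holomorphic_several f (ball 0 1)" and S: "Vector_Spaces.linear (*s) (*s) S"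
    and le: "\<And>z. norm z < 1 \<Longrightarrow> norm (S z) < 1"
  shows "holomorphic_several (\<lambda>z. f (S z)) (ball 0 1)"
  unfolding holomorphic_several_def
proof
  fix z :: "complex^'m" assume "z \<in> ball 0 1"
  then have "S z \<in> ball 0 1" using le by simp
  then obtain D where D: "(f has_derivative D) (at (S z))" "\<And>c v. D (c *s v) = c * D v"
    using f unfolding holomorphic_several_def by blast
  interpret S: Vector_Spaces.linear "(*s)" "(*s)" S by (rule S)
  have "linear S" by (rule linearI) (simp_all only: S.add S.scale scaleR_eq_smult)
  then have "(S has_derivative S) (at z)" by (simp add: linear_imp_has_derivative)
  from has_derivative_compose[OF this D(1)]
  show "\<exists>D. ((\<lambda>z. f (S z)) has_derivative D) (at z) \<and> (\<forall>c v. D (c *s v) = c * D v)"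
    by (intro exI[of _ "\<lambda>v. D (S v)"]) (simp add: S.scale D(2))
qed

lemma holomorphic_several_dilate:
  fixes f :: "complex^'N \<Rightarrow> complex"
  assumes f: "holomorphic_several f (ball 0 1)" and c: "norm c \<le> 1"
  shows "holomorphic_several (\<lambda>z. f (c *s z)) (ball 0 1)"
proof (rule holomorphic_several_linear[OF f])
  show "Vector_Spaces.linear (*s) (*s) (\<lambda>z :: complex^'N. c *s z)"
    by unfold_locales (simp_all add: vector_add_ldistrib vector_ssub_ldistrib vector_smult_assoc mult_ac algebra_simps)
  fix z :: "complex^'N" assume "norm z < 1"
  then show "norm (c *s z) < 1" using mult_right_mono[OF c norm_ge_zero[of z]] by simp
qed

lemma holomorphic_several_diff:
  assumes "holomorphic_several f S" "holomorphic_several g S"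
  shows "holomorphic_several (\<lambda>z. f z - g z) S"
  unfolding holomorphic_several_def
proof
  fix z assume z: "z \<in> S"
  obtain D where "(f has_derivative D) (at z)" "\<And>c v. D (c *s v) = c * D v"
    using assms(1) z unfolding holomorphic_several_def by blast
  moreover obtain D' where "(g has_derivative D') (at z)" "\<And>c v. D' (c *s v) = c * D' v"
    using assms(2) z unfolding holomorphic_several_def by blast
  ultimately show "\<exists>D. ((\<lambda>z. f z - g z) has_derivative D) (at z) \<and> (\<forall>c v. D (c *s v) = c * D v)"
    by (intro exI[of _ "\<lambda>v. D v - D' v"]) (auto intro!: has_derivative_diff simp: right_diff_distrib)
qed

lemma holomorphic_several_add:
  assumes "holomorphic_several f S" "holomorphic_several g S"
  shows "holomorphic_several (\<lambda>z. f z + g z) S"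
  unfolding holomorphic_several_def
proof
  fix z assume z: "z \<in> S"
  obtain D where "(f has_derivative D) (at z)" "\<And>c v. D (c *s v) = c * D v"
    using assms(1) z unfolding holomorphic_several_def by blast
  moreover obtain D' where "(g has_derivative D') (at z)" "\<And>c v. D' (c *s v) = c * D' v"
    using assms(2) z unfolding holomorphic_several_def by blast
  ultimately show "\<exists>D. ((\<lambda>z. f z + g z) has_derivative D) (at z) \<and> (\<forall>c v. D (c *s v) = c * D v)"
    by (intro exI[of _ "\<lambda>v. D v + D' v"]) (auto intro!: has_derivative_add simp: distrib_left)
qed

context sphere_norm
begin

text \<open>Schwarz' lemma in the parameter \<open>l\<close> of the pencil \<open>1 + l (U - 1)\<close>. Normalized by \<open>\<kappa> = 1 + L d\<close>, the
  pencil consists of contractions for \<open>|l| \<le> L\<close>, and the difference in question is its value at \<open>l = 1\<close>.\<close>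

lemma mean_diff_near_identity:
  assumes h: "holomorphic_several h (ball 0 1)" and r: "0 \<le> r" "r < 1"
    and U: "Vector_Spaces.linear (*s) (*s) U" and d: "\<And>z. norm (U z - z) \<le> d * norm z" and d0: "0 \<le> d"
    and L: "2 \<le> L" and \<kappa>: "\<kappa> = 1 + L * d"
  shows "mean r (\<lambda>z. h (of_real (1 / \<kappa>) *s U z) - h (of_real (1 / \<kappa>) *s z)) \<le> 4 / L * mean r h"
proof -
  have k1: "1 \<le> \<kappa>" using L d0 by (simp add: \<kappa>)
  define S where "S = (\<lambda>l z. of_real (1 / \<kappa>) *s (z + l *s (U z - z)))"
  have S0: "S 0 z = of_real (1 / \<kappa>) *s z" and S1: "S 1 z = of_real (1 / \<kappa>) *s U z" for z
    by (simp_all add: S_def)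
  have linS: "Vector_Spaces.linear (*s) (*s) (S l)" for l
    unfolding S_def by (rule linear_pencil[OF U])
  have nS: "norm (S l z) \<le> norm z" if "norm l \<le> L" for l z
  proof -
    have "norm (z + l *s (U z - z)) \<le> norm z + norm l * norm (U z - z)"
      using norm_triangle_ineq[of z "l *s (U z - z)"] by (simp only: norm_vector_scalar_mult)
    also have "norm l * norm (U z - z) \<le> L * (d * norm z)" using that L by (intro mult_mono d) auto
    finally have "norm (z + l *s (U z - z)) \<le> \<kappa> * norm z" by (simp add: \<kappa> algebra_simps)
    then have "norm (z + l *s (U z - z)) / \<kappa> \<le> norm z" using k1 by (simp add: divide_le_eq mult.commute)
    moreover have "norm (S l z) = norm (of_real (1 / \<kappa>) :: complex) * norm (z + l *s (U z - z))"
      unfolding S_def by (rule norm_vector_scalar_mult)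
    ultimately show ?thesis using k1 by (simp only: norm_of_real) simp
  qed
  have hc: "continuous_on (ball 0 1) h" by (rule holomorphic_several_continuous[OF h])
  have hS: "holomorphic_several (\<lambda>z. h (S l z)) (ball 0 1)" if "norm l \<le> L" for l
    by (rule holomorphic_several_linear[OF h linS]) (use nS[OF that] le_less_trans in blast)
  have cS: "continuous_on (ball 0 1) (\<lambda>z. h (S l z))" if "norm l \<le> L" for l
    by (rule holomorphic_several_continuous[OF hS[OF that]])
  have linU: "continuous_on A U" for A
  proof -
    interpret U: Vector_Spaces.linear "(*s)" "(*s)" U by (rule U)
    have "linear U" by (rule linearI) (simp_all only: U.add U.scale scaleR_eq_smult)
    then show ?thesis by (intro linear_continuous_on) (simp add: linear_conv_bounded_linear)
  qed
  define c where "c = (\<lambda>u. of_real L * circ u)"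
  have c: "norm (c u) = L" for u using L by (simp add: c_def norm_mult)
  have c1: "L / 2 \<le> norm (c u - 1)" for u
    using norm_triangle_ineq2[of "c u" 1] c[of u] L by simp
  define k where "k = (\<lambda>u z. (1 / (c u - 1)) * (h (S (c u) z) - h (S 0 z)))"
  show ?thesis
  proof (rule mean_le_average[OF r, of k])
    have "continuous_on ({0..1::real} \<times> ball 0 1) (\<lambda>p. h (S (c (fst p)) (snd p)))"
    proof (rule continuous_on_compose2[OF hc])
      show "continuous_on ({0..1::real} \<times> ball 0 1) (\<lambda>p. S (c (fst p)) (snd p))"
      proof -
        have "continuous_on ({0..1::real} \<times> ball 0 1) (\<lambda>p. U (snd p))"
          by (rule continuous_on_compose2[OF linU[of UNIV] continuous_on_snd[OF continuous_on_id]]) auto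
        then show ?thesis unfolding S_def c_def by (intro continuous_intros)
      qed
      show "(\<lambda>p. S (c (fst p)) (snd p)) ` ({0..1::real} \<times> ball 0 1) \<subseteq> ball 0 1"
      proof (rule image_subsetI)
        fix p :: "real \<times> (complex^'N)" assume "p \<in> {0..1} \<times> ball 0 1"
        then have "norm (snd p) < 1" by auto
        then show "S (c (fst p)) (snd p) \<in> ball 0 1"
          using nS[of "c (fst p)" "snd p"] c[of "fst p"] by simp
      qed
    qed
    moreover have "continuous_on ({0..1::real} \<times> ball 0 1) (\<lambda>p. h (S 0 (snd p)))"
      by (rule continuous_on_compose2[OF cS[of 0]]) (use L in \<open>auto intro!: continuous_intros\<close>)
    moreover have "c u - 1 \<noteq> 0" for u using c1[of u] L by auto
    ultimately show "continuous_on ({0..1} \<times> ball 0 1) (\<lambda>(u, z). k u z)"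
      unfolding k_def case_prod_unfold c_def by (intro continuous_intros) auto
    show "mean r (k u) \<le> 4 / L * mean r h" for u
    proof -
      have cu: "norm (c u) \<le> L" "norm (0 :: complex) \<le> L" using c[of u] L by auto
      have "mean r (k u) = norm (1 / (c u - 1)) * mean r (\<lambda>z. h (S (c u) z) - h (S 0 z))"
        unfolding k_def by (intro mean_cmult r continuous_on_diff cS cu)
      also have "\<dots> \<le> (2 / L) * (mean r h + mean r h)"
      proof (intro mult_mono)
        show "norm (1 / (c u - 1)) \<le> 2 / L" using le_imp_inverse_le[OF c1[of u]] L by (simp add: norm_divide inverse_eq_divide)
        have "mean r (\<lambda>z. h (S (c u) z) - h (S 0 z)) \<le> mean r (\<lambda>z. h (S (c u) z)) + mean r (\<lambda>z. h (S 0 z))"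
          by (intro mean_diff cS cu r)
        also have "\<dots> \<le> mean r h + mean r h"
          by (intro add_mono mean_contraction[OF h r linS] nS cu)
        finally show "mean r (\<lambda>z. h (S (c u) z) - h (S 0 z)) \<le> mean r h + mean r h" .
      qed (use L in auto)
      finally show ?thesis by simp
    qed
    have "continuous_on (ball 0 1) (\<lambda>z. h (S 1 z) - h (S 0 z))"
      using L by (intro continuous_on_diff cS) auto
    then show "continuous_on (ball 0 1) (\<lambda>z. h (of_real (1 / \<kappa>) *s U z) - h (of_real (1 / \<kappa>) *s z))"
      by (simp only: S0 S1)
    fix z :: "complex^'N" assume z: "norm z < 1"
    define F where "F = (\<lambda>l. h (S l z) - h (S 0 z))"
    have Sl: "S l z = of_real (1 / \<kappa>) *s z + l *s (of_real (1 / \<kappa>) *s (U z - z))" for l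
      by (simp add: S_def vector_add_ldistrib vector_smult_assoc mult.commute)
    have hol: "F holomorphic_on cball 0 L"
    proof -
      have "(\<lambda>l. h (S l z)) holomorphic_on {l. S l z \<in> ball 0 1}"
        unfolding Sl by (rule holomorphic_several_line[OF h])
      moreover have "cball 0 L \<subseteq> {l. S l z \<in> ball 0 1}"
      proof
        fix l :: complex assume "l \<in> cball 0 L"
        then have "norm (S l z) \<le> norm z" by (intro nS) simp
        then show "l \<in> {l. S l z \<in> ball 0 1}" using z by simp
      qed
      ultimately show ?thesis unfolding F_def by (intro holomorphic_intros) (rule holomorphic_on_subset)
    qed
    have "integral {0..1} (\<lambda>u. F (of_real L * circ u) / (of_real L * circ u - 1)) = F 1"
      using L by (intro Schwarz_circ holomorphic_on_imp_continuous_on[OF hol] holomorphic_on_subset[OF hol]) (auto simp: F_def)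
    then show "h (of_real (1 / \<kappa>) *s U z) - h (of_real (1 / \<kappa>) *s z) = integral {0..1} (\<lambda>u. k u z)"
      by (simp add: F_def k_def c_def S0 S1)
  qed
qed

end

section \<open>Decomposition into smooth pieces\<close>

definition dil :: "real \<Rightarrow> (complex^'N \<Rightarrow> complex) \<Rightarrow> complex^'N \<Rightarrow> complex" where
  "dil r h = (\<lambda>z. h (of_real r *s z))"

definition dil_diff :: "real \<Rightarrow> (complex^'N \<Rightarrow> complex) \<Rightarrow> complex^'N \<Rightarrow> complex" where
  "dil_diff r h = (\<lambda>z. h z - dil r h z)"

definition dil_sum :: "real \<Rightarrow> (complex^'N \<Rightarrow> complex) \<Rightarrow> complex^'N \<Rightarrow> complex" where
  "dil_sum r h = (\<lambda>z. h z + dil r h z)"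

lemma funpow_comp_commute:
  assumes "\<And>x. f (g x) = g (f x)"
  shows "((\<lambda>x. f (g x)) ^^ n) x = (f ^^ n) ((g ^^ n) x)"
proof -
  have 1: "(f ^^ n) (g x) = g ((f ^^ n) x)" for n x by (induction n) (simp_all add: assms)
  show ?thesis by (induction n) (simp_all add: 1 assms funpow_swap1[of f])
qed

lemma funpow_commute1:
  assumes "\<And>x. f (g x) = g (f x)"
  shows "(f ^^ n) (g x) = g ((f ^^ n) x)"
  by (induction n) (simp_all add: assms)

lemma dil_dil: "dil a (dil b h) = dil (a * b) h"
  by (simp add: dil_def vector_smult_assoc mult.commute)

lemma dil_sum_dil: "dil_sum a (dil b h) = dil b (dil_sum a h)"
  by (simp add: dil_sum_def dil_def vector_smult_assoc mult.commute)

lemma dil_diff_dil: "dil_diff a (dil b h) = dil b (dil_diff a h)"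
  by (simp add: dil_diff_def dil_def vector_smult_assoc mult.commute)

lemma dil_sum_diff_commute: "dil_sum r (dil_diff r h) = dil_diff r (dil_sum r h)"
  by (simp add: dil_sum_def dil_diff_def dil_def vector_smult_assoc fun_eq_iff)

lemma dil_diff_square: "dil_diff (r * r) h = dil_sum r (dil_diff r h)"
  by (simp add: dil_sum_def dil_diff_def dil_def vector_smult_assoc fun_eq_iff)

text \<open>The factors of \<open>1 - D\<^sup>2 = (1 + D) (1 - D)\<close> commute, where \<open>D\<close> is the dilation by \<open>r\<close>.\<close>

lemma dil_diff_square_funpow:
  fixes h :: "complex^'N \<Rightarrow> complex"
  shows "(dil_diff (r * r) ^^ s) h = (dil_sum r ^^ s) ((dil_diff r ^^ s) h)"
proof -
  have e: "dil_diff (r * r) = (\<lambda>h :: complex^'N \<Rightarrow> complex. dil_sum r (dil_diff r h))"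
    by (rule ext) (rule dil_diff_square)
  show ?thesis unfolding e
    by (rule funpow_comp_commute[of "dil_sum r" "dil_diff r", OF dil_sum_diff_commute])
qed

lemma dil_funpow: "(dil c ^^ n) h = dil (c ^ n) h"
  by (induction n) (simp_all add: dil_dil, simp add: dil_def)

lemma dil_sum_funpow_add: "(dil_sum r ^^ s) (\<lambda>z. g z + h z) = (\<lambda>z. (dil_sum r ^^ s) g z + (dil_sum r ^^ s) h z)"
  by (induction s) (simp_all add: dil_sum_def dil_def fun_eq_iff algebra_simps)

lemma dil_diff_funpow_diff: "(dil_diff r ^^ s) (\<lambda>z. g z - h z) = (\<lambda>z. (dil_diff r ^^ s) g z - (dil_diff r ^^ s) h z)"
  by (induction s) (simp_all add: dil_diff_def dil_def fun_eq_iff algebra_simps)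

text \<open>The identities \<open>(1 + D)\<^sup>s - 1 = \<Sum> (1 + D)\<^sup>i D\<close> and \<open>1 - (1 - D)\<^sup>s = \<Sum> (1 - D)\<^sup>i D\<close> exhibit a factor \<open>D\<close>,
  so that these functions extend to a larger ball.\<close>

lemma dil_sum_funpow_telescope: "(dil_sum r ^^ s) g z - g z = (\<Sum>i<s. (dil_sum r ^^ i) (dil r g) z)"
proof (induction s)
  case (Suc s)
  have "(dil_sum r ^^ Suc s) g = (dil_sum r ^^ s) (\<lambda>z. g z + dil r g z)"
    by (simp add: funpow_swap1 dil_sum_def[of r g])
  then show ?case using Suc by (simp add: dil_sum_funpow_add)
qed simp

lemma dil_diff_funpow_telescope: "g z - (dil_diff r ^^ s) g z = (\<Sum>i<s. (dil_diff r ^^ i) (dil r g) z)"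
proof (induction s)
  case (Suc s)
  have "(dil_diff r ^^ Suc s) g = (dil_diff r ^^ s) (\<lambda>z. g z - dil r g z)"
    by (simp add: funpow_swap1 dil_diff_def[of r g])
  then show ?case using Suc by (simp add: dil_diff_funpow_diff algebra_simps)
qed simp

abbreviation hol :: "(complex^'N \<Rightarrow> complex) \<Rightarrow> bool" where
  "hol h \<equiv> holomorphic_several h (ball 0 1)"

lemma hol_dil: "hol h \<Longrightarrow> \<bar>r\<bar> \<le> 1 \<Longrightarrow> hol (dil r h)"
  unfolding dil_def by (rule holomorphic_several_dilate) auto

lemma hol_dil_diff: "hol h \<Longrightarrow> \<bar>r\<bar> \<le> 1 \<Longrightarrow> hol (dil_diff r h)"
  unfolding dil_diff_def by (intro holomorphic_several_diff hol_dil)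

lemma hol_dil_sum: "hol h \<Longrightarrow> \<bar>r\<bar> \<le> 1 \<Longrightarrow> hol (dil_sum r h)"
  unfolding dil_sum_def by (intro holomorphic_several_add hol_dil)

lemma hol_dil_diff_funpow: "hol h \<Longrightarrow> \<bar>r\<bar> \<le> 1 \<Longrightarrow> hol ((dil_diff r ^^ s) h)"
  by (induction s) (auto intro: hol_dil_diff)

lemma hol_dil_sum_funpow: "hol h \<Longrightarrow> \<bar>r\<bar> \<le> 1 \<Longrightarrow> hol ((dil_sum r ^^ s) h)"
  by (induction s) (auto intro: hol_dil_sum)

lemma holomorphic_several_zero: "holomorphic_several (\<lambda>z. 0) S"
  unfolding holomorphic_several_def by (intro ballI exI[of _ "\<lambda>v. 0"]) auto

lemma hol_sum: "finite I \<Longrightarrow> (\<And>i. i \<in> I \<Longrightarrow> hol (g i)) \<Longrightarrow> hol (\<lambda>z. \<Sum>i\<in>I. g i z)"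
  by (induction I rule: finite_induct) (auto intro: holomorphic_several_zero holomorphic_several_add)

lemma hol_cont: "hol h \<Longrightarrow> continuous_on (ball 0 1) h"
  by (rule holomorphic_several_continuous)

lemma hol_slice: "hol h \<Longrightarrow> slice_holomorphic h"
  by (rule holomorphic_several_slice)

lemma slice_dil: "slice_holomorphic h \<Longrightarrow> \<bar>r\<bar> \<le> 1 \<Longrightarrow> slice_holomorphic (dil r h)"
  unfolding dil_def by (rule slice_holomorphic_dilate) auto

lemma slice_dil_diff: "slice_holomorphic h \<Longrightarrow> \<bar>r\<bar> \<le> 1 \<Longrightarrow> slice_holomorphic (dil_diff r h)"
  unfolding dil_diff_def by (intro slice_holomorphic_diff slice_dil)

lemma Rad_funpow_dil: "(Rad ^^ m) (dil r h) = dil r ((Rad ^^ m) h)"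
proof (induction m)
  case (Suc m)
  show ?case by (rule ext) (simp add: Suc, simp add: dil_def Rad_dilate)
qed simp

lemma Rad_funpow_dil_diff:
  assumes h: "slice_holomorphic h" and r: "\<bar>r\<bar> \<le> 1" and z: "norm z < 1"
  shows "(Rad ^^ m) (dil_diff r h) z = dil_diff r ((Rad ^^ m) h) z"
  using z
proof (induction m arbitrary: z)
  case (Suc m)
  have s: "slice_holomorphic ((Rad ^^ m) h)" by (rule slice_holomorphic_Rad_funpow[OF h])
  have "(Rad ^^ Suc m) (dil_diff r h) z = Rad ((Rad ^^ m) (dil_diff r h)) z" by simp
  also have "\<dots> = Rad (dil_diff r ((Rad ^^ m) h)) z" using Suc by (intro Rad_cong)
  also have "\<dots> = Rad ((Rad ^^ m) h) z - Rad (dil r ((Rad ^^ m) h)) z"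
    unfolding dil_diff_def by (rule Rad_diff[OF s slice_dil[OF s r] Suc.prems])
  also have "\<dots> = dil_diff r ((Rad ^^ Suc m) h) z"
    unfolding dil_diff_def dil_def Rad_dilate by simp
  finally show ?case .
qed simp

text \<open>The radii are \<open>exp (- 2\<^sup>-\<^sup>j)\<close>, so that each of them is the square of the next one.\<close>

definition radius :: "nat \<Rightarrow> real" where "radius j = exp (- ((1/2) ^ j))"

lemma radius_pos [simp]: "0 < radius j" and radius_nonneg [simp]: "0 \<le> radius j"
  and radius_less_1 [simp]: "radius j < 1" and radius_le_1 [simp]: "radius j \<le> 1"
  by (simp_all add: radius_def)

lemma radius_square: "radius j = radius (Suc j) * radius (Suc j)"
  by (simp add: radius_def flip: exp_add)

lemma radius_mono: "i \<le> j \<Longrightarrow> radius i \<le> radius j"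
  by (simp add: radius_def power_decreasing)

lemma diff_op_dil:
  assumes "Vector_Spaces.linear (*s) (*s) U"
  shows "diff_op U (dil c h) = dil c (diff_op U h)"
  by (simp add: diff_op_def dil_def fun_eq_iff smult_linear[OF assms])

lemma diff_op_funpow_add: "(diff_op U ^^ n) (\<lambda>z. g z + h z) = (\<lambda>z. (diff_op U ^^ n) g z + (diff_op U ^^ n) h z)"
  by (induction n) (simp_all add: diff_op_def fun_eq_iff)

lemma diff_op_funpow_0: "(diff_op U ^^ n) (\<lambda>z. 0) = (\<lambda>z. 0)"
  by (induction n) (simp_all add: diff_op_def fun_eq_iff)

lemma diff_op_funpow_sum: "finite I \<Longrightarrow> (diff_op U ^^ n) (\<lambda>z. \<Sum>i\<in>I. g i z) = (\<lambda>z. \<Sum>i\<in>I. (diff_op U ^^ n) (g i) z)"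
  by (induction I rule: finite_induct) (simp_all add: diff_op_funpow_add diff_op_funpow_0)

text \<open>Common to all operators in question: unitary maps, rotations and linear maps of the ball into itself.\<close>

locale linear_contraction =
  fixes U :: "complex^'N \<Rightarrow> complex^'N"
  assumes linear: "Vector_Spaces.linear (*s) (*s) U" and contr: "\<And>z. norm (U z) \<le> norm z"
begin

lemma hol_diff_op: "hol h \<Longrightarrow> hol (diff_op U h)"
proof -
  assume h: "hol h"
  have "hol (\<lambda>z. h (U z))" by (rule holomorphic_several_linear[OF h linear]) (use contr le_less_trans in blast)
  then have "hol (\<lambda>z. h (U z) - h z)" by (rule holomorphic_several_diff[OF _ h])
  then show ?thesis by (simp add: diff_op_def[abs_def])
qed

lemma hol_diff_op_funpow: "hol h \<Longrightarrow> hol ((diff_op U ^^ n) h)"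
  by (induction n) (auto intro: hol_diff_op)

end

context sphere_norm
begin

lemma mean_dil_le: "slice_holomorphic h \<Longrightarrow> 0 \<le> r \<Longrightarrow> r < 1 \<Longrightarrow> \<bar>a\<bar> \<le> 1 \<Longrightarrow> mean r (dil a h) \<le> mean r h"
  unfolding dil_def by (rule mean_contract) auto

lemma mean_dil: "mean r (dil a h) = mean (a * r) h"
  unfolding dil_def by (rule mean_scale_smult[symmetric])

lemma mean_dil_diff:
  assumes h: "slice_holomorphic h" and r: "0 \<le> r" "r < 1" and s: "0 \<le> s"
  shows "mean r (dil_diff (exp (- s)) h) \<le> s * mean r (Rad h)"
proof -
  have e: "exp (- of_real s) = (of_real (exp (- s)) :: complex)" by (simp add: exp_of_real[symmetric])
  have c: "continuous_on (ball 0 1) (\<lambda>z. h (exp (- of_real s) *s z) - h z)"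
    by (intro slice_cont slice_holomorphic_diff slice_holomorphic_dilate h norm_exp_le_1) (use s in simp)
  have "mean r (dil_diff (exp (- s)) h) = mean r (\<lambda>z. (-1) * (h (exp (- of_real s) *s z) - h z))"
    by (simp add: dil_diff_def dil_def e)
  also have "\<dots> = norm (-1 :: complex) * mean r (\<lambda>z. h (exp (- of_real s) *s z) - h z)"
    by (rule mean_cmult[OF c r])
  also have "\<dots> \<le> norm (-1 :: complex) * (norm (- of_real s :: complex) * mean r (Rad h))"
    using s by (intro mult_left_mono mean_exp_flow[OF h r]) auto
  finally show ?thesis using s by simp
qed

lemma mean_dil_diff_funpow:
  assumes h: "slice_holomorphic h" and r: "0 \<le> r" "r < 1" and s: "0 \<le> s"
  shows "mean r ((dil_diff (exp (- s)) ^^ m) h) \<le> s ^ m * mean r ((Rad ^^ m) h)"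
  using h
proof (induction m arbitrary: h)
  case (Suc m)
  let ?B = "dil_diff (exp (- s))"
  have Bh: "slice_holomorphic (?B h)" using s by (intro slice_dil_diff Suc.prems) simp
  have Rh: "slice_holomorphic ((Rad ^^ m) h)" by (rule slice_holomorphic_Rad_funpow[OF Suc.prems])
  have "mean r ((?B ^^ Suc m) h) = mean r ((?B ^^ m) (?B h))" by (simp add: funpow_swap1)
  also have "\<dots> \<le> s ^ m * mean r ((Rad ^^ m) (?B h))" by (rule Suc.IH[OF Bh])
  also have "mean r ((Rad ^^ m) (?B h)) = mean r (?B ((Rad ^^ m) h))"
    using s by (intro mean_cong slice_cont slice_holomorphic_Rad_funpow Bh r Rad_funpow_dil_diff[OF Suc.prems]) auto
  also have "s ^ m * \<dots> \<le> s ^ m * (s * mean r (Rad ((Rad ^^ m) h)))"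
    using s by (intro mult_left_mono mean_dil_diff[OF Rh r]) auto
  finally show ?case by (simp add: mult_ac)
qed simp

lemma mean_dil_sum_funpow:
  assumes h: "hol h" and r: "0 \<le> r" "r < 1" and a: "\<bar>a\<bar> \<le> 1"
  shows "mean r ((dil_sum a ^^ m) h) \<le> 2 ^ m * mean r h"
proof (induction m)
  case (Suc m)
  define g where "g = (dil_sum a ^^ m) h"
  have g: "hol g" unfolding g_def by (rule hol_dil_sum_funpow[OF h a])
  have "mean r (dil_sum a g) \<le> mean r g + mean r (dil a g)"
    unfolding dil_sum_def by (intro mean_add hol_cont hol_dil g a r)
  also have "mean r (dil a g) \<le> mean r g" by (rule mean_dil_le[OF hol_slice[OF g] r a])
  finally show ?case using Suc by (simp add: g_def)
qed simp

lemma mean_dil_diff_funpow_trivial: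
  assumes h: "hol h" and r: "0 \<le> r" "r < 1" and a: "\<bar>a\<bar> \<le> 1"
  shows "mean r ((dil_diff a ^^ m) h) \<le> 2 ^ m * mean r h"
proof (induction m)
  case (Suc m)
  define g where "g = (dil_diff a ^^ m) h"
  have g: "hol g" unfolding g_def by (rule hol_dil_diff_funpow[OF h a])
  have "mean r (dil_diff a g) \<le> mean r g + mean r (dil a g)"
    unfolding dil_diff_def by (intro mean_diff hol_cont hol_dil g a r)
  also have "mean r (dil a g) \<le> mean r g" by (rule mean_dil_le[OF hol_slice[OF g] r a])
  finally show ?case using Suc by (simp add: g_def)
qed simp

text \<open>The \<open>j\<close>-th piece is \<open>B\<^sub>j\<^sup>s f - B\<^sub>j\<^sub>+\<^sub>1\<^sup>s f\<close>, where \<open>B\<^sub>j\<close> is the difference of the identity and the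
  dilation \<open>D\<^sub>j\<close> by \<open>radius j\<close>. Since \<open>D\<^sub>j\<close> is the square of \<open>D = D\<^sub>j\<^sub>+\<^sub>1\<close>, the piece is
  \<open>((1 + D)\<^sup>s - 1) (1 - D)\<^sup>s f\<close>, which is divisible both by \<open>D\<close> (so it extends beyond the unit ball) and by
  \<open>(1 - D)\<^sup>s\<close> (so it is as small as \<open>2\<^sup>-\<^sup>j\<^sup>s\<close> times the derivative of order \<open>s\<close>). \<open>dyadic_core\<close> is
  the piece before the last dilation.\<close>

definition dyadic_core :: "nat \<Rightarrow> (complex^'N \<Rightarrow> complex) \<Rightarrow> nat \<Rightarrow> complex^'N \<Rightarrow> complex" where
  "dyadic_core s f j = (\<lambda>z. \<Sum>i<s. (dil_sum (radius (Suc j)) ^^ i) (dil (radius (Suc (Suc j))) ((dil_diff (radius (Suc j)) ^^ s) f)) z)"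

lemma dyadic_piece:
  "(dil_diff (radius j) ^^ s) f z - (dil_diff (radius (Suc j)) ^^ s) f z = dil (radius (Suc (Suc j))) (dyadic_core s f j) z"
proof -
  let ?r = "radius (Suc j)" and ?y = "radius (Suc (Suc j))" and ?g = "(dil_diff (radius (Suc j)) ^^ s) f"
  have "(dil_diff (radius j) ^^ s) f = (dil_sum ?r ^^ s) ?g"
    by (subst radius_square) (rule dil_diff_square_funpow)
  then have "(dil_diff (radius j) ^^ s) f z - ?g z = (\<Sum>i<s. (dil_sum ?r ^^ i) (dil ?r ?g) z)"
    by (simp only: dil_sum_funpow_telescope)
  also have "dil ?r ?g = dil ?y (dil ?y ?g)" by (subst radius_square) (simp only: dil_dil)
  also have "(\<lambda>i. (dil_sum ?r ^^ i) (dil ?y (dil ?y ?g)) z) = (\<lambda>i. dil ?y ((dil_sum ?r ^^ i) (dil ?y ?g)) z)"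
    by (simp only: funpow_commute1[of "dil_sum ?r" "dil ?y", OF dil_sum_dil])
  finally show ?thesis by (simp add: dil_def dyadic_core_def)
qed

lemma hol_dyadic_core: "hol f \<Longrightarrow> hol (dyadic_core s f j)"
  unfolding dyadic_core_def
  by (intro hol_sum hol_dil_sum_funpow hol_dil hol_dil_diff_funpow) auto

lemma sum_power2_le: "(\<Sum>i<s. 2 ^ i * a) \<le> real s * 2 ^ s * a" if "0 \<le> a" for a :: real
proof -
  have "(\<Sum>i<s. 2 ^ i * a) \<le> (\<Sum>i<s. 2 ^ s * a)" using that by (intro sum_mono mult_right_mono power_increasing) auto
  then show ?thesis by (simp add: mult_ac)
qed

lemma mean_dyadic_core:
  assumes f: "hol f" and r: "0 \<le> r" "r < 1"
  shows "mean r (dyadic_core s f j) \<le> real s * 2 ^ s * ((1/2) ^ (j * s) * mean (radius (Suc (Suc j))) ((Rad ^^ s) f))"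
proof -
  let ?r = "radius (Suc j)" and ?y = "radius (Suc (Suc j))" and ?g = "(dil_diff (radius (Suc j)) ^^ s) f"
  have g: "hol (dil ?y ?g)" by (intro hol_dil hol_dil_diff_funpow f) auto
  have sf: "slice_holomorphic f" by (rule hol_slice[OF f])
  have "mean r (dil ?y ?g) = mean r ((dil_diff ?r ^^ s) (dil ?y f))"
    by (simp only: funpow_commute1[of "dil_diff ?r" "dil ?y", OF dil_diff_dil])
  also have "\<dots> \<le> ((1/2) ^ Suc j) ^ s * mean r ((Rad ^^ s) (dil ?y f))"
    unfolding radius_def[of "Suc j"] by (intro mean_dil_diff_funpow slice_dil sf r) auto
  also have "mean r ((Rad ^^ s) (dil ?y f)) = mean (?y * r) ((Rad ^^ s) f)"
    by (simp only: Rad_funpow_dil mean_dil)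
  also have "((1/2) ^ Suc j) ^ s * \<dots> \<le> (1/2) ^ (j * s) * mean ?y ((Rad ^^ s) f)"
  proof (intro mult_mono)
    show "((1/2) ^ Suc j) ^ s \<le> ((1/2) ^ (j * s) :: real)"
      by (simp add: power_mult[symmetric] power_decreasing del: power_Suc)
    show "mean (?y * r) ((Rad ^^ s) f) \<le> mean ?y ((Rad ^^ s) f)"
      using r by (intro mean_mono slice_holomorphic_Rad_funpow sf) (auto simp: mult_le_one)
  qed auto
  finally have 1: "mean r (dil ?y ?g) \<le> (1/2) ^ (j * s) * mean ?y ((Rad ^^ s) f)" .
  have "mean r (dyadic_core s f j) \<le> (\<Sum>i<s. mean r ((dil_sum ?r ^^ i) (dil ?y ?g)))"
    unfolding dyadic_core_def by (intro mean_sum hol_cont hol_dil_sum_funpow g r) auto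
  also have "\<dots> \<le> (\<Sum>i<s. 2 ^ i * mean r (dil ?y ?g))"
    by (intro sum_mono mean_dil_sum_funpow g r) auto
  also have "\<dots> \<le> real s * 2 ^ s * mean r (dil ?y ?g)" by (rule sum_power2_le) simp
  also have "\<dots> \<le> real s * 2 ^ s * ((1/2) ^ (j * s) * mean ?y ((Rad ^^ s) f))"
    by (intro mult_left_mono 1) auto
  finally show ?thesis .
qed

text \<open>The remaining low-frequency piece \<open>f - B\<^sub>0\<^sup>s f\<close>, again before its last dilation.\<close>

definition initial_core :: "nat \<Rightarrow> (complex^'N \<Rightarrow> complex) \<Rightarrow> complex^'N \<Rightarrow> complex" where
  "initial_core s f = (\<lambda>z. \<Sum>i<s. (dil_diff (radius 0) ^^ i) (dil (radius 1) f) z)"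

lemma initial_piece: "f z - (dil_diff (radius 0) ^^ s) f z = dil (radius 1) (initial_core s f) z"
proof -
  have "f z - (dil_diff (radius 0) ^^ s) f z = (\<Sum>i<s. (dil_diff (radius 0) ^^ i) (dil (radius 0) f) z)"
    by (rule dil_diff_funpow_telescope)
  also have "dil (radius 0) f = dil (radius 1) (dil (radius 1) f)" by (subst radius_square) (simp add: dil_dil)
  also have "(\<lambda>i. (dil_diff (radius 0) ^^ i) (dil (radius 1) (dil (radius 1) f)) z)
      = (\<lambda>i. dil (radius 1) ((dil_diff (radius 0) ^^ i) (dil (radius 1) f)) z)"
    by (simp only: funpow_commute1[of "dil_diff (radius 0)" "dil (radius 1)", OF dil_diff_dil])
  finally show ?thesis by (simp add: dil_def initial_core_def)
qed

lemma hol_initial_core: "hol f \<Longrightarrow> hol (initial_core s f)"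
  unfolding initial_core_def
  by (intro hol_sum hol_dil hol_dil_diff_funpow) auto

lemma mean_initial_core:
  assumes f: "hol f" and r: "0 \<le> r" "r < 1"
  shows "mean r (initial_core s f) \<le> real s * 2 ^ s * mean (radius 1) f"
proof -
  have g: "hol (dil (radius 1) f)" by (intro hol_dil f) auto
  have "mean r (initial_core s f) \<le> (\<Sum>i<s. mean r ((dil_diff (radius 0) ^^ i) (dil (radius 1) f)))"
    unfolding initial_core_def by (intro mean_sum hol_cont hol_dil_diff_funpow g r) auto
  also have "\<dots> \<le> (\<Sum>i<s. 2 ^ i * mean r (dil (radius 1) f))"
    by (intro sum_mono mean_dil_diff_funpow_trivial g r) auto
  also have "\<dots> \<le> real s * 2 ^ s * mean r (dil (radius 1) f)" by (rule sum_power2_le) simp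
  also have "mean r (dil (radius 1) f) \<le> mean (radius 1) f"
    unfolding mean_dil using r by (intro mean_mono hol_slice f) (auto simp: mult_le_one)
  finally show ?thesis by (simp add: mult_left_mono)
qed

lemma telescope_dyadic:
  assumes "k \<le> m"
  shows "(dil_diff (radius k) ^^ s) f z = (\<Sum>j=k..<m. dil (radius (Suc (Suc j))) (dyadic_core s f j) z) + (dil_diff (radius m) ^^ s) f z"
  using assms
proof (induction m rule: dec_induct)
  case (step m)
  have "(dil_diff (radius m) ^^ s) f z = dil (radius (Suc (Suc m))) (dyadic_core s f m) z + (dil_diff (radius (Suc m)) ^^ s) f z"
    using dyadic_piece[where j = m and s = s and f = f and z = z] by (simp only: diff_eq_eq)
  then show ?case using step by (simp add: add.assoc)
qed simp

text \<open>The tail is the sum of the pieces from \<open>k\<close> on. The remainder at scale \<open>m\<close> is at most \<open>2\<^sup>-\<^sup>m\<^sup>s\<close> times the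
  mean of the derivative of order \<open>s\<close> over the fixed sphere of radius \<open>r\<close>, hence vanishes in the limit; the
  resulting bound does not depend on \<open>r\<close>.\<close>

lemma mean_dil_diff_tail:
  assumes f: "hol f" and r: "0 \<le> r" "r < 1" and s: "1 \<le> s"
    and b: "\<And>j. b j = (1/2) ^ (j * s) * mean (radius (Suc (Suc j))) ((Rad ^^ s) f)"
    and sm: "summable b"
  shows "mean r ((dil_diff (radius k) ^^ s) f) \<le> real s * 2 ^ s * (\<Sum>j. b (j + k))"
proof (rule LIMSEQ_le_const)
  have b0: "0 \<le> b j" for j by (simp add: b)
  let ?R = "mean r ((Rad ^^ s) f)"
  show "(\<lambda>m. real s * 2 ^ s * (\<Sum>j. b (j + k)) + ((1/2) ^ s) ^ m * ?R) \<longlonglongrightarrow> real s * 2 ^ s * (\<Sum>j. b (j + k))"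
  proof -
    have "(1/2 :: real) ^ s < 1" using s by (simp add: power_less_one_iff)
    then have "(\<lambda>m. ((1/2 :: real) ^ s) ^ m) \<longlonglongrightarrow> 0" by (intro LIMSEQ_realpow_zero) auto
    then show ?thesis using tendsto_add[OF tendsto_const tendsto_mult_right, of "\<lambda>m. ((1/2 :: real) ^ s) ^ m" 0] by (auto intro!: tendsto_eq_intros)
  qed
  show "\<exists>N. \<forall>m\<ge>N. mean r ((dil_diff (radius k) ^^ s) f) \<le> real s * 2 ^ s * (\<Sum>j. b (j + k)) + ((1/2) ^ s) ^ m * ?R"
  proof (intro exI[of _ k] allI impI)
    fix m assume m: "k \<le> m"
    have hj: "hol (dil (radius (Suc (Suc j))) (dyadic_core s f j))" for j
      by (intro hol_dil hol_dyadic_core f) auto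
    have hm: "hol ((dil_diff (radius m) ^^ s) f)" by (intro hol_dil_diff_funpow f) auto
    have "mean r ((dil_diff (radius k) ^^ s) f)
      = mean r (\<lambda>z. (\<Sum>j=k..<m. dil (radius (Suc (Suc j))) (dyadic_core s f j) z) + (dil_diff (radius m) ^^ s) f z)"
      by (rule arg_cong[where f = "mean r"]) (rule ext, rule telescope_dyadic[OF m])
    also have "\<dots> \<le> mean r (\<lambda>z. \<Sum>j=k..<m. dil (radius (Suc (Suc j))) (dyadic_core s f j) z) + mean r ((dil_diff (radius m) ^^ s) f)"
      by (intro mean_add hol_cont hol_sum hj hm r) auto
    also have "mean r (\<lambda>z. \<Sum>j=k..<m. dil (radius (Suc (Suc j))) (dyadic_core s f j) z)
        \<le> (\<Sum>j=k..<m. mean r (dil (radius (Suc (Suc j))) (dyadic_core s f j)))"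
      by (intro mean_sum hol_cont hj r) auto
    also have "\<dots> \<le> (\<Sum>j=k..<m. real s * 2 ^ s * b j)"
    proof (rule sum_mono)
      fix j
      have "mean r (dil (radius (Suc (Suc j))) (dyadic_core s f j)) \<le> mean r (dyadic_core s f j)"
        by (intro mean_dil_le hol_slice hol_dyadic_core f r) auto
      also have "\<dots> \<le> real s * 2 ^ s * b j" unfolding b by (rule mean_dyadic_core[OF f r])
      finally show "mean r (dil (radius (Suc (Suc j))) (dyadic_core s f j)) \<le> real s * 2 ^ s * b j" .
    qed
    also have "\<dots> = real s * 2 ^ s * (\<Sum>j<m - k. b (j + k))"
      unfolding sum_distrib_left by (rule sum.reindex_bij_witness[of _ "\<lambda>j. j + k" "\<lambda>j. j - k"]) auto
    also have "\<dots> \<le> real s * 2 ^ s * (\<Sum>j. b (j + k))"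
      using sm b0 by (intro mult_left_mono sum_le_suminf) (auto simp: summable_iff_shift)
    also have "mean r ((dil_diff (radius m) ^^ s) f) \<le> ((1/2) ^ m) ^ s * ?R"
      unfolding radius_def by (intro mean_dil_diff_funpow hol_slice f r) auto
    also have "((1/2 :: real) ^ m) ^ s = ((1/2) ^ s) ^ m" by (simp add: power_mult[symmetric] mult.commute)
    finally show "mean r ((dil_diff (radius k) ^^ s) f) \<le> real s * 2 ^ s * (\<Sum>j. b (j + k)) + ((1/2) ^ s) ^ m * ?R"
      by simp
  qed
qed

lemma mean_le_dyadic:
  assumes f: "hol f" and r: "0 \<le> r" "r < 1" and s: "1 \<le> s"
    and b: "\<And>j. b j = (1/2) ^ (j * s) * mean (radius (Suc (Suc j))) ((Rad ^^ s) f)"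
    and sm: "summable b"
  shows "mean r f \<le> real s * 2 ^ s * (mean (radius 1) f + (\<Sum>j. b j))"
proof -
  have h1: "hol (dil (radius 1) (initial_core s f))" by (intro hol_dil hol_initial_core f) auto
  have h2: "hol ((dil_diff (radius 0) ^^ s) f)" by (intro hol_dil_diff_funpow f) auto
  have "mean r f = mean r (\<lambda>z. dil (radius 1) (initial_core s f) z + (dil_diff (radius 0) ^^ s) f z)"
    by (rule arg_cong[where f = "mean r"]) (rule ext, use initial_piece[where s = s and f = f] in \<open>simp only: diff_eq_eq\<close>)
  also have "\<dots> \<le> mean r (dil (radius 1) (initial_core s f)) + mean r ((dil_diff (radius 0) ^^ s) f)"
    by (intro mean_add hol_cont h1 h2 r)
  also have "mean r (dil (radius 1) (initial_core s f)) \<le> mean r (initial_core s f)"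
    by (intro mean_dil_le hol_slice hol_initial_core f r) auto
  also have "\<dots> \<le> real s * 2 ^ s * mean (radius 1) f" by (rule mean_initial_core[OF f r])
  also have "mean r ((dil_diff (radius 0) ^^ s) f) \<le> real s * 2 ^ s * (\<Sum>j. b (j + 0))"
    by (rule mean_dil_diff_tail[OF f r s b sm])
  finally show ?thesis by (simp add: algebra_simps)
qed

end

section \<open>Differences of the pieces\<close>

context sphere_norm
begin

lemma mean_diff_op_trivial:
  assumes U: "linear_contraction U" and h: "hol h" and r: "0 \<le> r" "r < 1"
  shows "mean r ((diff_op U ^^ n) h) \<le> 2 ^ n * mean r h"
proof (induction n)
  case (Suc n)
  interpret U: linear_contraction U by (rule U)
  define g where "g = (diff_op U ^^ n) h"
  have g: "hol g" unfolding g_def by (rule U.hol_diff_op_funpow[OF h])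
  have gU: "hol (\<lambda>z. g (U z))"
    by (rule holomorphic_several_linear[OF g U.linear]) (use U.contr le_less_trans in blast)
  have "mean r (diff_op U g) \<le> mean r (\<lambda>z. g (U z)) + mean r g"
    unfolding diff_op_def[abs_def] by (intro mean_diff hol_cont g gU r)
  also have "mean r (\<lambda>z. g (U z)) \<le> mean r g" by (rule mean_contraction[OF g r U.linear U.contr])
  finally show ?case using Suc by (simp add: g_def)
qed simp

text \<open>If a function extends holomorphically to a ball that is larger by the factor \<open>exp \<tau>\<close>, then an
  \<open>n\<close>-fold difference with step \<open>d\<close> gains the factor \<open>(d / \<tau>)\<^sup>n\<close>: each step uses an \<open>n\<close>-th of the room.\<close>

lemma mean_diff_op_room:
  assumes U: "linear_contraction U" and h: "hol h" and r: "0 \<le> r" "r < 1"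
    and d: "\<And>z. norm (U z - z) \<le> d * norm z" and d0: "0 < d" and t: "0 < \<tau>" and n: "1 \<le> n"
  shows "mean r ((diff_op U ^^ n) (dil (exp (- \<tau>)) h)) \<le> (4 * real n * d / \<tau>) ^ n * mean r h"
proof -
  interpret U: linear_contraction U by (rule U)
  define \<kappa> where "\<kappa> = exp (\<tau> / real n)"
  \<comment> \<open>The room \<open>exp \<tau>\<close> is divided into \<open>n\<close> equal factors \<open>\<kappa>\<close>; \<open>L\<close> is the radius of the disc in the pencil that fits into one of them.\<close>
  define L where "L = (\<kappa> - 1) / d"
  have \<kappa>: "\<kappa> = 1 + L * d" using d0 by (simp add: L_def)
  have "\<tau> / real n \<le> \<kappa> - 1" unfolding \<kappa>_def using exp_ge_add_one_self[of "\<tau> / real n"] by linarith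
  then have L: "\<tau> / (real n * d) \<le> L" using d0 by (simp add: L_def field_simps)
  have q0: "0 < \<tau> / (real n * d)" using t n d0 by simp
  have L0: "0 < L" using L q0 by linarith
  have inv: "4 / L \<le> 4 * real n * d / \<tau>"
  proof -
    have "4 / L \<le> 4 / (\<tau> / (real n * d))" by (rule divide_left_mono[OF L _ mult_pos_pos[OF L0 q0]]) simp
    then show ?thesis by (simp add: mult_ac)
  qed
  show ?thesis
  proof (cases "2 \<le> L")
    case True
    define P where "P = (\<lambda>h. diff_op U (dil (1 / \<kappa>) h))"
    have k1: "1 \<le> \<kappa>" using True d0 by (simp add: \<kappa>)
    have hP: "hol (P g)" if "hol g" for g
      unfolding P_def using that k1 by (intro U.hol_diff_op hol_dil) auto
    have mP: "mean r (P g) \<le> (4 / L) * mean r g" if "hol g" for g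
      using mean_diff_near_identity[OF that r U.linear d less_imp_le[OF d0] True \<kappa>]
      by (simp add: P_def diff_op_def[abs_def] dil_def)
    have hPn: "hol ((P ^^ m) h)" for m by (induction m) (auto intro: hP h)
    have Pn: "mean r ((P ^^ m) h) \<le> (4 / L) ^ m * mean r h" for m
    proof (induction m)
      case (Suc m)
      have "mean r (P ((P ^^ m) h)) \<le> (4 / L) * mean r ((P ^^ m) h)" by (rule mP[OF hPn])
      also have "\<dots> \<le> (4 / L) * ((4 / L) ^ m * mean r h)" using L0 by (intro mult_left_mono Suc) auto
      finally show ?case by (simp add: mult_ac)
    qed simp
    have "(1 / \<kappa>) ^ n = exp (- \<tau>)"
      using n by (simp add: \<kappa>_def power_one_over exp_of_nat_mult[symmetric] exp_minus inverse_eq_divide)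
    then have "(diff_op U ^^ n) (dil (exp (- \<tau>)) h) = (diff_op U ^^ n) ((dil (1 / \<kappa>) ^^ n) h)"
      by (simp only: dil_funpow)
    also have "\<dots> = (P ^^ n) h"
      unfolding P_def by (rule funpow_comp_commute[symmetric]) (rule diff_op_dil[OF U.linear])
    finally have "mean r ((diff_op U ^^ n) (dil (exp (- \<tau>)) h)) \<le> (4 / L) ^ n * mean r h" using Pn by simp
    also have "\<dots> \<le> (4 * real n * d / \<tau>) ^ n * mean r h"
      using inv L0 by (intro mult_right_mono power_mono) auto
    finally show ?thesis .
  next
    case False
    \<comment> \<open>There is less room than the displacement, and the claim is weaker than the trivial bound.\<close>
    then have "2 \<le> 4 / L" using L0 by (simp add: field_simps)
    then have 2: "2 \<le> 4 * real n * d / \<tau>" using inv by linarith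
    have hd: "hol (dil (exp (- \<tau>)) h)" using t by (intro hol_dil h) auto
    have "mean r ((diff_op U ^^ n) (dil (exp (- \<tau>)) h)) \<le> 2 ^ n * mean r (dil (exp (- \<tau>)) h)"
      by (rule mean_diff_op_trivial[OF U hd r])
    also have "\<dots> \<le> (4 * real n * d / \<tau>) ^ n * mean r h"
      using 2 t by (intro mult_mono power_mono mean_dil_le hol_slice h r) auto
    finally show ?thesis .
  qed
qed

text \<open>Pieces below the scale \<open>k\<close> of the displacement extend far enough to gain \<open>2\<^sup>-\<^sup>(\<^sup>k\<^sup>-\<^sup>j\<^sup>)\<^sup>n\<close> from the \<open>n\<close>-fold
  difference; for the tail the trivial bound \<open>2\<^sup>n\<close> suffices.\<close>

lemma mean_diff_op_dyadic:
  assumes U: "linear_contraction U" and f: "hol f" and r: "0 \<le> r" "r < 1" and s: "1 \<le> s" and n: "1 \<le> n"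
    and d: "\<And>z. norm (U z - z) \<le> (1/2) ^ k * norm z"
    and b: "\<And>j. b j = (1/2) ^ (j * s) * mean (radius (Suc (Suc j))) ((Rad ^^ s) f)"
    and sm: "summable b"
  shows "mean r ((diff_op U ^^ n) f) \<le> (16 * real n) ^ n * (real s * 2 ^ s) *
    ((1/2) ^ (k * n) * mean (radius 1) f + (\<Sum>j<k. (1/2) ^ ((k - j) * n) * b j) + (\<Sum>j. b (j + k)))"
proof -
  interpret U: linear_contraction U by (rule U)
  define C where "C = (16 * real n) ^ n"
  define K where "K = real s * 2 ^ s"
  have K: "0 \<le> K" by (simp add: K_def)
  have C2: "2 ^ n \<le> C" unfolding C_def using n by (intro power_mono) auto
  then have C: "0 \<le> C" by (rule order_trans[rotated]) simp
  let ?c = "\<lambda>j. dil (radius (Suc (Suc j))) (dyadic_core s f j)"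
  have h1: "hol (dil (radius 1) (initial_core s f))" by (intro hol_dil hol_initial_core f) auto
  have h2: "hol (?c j)" for j by (intro hol_dil hol_dyadic_core f) auto
  have h3: "hol ((dil_diff (radius k) ^^ s) f)" by (intro hol_dil_diff_funpow f) auto
  have "f z = dil (radius 1) (initial_core s f) z + ((\<Sum>j=0..<k. ?c j z) + (dil_diff (radius k) ^^ s) f z)" for z
  proof -
    have "f z = dil (radius 1) (initial_core s f) z + (dil_diff (radius 0) ^^ s) f z"
      using initial_piece[where s = s and f = f and z = z] by (simp only: diff_eq_eq)
    also have "(dil_diff (radius 0) ^^ s) f z = (\<Sum>j=0..<k. ?c j z) + (dil_diff (radius k) ^^ s) f z"
      by (rule telescope_dyadic) simp
    finally show ?thesis .
  qed
  then have "f = (\<lambda>z. dil (radius 1) (initial_core s f) z + ((\<Sum>j=0..<k. ?c j z) + (dil_diff (radius k) ^^ s) f z))"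
    by (rule ext)
  then have "(diff_op U ^^ n) f = (diff_op U ^^ n) (\<lambda>z. dil (radius 1) (initial_core s f) z + ((\<Sum>j=0..<k. ?c j z) + (dil_diff (radius k) ^^ s) f z))"
    by (rule arg_cong)
  also have "\<dots> = (\<lambda>z. (diff_op U ^^ n) (dil (radius 1) (initial_core s f)) z
      + ((\<Sum>j=0..<k. (diff_op U ^^ n) (?c j) z) + (diff_op U ^^ n) ((dil_diff (radius k) ^^ s) f) z))"
    by (simp only: diff_op_funpow_add diff_op_funpow_sum finite_atLeastLessThan)
  finally have "mean r ((diff_op U ^^ n) f) = mean r (\<lambda>z. (diff_op U ^^ n) (dil (radius 1) (initial_core s f)) z
      + ((\<Sum>j=0..<k. (diff_op U ^^ n) (?c j) z) + (diff_op U ^^ n) ((dil_diff (radius k) ^^ s) f) z))"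
    by (rule arg_cong)
  also have "\<dots> \<le> mean r ((diff_op U ^^ n) (dil (radius 1) (initial_core s f)))
      + (mean r (\<lambda>z. \<Sum>j=0..<k. (diff_op U ^^ n) (?c j) z) + mean r ((diff_op U ^^ n) ((dil_diff (radius k) ^^ s) f)))"
    by (intro order_trans[OF mean_add] add_mono order_refl mean_add r hol_cont U.hol_diff_op_funpow h1 h2 h3
        hol_sum holomorphic_several_add finite_atLeastLessThan)
  also have "mean r ((diff_op U ^^ n) (dil (radius 1) (initial_core s f))) \<le> C * K * ((1/2) ^ (k * n) * mean (radius 1) f)"
  proof -
    have "mean r ((diff_op U ^^ n) (dil (radius 1) (initial_core s f)))
        \<le> (4 * real n * (1/2) ^ k / (1/2) ^ 1) ^ n * mean r (initial_core s f)"
      unfolding radius_def by (intro mean_diff_op_room[OF U _ r d] hol_initial_core f n) auto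
    also have "\<dots> \<le> (C * (1/2) ^ (k * n)) * (K * mean (radius 1) f)"
    proof (intro mult_mono)
      have "(4 * real n * (1/2) ^ k / (1/2) ^ 1) ^ n \<le> (16 * real n * (1/2) ^ k) ^ n"
        by (intro power_mono) auto
      also have "\<dots> = C * (1/2) ^ (k * n)" by (simp add: C_def power_mult_distrib power_mult)
      finally show "(4 * real n * (1/2) ^ k / (1/2) ^ 1) ^ n \<le> C * (1/2) ^ (k * n)" .
      show "mean r (initial_core s f) \<le> K * mean (radius 1) f"
        unfolding K_def by (rule mean_initial_core[OF f r])
    qed (use C in auto)
    finally show ?thesis by (simp add: mult_ac)
  qed
  also have "mean r (\<lambda>z. \<Sum>j=0..<k. (diff_op U ^^ n) (?c j) z) \<le> (\<Sum>j=0..<k. mean r ((diff_op U ^^ n) (?c j)))"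
    by (intro mean_sum hol_cont U.hol_diff_op_funpow h2 r) auto
  also have "\<dots> \<le> (\<Sum>j=0..<k. C * K * ((1/2) ^ ((k - j) * n) * b j))"
  proof (rule sum_mono)
    fix j assume "j \<in> {0..<k}"
    then have j: "j < k" by simp
    have "mean r ((diff_op U ^^ n) (?c j))
        \<le> (4 * real n * (1/2) ^ k / (1/2) ^ (Suc (Suc j))) ^ n * mean r (dyadic_core s f j)"
      unfolding radius_def by (intro mean_diff_op_room[OF U _ r d] hol_dyadic_core f n) auto
    also have "\<dots> \<le> (C * (1/2) ^ ((k - j) * n)) * (K * b j)"
    proof (intro mult_mono)
      have "(1/2 :: real) ^ k = (1/2) ^ (k - j) * (1/2) ^ j" using j by (simp add: power_add[symmetric])
      then have "4 * real n * (1/2) ^ k / (1/2) ^ (Suc (Suc j)) = 16 * real n * (1/2) ^ (k - j)" by simp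
      then show "(4 * real n * (1/2) ^ k / (1/2) ^ (Suc (Suc j))) ^ n \<le> C * (1/2) ^ ((k - j) * n)"
        by (simp only: C_def power_mult_distrib power_mult)
      show "mean r (dyadic_core s f j) \<le> K * b j"
        unfolding K_def b by (rule mean_dyadic_core[OF f r])
    qed (use C in auto)
    finally show "mean r ((diff_op U ^^ n) (?c j)) \<le> C * K * ((1/2) ^ ((k - j) * n) * b j)" by (simp add: mult_ac)
  qed
  also have "mean r ((diff_op U ^^ n) ((dil_diff (radius k) ^^ s) f)) \<le> C * K * (\<Sum>j. b (j + k))"
  proof -
    have b0: "0 \<le> (\<Sum>j. b (j + k))"
    proof (rule suminf_nonneg)
      show "summable (\<lambda>j. b (j + k))" using sm by (simp only: summable_iff_shift)
      show "0 \<le> b (j + k)" for j unfolding b by simp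
    qed
    have "mean r ((diff_op U ^^ n) ((dil_diff (radius k) ^^ s) f)) \<le> 2 ^ n * mean r ((dil_diff (radius k) ^^ s) f)"
      by (rule mean_diff_op_trivial[OF U h3 r])
    also have "\<dots> \<le> C * (K * (\<Sum>j. b (j + k)))"
      unfolding K_def by (intro mult_mono C2 C mean_dil_diff_tail[OF f r s b sm]) auto
    finally show ?thesis by (simp add: mult_ac)
  qed
  finally have "mean r ((diff_op U ^^ n) f) \<le> C * K *
      ((1/2) ^ (k * n) * mean (radius 1) f + (\<Sum>j<k. (1/2) ^ ((k - j) * n) * b j) + (\<Sum>j. b (j + k)))"
    by (simp add: sum_distrib_left[symmetric] atLeast0LessThan distrib_left add.assoc)
  then show ?thesis by (simp only: C_def K_def)
qed

end

section \<open>Rotational differences and the radial derivative\<close>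

lemma diff_rot_exp: "diff_rot t h = (\<lambda>z. h (exp (\<i> * of_real t) *s z) - h z)"
  by (simp add: diff_rot_def fun_eq_iff)

lemma slice_diff_rot: "slice_holomorphic h \<Longrightarrow> slice_holomorphic (diff_rot t h)"
  unfolding diff_rot_exp by (intro slice_holomorphic_diff slice_holomorphic_dilate norm_exp_le_1) auto

lemma slice_diff_rot_funpow: "slice_holomorphic h \<Longrightarrow> slice_holomorphic ((diff_rot t ^^ n) h)"
  by (induction n) (auto intro: slice_diff_rot)

lemma diff_rot_funpow_add: "(diff_rot t ^^ n) (\<lambda>z. g z + h z) = (\<lambda>z. (diff_rot t ^^ n) g z + (diff_rot t ^^ n) h z)"
  by (induction n) (simp_all add: diff_rot_def fun_eq_iff)

lemma diff_rot_funpow_cmult: "(diff_rot t ^^ n) (\<lambda>z. c * h z) = (\<lambda>z. c * (diff_rot t ^^ n) h z)"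
  by (induction n) (simp_all add: diff_rot_def fun_eq_iff right_diff_distrib)

lemma Rad_funpow_diff_rot:
  assumes h: "slice_holomorphic h" and z: "norm z < 1"
  shows "(Rad ^^ m) (diff_rot t h) z = diff_rot t ((Rad ^^ m) h) z"
  using z
proof (induction m arbitrary: z)
  case (Suc m)
  have s: "slice_holomorphic ((Rad ^^ m) h)" by (rule slice_holomorphic_Rad_funpow[OF h])
  have s2: "slice_holomorphic (\<lambda>z. (Rad ^^ m) h (exp (\<i> * of_real t) *s z))"
    by (intro slice_holomorphic_dilate s norm_exp_le_1) simp
  have "(Rad ^^ Suc m) (diff_rot t h) z = Rad ((Rad ^^ m) (diff_rot t h)) z" by simp
  also have "\<dots> = Rad (diff_rot t ((Rad ^^ m) h)) z" using Suc by (intro Rad_cong)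
  also have "\<dots> = Rad (\<lambda>z. (Rad ^^ m) h (exp (\<i> * of_real t) *s z)) z - Rad ((Rad ^^ m) h) z"
    unfolding diff_rot_exp by (rule Rad_diff[OF s2 s Suc.prems])
  also have "\<dots> = diff_rot t ((Rad ^^ Suc m) h) z"
    unfolding diff_rot_exp Rad_dilate by simp
  finally show ?case .
qed simp

context sphere_norm
begin

lemma mean_diff_rot:
  assumes h: "slice_holomorphic h" and r: "0 \<le> r" "r < 1"
  shows "mean r (diff_rot t h) \<le> \<bar>t\<bar> * mean r (Rad h)"
  unfolding diff_rot_exp using mean_exp_flow[OF h r, of "\<i> * of_real t"] by (simp add: norm_mult)

lemma mean_diff_rot_funpow:
  assumes h: "slice_holomorphic h" and r: "0 \<le> r" "r < 1"
  shows "mean r ((diff_rot t ^^ m) h) \<le> \<bar>t\<bar> ^ m * mean r ((Rad ^^ m) h)"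
  using h
proof (induction m arbitrary: h)
  case (Suc m)
  have Bh: "slice_holomorphic (diff_rot t h)" by (rule slice_diff_rot[OF Suc.prems])
  have Rh: "slice_holomorphic ((Rad ^^ m) h)" by (rule slice_holomorphic_Rad_funpow[OF Suc.prems])
  have "mean r ((diff_rot t ^^ Suc m) h) = mean r ((diff_rot t ^^ m) (diff_rot t h))" by (simp add: funpow_swap1)
  also have "\<dots> \<le> \<bar>t\<bar> ^ m * mean r ((Rad ^^ m) (diff_rot t h))" by (rule Suc.IH[OF Bh])
  also have "mean r ((Rad ^^ m) (diff_rot t h)) = mean r (diff_rot t ((Rad ^^ m) h))"
    by (intro mean_cong slice_cont slice_holomorphic_Rad_funpow Bh r Rad_funpow_diff_rot[OF Suc.prems])
  also have "\<bar>t\<bar> ^ m * \<dots> \<le> \<bar>t\<bar> ^ m * (\<bar>t\<bar> * mean r (Rad ((Rad ^^ m) h)))"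
    by (intro mult_left_mono mean_diff_rot[OF Rh r]) auto
  finally show ?case by (simp add: mult_ac)
qed simp

text \<open>By induction on \<open>n\<close>: the error \<open>e\<close> of a single difference is of second order in \<open>t\<close>, and the
  remaining \<open>n\<close> differences of \<open>e\<close> contribute a factor \<open>t\<close> and a radial derivative each.\<close>

lemma mean_diff_rot_expansion:
  assumes h: "slice_holomorphic h" and r: "0 \<le> r" "r < 1"
  shows "mean r (\<lambda>z. (diff_rot t ^^ n) h z - (\<i> * of_real t) ^ n * (Rad ^^ n) h z)
    \<le> real n * \<bar>t\<bar> ^ Suc n * mean r ((Rad ^^ Suc n) h)"
  using h
proof (induction n arbitrary: h)
  case 0
  then show ?case using bound[of "\<lambda>z. 0" 0] by (simp add: mean_def)
next
  case (Suc n)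
  note h = Suc.prems
  define w where "w = \<i> * of_real t"
  have w: "Re w \<le> 0" "norm w = \<bar>t\<bar>" by (simp_all add: w_def norm_mult)
  have Rh: "slice_holomorphic (Rad h)" by (rule slice_holomorphic_Rad[OF h])
  define e where "e = (\<lambda>z. diff_rot t h z - w * Rad h z)"
  have e: "slice_holomorphic e"
    unfolding e_def by (intro slice_holomorphic_diff slice_diff_rot slice_holomorphic_cmult h Rh)
  have s: "slice_holomorphic ((Rad ^^ n) h)" by (rule slice_holomorphic_Rad_funpow[OF h])
  have Re: "(Rad ^^ m) e z = diff_rot t ((Rad ^^ m) h) z - w * Rad ((Rad ^^ m) h) z" if "norm z < 1" for m z
    using that
  proof (induction m arbitrary: z)
    case (Suc m)
    have sm: "slice_holomorphic ((Rad ^^ m) h)" by (rule slice_holomorphic_Rad_funpow[OF h])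
    have "(Rad ^^ Suc m) e z = Rad (\<lambda>z. diff_rot t ((Rad ^^ m) h) z - w * Rad ((Rad ^^ m) h) z) z"
      unfolding funpow.simps o_apply using Suc by (intro Rad_cong)
    also have "\<dots> = Rad (diff_rot t ((Rad ^^ m) h)) z - Rad (\<lambda>z. w * Rad ((Rad ^^ m) h) z) z"
      by (rule Rad_diff[OF slice_diff_rot[OF sm] slice_holomorphic_cmult[OF slice_holomorphic_Rad[OF sm]] Suc.prems])
    also have "Rad (diff_rot t ((Rad ^^ m) h)) z = diff_rot t ((Rad ^^ Suc m) h) z"
      using Rad_funpow_diff_rot[OF sm Suc.prems, of 1 t] by simp
    also have "Rad (\<lambda>z. w * Rad ((Rad ^^ m) h) z) z = w * Rad ((Rad ^^ Suc m) h) z"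
      using Rad_cmult[OF slice_holomorphic_Rad[OF sm] Suc.prems, of w] by simp
    finally show ?case .
  qed (simp add: e_def)
  have "(diff_rot t ^^ Suc n) h = (diff_rot t ^^ n) (\<lambda>z. e z + w * Rad h z)"
    by (simp add: funpow_swap1 e_def)
  also have "\<dots> = (\<lambda>z. (diff_rot t ^^ n) e z + w * (diff_rot t ^^ n) (Rad h) z)"
    by (simp only: diff_rot_funpow_add diff_rot_funpow_cmult)
  finally have eq: "(\<lambda>z. (diff_rot t ^^ Suc n) h z - w ^ Suc n * (Rad ^^ Suc n) h z)
      = (\<lambda>z. (diff_rot t ^^ n) e z + w * ((diff_rot t ^^ n) (Rad h) z - w ^ n * (Rad ^^ n) (Rad h) z))"
    by (simp add: funpow_swap1 algebra_simps)
  have c2: "slice_holomorphic (\<lambda>z. (diff_rot t ^^ n) (Rad h) z - w ^ n * (Rad ^^ n) (Rad h) z)"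
    by (intro slice_holomorphic_diff slice_diff_rot_funpow slice_holomorphic_cmult slice_holomorphic_Rad_funpow Rh)
  have "mean r (\<lambda>z. (diff_rot t ^^ n) e z + w * ((diff_rot t ^^ n) (Rad h) z - w ^ n * (Rad ^^ n) (Rad h) z))
     \<le> mean r ((diff_rot t ^^ n) e) + mean r (\<lambda>z. w * ((diff_rot t ^^ n) (Rad h) z - w ^ n * (Rad ^^ n) (Rad h) z))"
    by (intro mean_add slice_cont slice_diff_rot_funpow e slice_holomorphic_cmult c2 r)
  also have "mean r ((diff_rot t ^^ n) e) \<le> \<bar>t\<bar> ^ n * mean r ((Rad ^^ n) e)"
    by (rule mean_diff_rot_funpow[OF e r])
  also have "mean r ((Rad ^^ n) e) = mean r (\<lambda>z. (Rad ^^ n) h (exp w *s z) - (Rad ^^ n) h z - w * Rad ((Rad ^^ n) h) z)"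
    using Re by (intro mean_cong slice_cont slice_holomorphic_Rad_funpow e r) (simp add: diff_rot_exp w_def)
  also have "\<dots> \<le> (norm w)\<^sup>2 * mean r (Rad (Rad ((Rad ^^ n) h)))"
    by (rule mean_exp_flow2[OF s r w(1)])
  also have "mean r (\<lambda>z. w * ((diff_rot t ^^ n) (Rad h) z - w ^ n * (Rad ^^ n) (Rad h) z))
     = norm w * mean r (\<lambda>z. (diff_rot t ^^ n) (Rad h) z - w ^ n * (Rad ^^ n) (Rad h) z)"
    by (rule mean_cmult[OF slice_cont[OF c2] r])
  also have "\<dots> \<le> norm w * (real n * \<bar>t\<bar> ^ Suc n * mean r ((Rad ^^ Suc n) (Rad h)))"
    unfolding w_def by (intro mult_left_mono Suc.IH Rh) auto
  finally have "mean r (\<lambda>z. (diff_rot t ^^ Suc n) h z - w ^ Suc n * (Rad ^^ Suc n) h z)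
    \<le> \<bar>t\<bar> ^ n * ((norm w)\<^sup>2 * mean r (Rad (Rad ((Rad ^^ n) h)))) + norm w * (real n * \<bar>t\<bar> ^ Suc n * mean r ((Rad ^^ Suc n) (Rad h)))"
    unfolding eq by (simp add: mult_left_mono)
  also have "(Rad ^^ Suc n) (Rad h) = Rad (Rad ((Rad ^^ n) h))" by (simp add: funpow_swap1)
  also have "\<bar>t\<bar> ^ n * ((norm w)\<^sup>2 * M) + norm w * (real n * \<bar>t\<bar> ^ Suc n * M) = real (Suc n) * \<bar>t\<bar> ^ Suc (Suc n) * M" for M
  proof -
    have "a ^ n * (a\<^sup>2 * M) + a * (real n * a ^ Suc n * M) = real (Suc n) * a ^ Suc (Suc n) * M" for a :: real
      by (simp add: algebra_simps power2_eq_square)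
    then show ?thesis unfolding w(2) .
  qed
  finally show ?case by (simp only: w_def funpow.simps o_apply)
qed

text \<open>Read backwards, the expansion estimates the derivative of order \<open>n\<close> by the difference, up to the
  derivative of order \<open>n + 1\<close> with a small factor.\<close>

lemma mean_Rad_le_diff_rot:
  assumes h: "slice_holomorphic h" and r: "0 \<le> r" "r < 1"
  shows "\<bar>t\<bar> ^ n * mean r ((Rad ^^ n) h) \<le> mean r ((diff_rot t ^^ n) h) + real n * \<bar>t\<bar> ^ Suc n * mean r ((Rad ^^ Suc n) h)"
proof -
  let ?w = "\<i> * of_real t" and ?D = "(diff_rot t ^^ n) h" and ?R = "(Rad ^^ n) h"
  have s: "slice_holomorphic ?R" "slice_holomorphic ?D"
    by (intro slice_holomorphic_Rad_funpow slice_diff_rot_funpow h)+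
  have "\<bar>t\<bar> ^ n * mean r ?R = norm (?w ^ n) * mean r ?R" by (simp add: norm_power norm_mult)
  also have "\<dots> = mean r (\<lambda>z. ?w ^ n * ?R z)" by (rule mean_cmult[OF slice_cont[OF s(1)] r, symmetric])
  also have "\<dots> = mean r (\<lambda>z. ?D z - (?D z - ?w ^ n * ?R z))" by simp
  also have "\<dots> \<le> mean r ?D + mean r (\<lambda>z. ?D z - ?w ^ n * ?R z)"
    by (intro mean_diff slice_cont slice_holomorphic_diff slice_holomorphic_cmult s r)
  also have "mean r (\<lambda>z. ?D z - ?w ^ n * ?R z) \<le> real n * \<bar>t\<bar> ^ Suc n * mean r ((Rad ^^ Suc n) h)"
    by (rule mean_diff_rot_expansion[OF h r])
  finally show ?thesis by simp
qed

lemma mean_radius_Cauchy: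
  assumes h: "slice_holomorphic h"
  shows "mean (radius k) (Rad h) \<le> 2 ^ Suc k * mean (radius (Suc k)) h"
proof -
  have "radius k = exp (- ((1/2) ^ Suc k)) * radius (Suc k)"
    by (simp only: radius_square[of k]) (simp only: radius_def)
  then show ?thesis using mean_Rad_Cauchy[OF h, of "(1/2) ^ Suc k" "radius (Suc k)"]
    by (simp add: power_one_over field_simps)
qed

text \<open>The a priori growth of the derivatives of a function with bounded means, by one Cauchy estimate per order
  across the next dyadic annulus.\<close>

lemma mean_Rad_funpow_le:
  assumes h: "slice_holomorphic h" and H: "\<And>r. 0 < r \<Longrightarrow> r < 1 \<Longrightarrow> mean r h \<le> H"
  shows "mean (radius k) ((Rad ^^ m) h) \<le> 2 ^ (m * (k + m)) * H"
proof (induction m arbitrary: k)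
  case 0 show ?case using H[of "radius k"] by simp
next
  case (Suc m)
  have H0: "0 \<le> H" by (rule order_trans[OF mean_nonneg H[of "1/2"]]) simp_all
  have "mean (radius k) ((Rad ^^ Suc m) h) \<le> 2 ^ Suc k * mean (radius (Suc k)) ((Rad ^^ m) h)"
    using mean_radius_Cauchy[OF slice_holomorphic_Rad_funpow[OF h], of k m] by simp
  also have "\<dots> \<le> 2 ^ Suc k * (2 ^ (m * (Suc k + m)) * H)" by (intro mult_left_mono Suc.IH) auto
  also have "\<dots> = 2 ^ (Suc k + m * (Suc k + m)) * H" by (simp add: power_add)
  also have "\<dots> \<le> 2 ^ (Suc m * (k + Suc m)) * H"
    by (intro mult_right_mono power_increasing H0) (auto simp: algebra_simps)
  finally show ?case .
qed

text \<open>The fundamental theorem of calculus along the radius, over one dyadic annulus.\<close>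

lemma mean_radius_step:
  assumes h: "slice_holomorphic h"
  shows "mean (radius (Suc k)) h \<le> mean (radius k) h + (1/2) ^ Suc k * mean (radius (Suc k)) (Rad h)"
proof -
  let ?r = "radius (Suc k)"
  have "mean ?r h = mean ?r (\<lambda>z. dil ?r h z + dil_diff ?r h z)" by (simp add: dil_diff_def)
  also have "\<dots> \<le> mean ?r (dil ?r h) + mean ?r (dil_diff ?r h)"
    by (intro mean_add slice_cont slice_dil slice_dil_diff h) auto
  also have "mean ?r (dil ?r h) = mean (radius k) h" by (simp only: mean_dil radius_square[of k])
  also have "mean ?r (dil_diff ?r h) \<le> (1/2) ^ Suc k * mean ?r (Rad h)"
    using mean_dil_diff[OF h, of ?r "(1/2) ^ Suc k"] by (simp add: radius_def)
  finally show ?thesis by simp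
qed

end

section \<open>A discrete convolution inequality\<close>

text \<open>The exponent is the distance of \<open>k\<close> and \<open>j\<close>, one of the truncated differences being zero.\<close>

definition geom_kernel :: "real \<Rightarrow> nat \<Rightarrow> nat \<Rightarrow> real" where
  "geom_kernel \<theta> k j = \<theta> ^ ((k - j) + (j - k))"

lemma geom_kernel_commute: "geom_kernel \<theta> k j = geom_kernel \<theta> j k"
  by (simp add: geom_kernel_def add.commute)

lemma geom_kernel_sum_le:
  assumes \<theta>: "0 \<le> \<theta>" "\<theta> < 1"
  shows "(\<Sum>j<J. geom_kernel \<theta> k j) \<le> 2 / (1 - \<theta>)"
proof -
  have geo: "(\<Sum>i\<in>I. \<theta> ^ i) \<le> 1 / (1 - \<theta>)" if "finite I" for I
  proof -
    have "(\<Sum>i\<in>I. \<theta> ^ i) \<le> (\<Sum>i. \<theta> ^ i)" using \<theta> that by (intro sum_le_suminf summable_geometric) auto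
    then show ?thesis using \<theta> by (simp add: suminf_geometric)
  qed
  have "(\<Sum>j<J. geom_kernel \<theta> k j) = (\<Sum>j\<in>{..<J} \<inter> {..k}. \<theta> ^ (k - j)) + (\<Sum>j\<in>{..<J} - {..k}. \<theta> ^ (j - k))"
    unfolding sum.Int_Diff[OF finite_lessThan, of _ J "{..k}"]
    by (intro arg_cong2[where f = "(+)"] sum.cong) (auto simp: geom_kernel_def)
  also have "(\<Sum>j\<in>{..<J} \<inter> {..k}. \<theta> ^ (k - j)) = (\<Sum>i\<in>(\<lambda>j. k - j) ` ({..<J} \<inter> {..k}). \<theta> ^ i)"
    by (subst sum.reindex) (auto simp: inj_on_def)
  also have "\<dots> \<le> 1 / (1 - \<theta>)" by (intro geo) auto
  also have "(\<Sum>j\<in>{..<J} - {..k}. \<theta> ^ (j - k)) = (\<Sum>i\<in>(\<lambda>j. j - k) ` ({..<J} - {..k}). \<theta> ^ i)"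
    by (subst sum.reindex) (auto simp: inj_on_def)
  also have "\<dots> \<le> 1 / (1 - \<theta>)" by (intro geo) auto
  finally show ?thesis by simp
qed

text \<open>Convolution with a two-sided geometric sequence preserves \<open>\<ell>\<^sup>q\<close>. Half of the decay is spent on
  replacing the sum over \<open>j\<close> by a maximum, whose \<open>q\<close>-th power is at most the sum of the \<open>q\<close>-th powers.
  The error \<open>e\<close> in the hypothesis leaves room for truncating an infinite convolution.\<close>

lemma summable_geom_convolution:
  fixes A b :: "nat \<Rightarrow> real"
  assumes \<eta>: "0 < \<eta>" "\<eta> < 1" and q: "0 < q" and b: "\<And>j. 0 \<le> b j" and sb: "summable (\<lambda>j. b j powr q)"
    and C: "0 \<le> C" and A0: "\<And>k. 0 \<le> A k"
    and A: "\<And>k e. 0 < e \<Longrightarrow> \<exists>J. A k \<le> C * (\<Sum>j<J. geom_kernel (\<eta>\<^sup>2) k j * b j) + e"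
  shows "summable (\<lambda>k. A k powr q)"
proof -
  define x where "x = \<eta> powr q"
  have x: "0 < x" "x < 1" using \<eta> q powr_less_mono2[of q \<eta> 1] by (simp_all add: x_def)
  define D where "D = 2 / (1 - \<eta>)"
  define S where "S = (\<lambda>k. \<Sum>j. geom_kernel x k j * b j powr q)"
  have gk: "0 \<le> geom_kernel x k j" "geom_kernel x k j \<le> 1" for k j
    using x by (auto simp: geom_kernel_def power_le_one)
  have sS: "summable (\<lambda>j. geom_kernel x k j * b j powr q)" for k
    by (rule summable_comparison_test'[OF sb, of 0]) (use gk in \<open>auto simp: abs_mult mult_left_le_one_le\<close>)
  have S0: "0 \<le> S k" for k unfolding S_def using sS gk by (intro suminf_nonneg) auto
  have D0: "0 \<le> D" using \<eta> by (simp add: D_def)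
  have Ale: "A k powr q \<le> (C * D) powr q * S k" for k
  proof -
    have one: "geom_kernel \<eta> k j * b j \<le> S k powr (1/q)" for j
    proof -
      have "(geom_kernel \<eta> k j * b j) powr q = geom_kernel x k j * b j powr q"
      proof -
        have "(\<eta> ^ m) powr q = x ^ m" for m
          using \<eta> by (simp add: x_def powr_powr mult.commute flip: powr_realpow)
        then show ?thesis using \<eta> b by (simp add: powr_mult geom_kernel_def)
      qed
      also have "\<dots> \<le> S k" unfolding S_def
        using sum_le_suminf[OF sS, of "{j}" k] gk by simp
      finally have "((geom_kernel \<eta> k j * b j) powr q) powr (1/q) \<le> S k powr (1/q)"
        using q by (intro powr_mono2) auto
      then show ?thesis using q \<eta> b by (simp add: powr_powr geom_kernel_def)
    qed
    have "A k \<le> C * D * S k powr (1/q) + e" if e: "0 < e" for e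
    proof -
      obtain J where "A k \<le> C * (\<Sum>j<J. geom_kernel (\<eta>\<^sup>2) k j * b j) + e" using A[OF e] by blast
      also have "(\<Sum>j<J. geom_kernel (\<eta>\<^sup>2) k j * b j) \<le> (\<Sum>j<J. geom_kernel \<eta> k j * S k powr (1/q))"
      proof (rule sum_mono)
        fix j
        have "geom_kernel (\<eta>\<^sup>2) k j * b j = geom_kernel \<eta> k j * (geom_kernel \<eta> k j * b j)"
          by (simp add: geom_kernel_def power_mult[symmetric] mult.commute[of 2] power_mult power2_eq_square power_mult_distrib)
        also have "\<dots> \<le> geom_kernel \<eta> k j * S k powr (1/q)"
          using \<eta> by (intro mult_left_mono one) (simp add: geom_kernel_def)
        finally show "geom_kernel (\<eta>\<^sup>2) k j * b j \<le> geom_kernel \<eta> k j * S k powr (1/q)" .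
      qed
      also have "\<dots> = (\<Sum>j<J. geom_kernel \<eta> k j) * S k powr (1/q)" by (simp add: sum_distrib_right)
      also have "\<dots> \<le> D * S k powr (1/q)"
        unfolding D_def using \<eta> by (intro mult_right_mono geom_kernel_sum_le) auto
      finally show ?thesis using C by (simp add: mult_left_mono mult.assoc)
    qed
    then have "A k \<le> C * D * S k powr (1/q)" by (rule field_le_epsilon)
    then have "A k powr q \<le> (C * D * S k powr (1/q)) powr q" using A0 q by (intro powr_mono2) auto
    also have "\<dots> = (C * D) powr q * S k" using C D0 S0 q by (simp add: powr_mult powr_powr)
    finally show ?thesis .
  qed
  have "(\<Sum>k<K. S k) \<le> 2 / (1 - x) * (\<Sum>j. b j powr q)" for K
  proof -
    have "(\<Sum>k<K. S k) = (\<Sum>j. \<Sum>k<K. geom_kernel x k j * b j powr q)"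
      unfolding S_def by (rule suminf_sum[symmetric]) (rule sS)
    also have "\<dots> \<le> (\<Sum>j. 2 / (1 - x) * b j powr q)"
    proof (rule suminf_le)
      fix j
      have "(\<Sum>k<K. geom_kernel x k j * b j powr q) = (\<Sum>k<K. geom_kernel x j k) * b j powr q"
        by (simp add: sum_distrib_right geom_kernel_commute[of x _ j])
      also have "\<dots> \<le> 2 / (1 - x) * b j powr q" using x by (intro mult_right_mono geom_kernel_sum_le) auto
      finally show "(\<Sum>k<K. geom_kernel x k j * b j powr q) \<le> 2 / (1 - x) * b j powr q" .
    qed (intro summable_sum sS summable_mult sb)+
    also have "\<dots> = 2 / (1 - x) * (\<Sum>j. b j powr q)" by (rule suminf_mult[OF sb])
    finally show ?thesis .
  qed
  then have "summable S" by (intro summableI_nonneg_bounded[OF S0])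
  then have "summable (\<lambda>k. (C * D) powr q * S k)" by (rule summable_mult)
  then show ?thesis by (rule summable_comparison_test'[of _ 0]) (use Ale in auto)
qed

section \<open>The homogeneous expansion\<close>

lemma homogeneous_poly_smult:
  assumes "homogeneous_poly d P"
  shows "P (c *s z) = c ^ d * P z"
proof -
  obtain co where co: "\<And>z. P z = (\<Sum>a | (\<Sum>i\<in>UNIV. a i) = d. co a * (\<Prod>i\<in>UNIV. (z $ i) ^ a i))"
    using assms unfolding homogeneous_poly_def by blast
  have "(\<Prod>i\<in>UNIV. ((c *s z) $ i) ^ a i) = c ^ d * (\<Prod>i\<in>UNIV. (z $ i) ^ a i)" if "(\<Sum>i\<in>UNIV. a i) = d" for a
    by (simp add: power_mult_distrib prod.distrib that flip: power_sum)
  then show ?thesis unfolding co by (simp add: sum_distrib_left mult_ac)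
qed

lemma homogeneous_poly_0: "homogeneous_poly d (\<lambda>z. 0)"
  unfolding homogeneous_poly_def by (intro exI[of _ "\<lambda>a. 0"]) simp

lemma homogeneous_poly_add:
  assumes "homogeneous_poly d P" "homogeneous_poly d Q"
  shows "homogeneous_poly d (\<lambda>z. P z + Q z)"
proof -
  obtain co where "\<And>z. P z = (\<Sum>a | (\<Sum>i\<in>UNIV. a i) = d. co a * (\<Prod>i\<in>UNIV. (z $ i) ^ a i))"
    using assms(1) unfolding homogeneous_poly_def by blast
  moreover obtain co' where "\<And>z. Q z = (\<Sum>a | (\<Sum>i\<in>UNIV. a i) = d. co' a * (\<Prod>i\<in>UNIV. (z $ i) ^ a i))"
    using assms(2) unfolding homogeneous_poly_def by blast
  ultimately show ?thesis unfolding homogeneous_poly_def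
    by (intro exI[of _ "\<lambda>a. co a + co' a"]) (simp add: distrib_right sum.distrib)
qed

lemma homogeneous_poly_cmult:
  assumes "homogeneous_poly d P"
  shows "homogeneous_poly d (\<lambda>z. c * P z)"
proof -
  obtain co where "\<And>z. P z = (\<Sum>a | (\<Sum>i\<in>UNIV. a i) = d. co a * (\<Prod>i\<in>UNIV. (z $ i) ^ a i))"
    using assms(1) unfolding homogeneous_poly_def by blast
  then show ?thesis unfolding homogeneous_poly_def
    by (intro exI[of _ "\<lambda>a. c * co a"]) (simp add: sum_distrib_left mult.assoc)
qed

lemma homogeneous_poly_const: "homogeneous_poly 0 (\<lambda>z :: complex^'N. c)"
proof -
  have "{a :: 'N \<Rightarrow> nat. (\<Sum>i\<in>UNIV. a i) = 0} = {\<lambda>i. 0}" by (auto simp: fun_eq_iff)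
  then show ?thesis unfolding homogeneous_poly_def by (intro exI[of _ "\<lambda>a. c"]) simp
qed

lemma finite_multi_indices: "finite {a :: 'N::finite \<Rightarrow> nat. (\<Sum>i\<in>UNIV. a i) = d}"
proof (rule finite_subset)
  show "{a :: 'N \<Rightarrow> nat. (\<Sum>i\<in>UNIV. a i) = d} \<subseteq> PiE UNIV (\<lambda>i. {..d})"
    by (auto intro: member_le_sum)
qed (auto intro: finite_PiE)

lemma homogeneous_poly_coordinate:
  fixes P :: "complex^'N \<Rightarrow> complex"
  assumes "homogeneous_poly d P"
  shows "homogeneous_poly (Suc d) (\<lambda>z. z $ i * P z)"
proof -
  let ?A = "\<lambda>d. {a :: 'N \<Rightarrow> nat. (\<Sum>i\<in>UNIV. a i) = d}"
  let ?m = "\<lambda>z a. \<Prod>i\<in>UNIV. ((z :: complex^'N) $ i) ^ a i"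
  obtain co where co: "\<And>z. P z = (\<Sum>a\<in>?A d. co a * ?m z a)"
    using assms unfolding homogeneous_poly_def by blast
  define co' where "co' = (\<lambda>a. if a i = 0 then 0 else co (a(i := a i - 1)))"
  have sumupd: "(\<Sum>j\<in>UNIV. (a(i := v)) j) + a i = (\<Sum>j\<in>UNIV. a j) + v" for a :: "'N \<Rightarrow> nat" and v
    by (simp add: sum.remove[of UNIV i])
  have mon: "z $ i * ?m z a = ?m z (a(i := Suc (a i)))" for z a
    by (simp add: prod.remove[of UNIV i] mult.assoc)
  have "z $ i * P z = (\<Sum>a\<in>?A (Suc d). co' a * ?m z a)" for z
  proof -
    have "z $ i * P z = (\<Sum>a\<in>?A d. co a * ?m z (a(i := Suc (a i))))"
      unfolding co sum_distrib_left
      by (rule sum.cong[OF refl]) (subst mult.left_commute, simp only: mon)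
    also have "\<dots> = (\<Sum>a\<in>{a \<in> ?A (Suc d). a i \<noteq> 0}. co' a * ?m z a)"
    proof (rule sum.reindex_bij_witness[of _ "\<lambda>a. a(i := a i - 1)" "\<lambda>a. a(i := Suc (a i))"])
      fix a assume a: "a \<in> {a \<in> ?A (Suc d). a i \<noteq> 0}"
      then show "(a(i := a i - 1)) \<in> ?A d" using sumupd[of a "a i - 1"] by simp
    next
      fix a assume a: "a \<in> ?A d"
      then show "a(i := Suc (a i)) \<in> {a \<in> ?A (Suc d). a i \<noteq> 0}" using sumupd[of a "Suc (a i)"] by simp
    qed (auto simp: co'_def)
    also have "\<dots> = (\<Sum>a\<in>?A (Suc d). co' a * ?m z a)"
      by (rule sum.mono_neutral_left[OF finite_multi_indices]) (auto simp: co'_def)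
    finally show ?thesis .
  qed
  then show ?thesis unfolding homogeneous_poly_def by blast
qed

text \<open>The polynomial functions of \<open>N\<close> variables, graded by the total degree.\<close>

definition sum_homogeneous :: "(complex^'N \<Rightarrow> complex) \<Rightarrow> bool" where
  "sum_homogeneous Q \<longleftrightarrow> (\<exists>M. \<exists>H. (\<forall>d. homogeneous_poly d (H d)) \<and> (\<forall>d\<ge>M. \<forall>z. H d z = 0) \<and> (\<forall>z. Q z = (\<Sum>d<M. H d z)))"

lemma sum_homogeneous_extend:
  fixes M M' :: nat
  assumes "\<forall>d\<ge>M. \<forall>z. H d z = (0::complex)" "M \<le> M'"
  shows "(\<Sum>d<M. H d z) = (\<Sum>d<M'. H d z)"
  by (rule sum.mono_neutral_left) (use assms in \<open>auto simp: not_less\<close>)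

lemma sum_homogeneous_add:
  assumes "sum_homogeneous P" "sum_homogeneous Q"
  shows "sum_homogeneous (\<lambda>z. P z + Q z)"
proof -
  obtain M H where 1: "\<forall>d. homogeneous_poly d (H d)" "\<forall>d\<ge>M. \<forall>z. H d z = 0" "\<forall>z. P z = (\<Sum>d<M. H d z)"
    using assms(1) unfolding sum_homogeneous_def by blast
  obtain M' H' where 2: "\<forall>d. homogeneous_poly d (H' d)" "\<forall>d\<ge>M'. \<forall>z. H' d z = 0" "\<forall>z. Q z = (\<Sum>d<M'. H' d z)"
    using assms(2) unfolding sum_homogeneous_def by blast
  show ?thesis unfolding sum_homogeneous_def
  proof (intro exI[of _ "max M M'"] exI[of _ "\<lambda>d z. H d z + H' d z"] conjI allI impI)
    fix z
    have "P z = (\<Sum>d<max M M'. H d z)" "Q z = (\<Sum>d<max M M'. H' d z)"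
      using 1(3) 2(3) sum_homogeneous_extend[OF 1(2), of "max M M'" z] sum_homogeneous_extend[OF 2(2), of "max M M'" z] by auto
    then show "P z + Q z = (\<Sum>d<max M M'. H d z + H' d z)" by (simp add: sum.distrib)
  qed (use 1 2 in \<open>auto intro: homogeneous_poly_add\<close>)
qed

lemma sum_homogeneous_cmult:
  assumes "sum_homogeneous P"
  shows "sum_homogeneous (\<lambda>z. c * P z)"
proof -
  obtain M H where 1: "\<forall>d. homogeneous_poly d (H d)" "\<forall>d\<ge>M. \<forall>z. H d z = 0" "\<forall>z. P z = (\<Sum>d<M. H d z)"
    using assms(1) unfolding sum_homogeneous_def by blast
  then show ?thesis unfolding sum_homogeneous_def
    by (intro exI[of _ M] exI[of _ "\<lambda>d z. c * H d z"]) (auto simp: sum_distrib_left intro: homogeneous_poly_cmult)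
qed

lemma sum_homogeneous_coordinate:
  assumes "sum_homogeneous P"
  shows "sum_homogeneous (\<lambda>z. z $ i * P z)"
proof -
  obtain M H where 1: "\<forall>d. homogeneous_poly d (H d)" "\<forall>d\<ge>M. \<forall>z. H d z = 0" "\<forall>z. P z = (\<Sum>d<M. H d z)"
    using assms(1) unfolding sum_homogeneous_def by blast
  define H' where "H' = (\<lambda>d z. case d of 0 \<Rightarrow> 0 | Suc d \<Rightarrow> z $ i * H d z)"
  show ?thesis unfolding sum_homogeneous_def
  proof (intro exI[of _ "Suc M"] exI[of _ H'] conjI allI impI)
    fix d show "homogeneous_poly d (H' d)"
      using 1(1) by (cases d) (auto simp: H'_def intro: homogeneous_poly_0 homogeneous_poly_coordinate)
  next
    fix d z assume "Suc M \<le> d" then show "H' d z = 0" using 1(2) by (cases d) (auto simp: H'_def)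
  next
    fix z show "z $ i * P z = (\<Sum>d<Suc M. H' d z)"
      unfolding sum.lessThan_Suc_shift by (simp add: H'_def 1(3) sum_distrib_left)
  qed
qed

lemma sum_homogeneous_const: "sum_homogeneous (\<lambda>z. c)"
  unfolding sum_homogeneous_def
  by (intro exI[of _ 1] exI[of _ "\<lambda>d z. if d = 0 then c else 0"])
    (auto intro: homogeneous_poly_const homogeneous_poly_0)

lemma sum_homogeneous_sum:
  "finite I \<Longrightarrow> (\<And>i. i \<in> I \<Longrightarrow> sum_homogeneous (Q i)) \<Longrightarrow> sum_homogeneous (\<lambda>z. \<Sum>i\<in>I. Q i z)"
  by (induction I rule: finite_induct) (auto intro: sum_homogeneous_const sum_homogeneous_add)

lemma sum_homogeneous_mult_poly:
  assumes "sum_homogeneous Q"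
  shows "sum_homogeneous (\<lambda>z. Q z * poly p (z $ i))"
proof (induction p)
  case 0 then show ?case by (simp add: sum_homogeneous_const)
next
  case (pCons a p)
  have "sum_homogeneous (\<lambda>z. a * Q z + z $ i * (Q z * poly p (z $ i)))"
    by (intro sum_homogeneous_add sum_homogeneous_cmult sum_homogeneous_coordinate assms pCons.IH)
  then show ?case by (simp add: algebra_simps)
qed

text \<open>Restricted to a line through the origin, both sides are polynomials in \<open>c\<close>, and only the coefficient of \<open>c\<^sup>k\<close>
  survives.\<close>

lemma homogeneous_of_sum_homogeneous:
  assumes Q: "sum_homogeneous Q" and hom: "\<And>c z. Q (c *s z) = c ^ k * Q z"
  shows "homogeneous_poly k Q"
proof -
  obtain M H where 1: "\<forall>d. homogeneous_poly d (H d)" "\<forall>d\<ge>M. \<forall>z. H d z = 0" "\<forall>z. Q z = (\<Sum>d<M. H d z)"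
    using Q unfolding sum_homogeneous_def by blast
  have "Q z = H k z" for z
  proof -
    let ?n = "max M k"
    have "(\<Sum>d\<le>?n. H d z * c ^ d) = (\<Sum>d\<le>?n. (if d = k then Q z else 0) * c ^ d)" for c
    proof -
      have "(\<Sum>d\<le>?n. H d z * c ^ d) = (\<Sum>d<Suc ?n. H d (c *s z))"
        unfolding lessThan_Suc_atMost
        using homogeneous_poly_smult[OF 1(1)[rule_format]] by (intro sum.cong refl) (simp only: mult.commute)
      also have "\<dots> = (\<Sum>d<M. H d (c *s z))"
        by (rule sum_homogeneous_extend[OF 1(2), symmetric]) simp
      also have "\<dots> = Q (c *s z)" using 1(3) by simp
      also have "\<dots> = Q z * c ^ k" by (simp add: hom mult.commute)
      also have "\<dots> = (\<Sum>d\<le>?n. (if d = k then Q z else 0) * c ^ d)"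
        by (simp add: if_distrib[of "\<lambda>x. x * _"] sum.delta cong: if_cong)
      finally show ?thesis .
    qed
    then have "\<forall>i\<le>?n. H i z = (if i = k then Q z else 0)"
      using polyfun_eq_coeffs[of "\<lambda>d. H d z" ?n "\<lambda>d. if d = k then Q z else 0"] by blast
    then show ?thesis by simp
  qed
  then have "Q = H k" by (rule ext)
  then show ?thesis using 1(1) by simp
qed

definition vec_upd :: "complex^'N \<Rightarrow> 'N \<Rightarrow> complex \<Rightarrow> complex^'N" where
  "vec_upd z i w = (\<chi> m. if m = i then w else z $ m)"

text \<open>A function that is a polynomial of degree at most \<open>k\<close> in each coordinate is a polynomial: in one
  coordinate at a time, Lagrange interpolation at \<open>0, \<dots>, k\<close> expresses it by its restrictions to
  hyperplanes.\<close>

lemma separately_polynomial: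
  fixes P :: "complex^'N \<Rightarrow> complex"
  assumes "finite I"
    and "\<And>z i. \<exists>q. degree q \<le> k \<and> (\<forall>w. P (vec_upd z i w) = poly q w)"
    and "\<And>z z'. (\<And>i. i \<in> I \<Longrightarrow> z $ i = z' $ i) \<Longrightarrow> P z = P z'"
  shows "sum_homogeneous P"
  using assms
proof (induction I arbitrary: P rule: finite_induct)
  case empty
  have "P = (\<lambda>z. P 0)" by (rule ext, rule empty(2)) simp
  then show ?case by (rule ssubst[where P = sum_homogeneous]) (rule sum_homogeneous_const)
next
  case (insert i I)
  define l :: "nat \<Rightarrow> complex poly" where
    "l = (\<lambda>j. \<Prod>m\<in>{..k} - {j}. smult (1 / (of_nat j - of_nat m)) [:- of_nat m, 1:])"
  have ldeg: "degree (l j) \<le> k" if "j \<le> k" for j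
  proof -
    have "degree (l j) \<le> (\<Sum>m\<in>{..k} - {j}. degree (smult (1 / (of_nat j - of_nat m)) [:- of_nat m, 1 :: complex:]))"
      unfolding l_def by (rule degree_prod_sum_le[unfolded o_def]) auto
    also have "\<dots> \<le> (\<Sum>m\<in>{..k} - {j}. 1)" by (intro sum_mono order_trans[OF degree_smult_le]) simp
    finally show ?thesis using that by (simp add: card_Diff_singleton)
  qed
  have lval: "poly (l j) (of_nat m) = (if m = j then 1 else 0)" if "j \<le> k" "m \<le> k" for j m
  proof (cases "m = j")
    case True
    have "poly (smult (1 / (of_nat j - of_nat x)) [:- of_nat x, 1 :: complex:]) (of_nat j) = 1" if "x \<noteq> j" for x
      using that by (simp add: diff_divide_distrib[symmetric])
    then have "(\<Prod>x\<in>{..k} - {j}. poly (smult (1 / (of_nat j - of_nat x)) [:- of_nat x, 1 :: complex:]) (of_nat j)) = 1"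
      by (intro prod.neutral) blast
    then show ?thesis using True by (simp only: l_def poly_prod) simp
  next
    case False
    then have "\<exists>x\<in>{..k} - {j}. poly (smult (1 / (of_nat j - of_nat x)) [:- of_nat x, 1 :: complex:]) (of_nat m) = 0"
      using that by (intro bexI[of _ m]) auto
    then show ?thesis using False by (simp add: l_def poly_prod prod_zero)
  qed
  have "P = (\<lambda>z. \<Sum>j\<le>k. P (vec_upd z i (of_nat j)) * poly (l j) (z $ i))"
  proof (rule ext)
  fix z
  show "P z = (\<Sum>j\<le>k. P (vec_upd z i (of_nat j)) * poly (l j) (z $ i))"
  proof -
    obtain q where q: "degree q \<le> k" "\<And>w. P (vec_upd z i w) = poly q w" using insert.prems(1) by blast
    have qeq: "q = (\<Sum>j\<le>k. smult (poly q (of_nat j)) (l j))"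
    proof (rule poly_eqI_degree[of "of_nat ` {..k}"])
      fix x :: complex assume "x \<in> of_nat ` {..k}"
      then obtain m where m: "x = of_nat m" "m \<le> k" by auto
      have "(\<Sum>j\<le>k. poly q (of_nat j) * poly (l j) (of_nat m)) = (\<Sum>j\<le>k. if j = m then poly q (of_nat m) else 0)"
        using m by (intro sum.cong) (auto simp: lval)
      then show "poly q x = poly (\<Sum>j\<le>k. smult (poly q (of_nat j)) (l j)) x"
        using m by (simp add: poly_sum)
    next
      have card: "card (of_nat ` {..k} :: complex set) = Suc k" by (subst card_image) (auto simp: inj_on_def)
      show "degree q < card (of_nat ` {..k} :: complex set)" using q(1) card by simp
      have "degree (\<Sum>j\<le>k. smult (poly q (of_nat j)) (l j)) \<le> k"
        by (intro degree_sum_le order_trans[OF degree_smult_le] ldeg) auto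
      then show "degree (\<Sum>j\<le>k. smult (poly q (of_nat j)) (l j)) < card (of_nat ` {..k} :: complex set)" using card by simp
    qed
    have "poly q (z $ i) = poly (\<Sum>j\<le>k. smult (poly q (of_nat j)) (l j)) (z $ i)"
      by (rule arg_cong[where f = "\<lambda>p. poly p (z $ i)"]) (rule qeq)
    then have "poly q (z $ i) = (\<Sum>j\<le>k. poly q (of_nat j) * poly (l j) (z $ i))"
      by (simp only: poly_sum poly_smult)
    moreover have "vec_upd z i (z $ i) = z" by (simp add: vec_upd_def vec_eq_iff)
    ultimately show ?thesis using q(2)[of "z $ i"] by (simp add: q(2))
  qed
  qed
  moreover have "sum_homogeneous (\<lambda>z. \<Sum>j\<le>k. P (vec_upd z i (of_nat j)) * poly (l j) (z $ i))"
  proof (intro sum_homogeneous_sum sum_homogeneous_mult_poly)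
    fix j
    show "sum_homogeneous (\<lambda>z. P (vec_upd z i (of_nat j)))"
    proof (rule insert.IH)
      fix z m
      show "\<exists>q. degree q \<le> k \<and> (\<forall>w. P (vec_upd (vec_upd z m w) i (of_nat j)) = poly q w)"
      proof (cases "m = i")
        case True
        have "vec_upd (vec_upd z i w) i (of_nat j) = vec_upd z i (of_nat j)" for w by (simp add: vec_upd_def vec_eq_iff)
        then show ?thesis using True by (intro exI[of _ "[:P (vec_upd z i (of_nat j)):]"]) simp
      next
        case False
        then have "vec_upd (vec_upd z m w) i (of_nat j) = vec_upd (vec_upd z i (of_nat j)) m w" for w by (auto simp: vec_upd_def vec_eq_iff)
        then show ?thesis using insert.prems(1)[of "vec_upd z i (of_nat j)" m] by simp
      qed
    next
      fix z z' :: "complex^'N" assume "\<And>m. m \<in> I \<Longrightarrow> z $ m = z' $ m"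
      then show "P (vec_upd z i (of_nat j)) = P (vec_upd z' i (of_nat j))"
        by (intro insert.prems(2)) (auto simp: vec_upd_def)
    qed
  qed simp
  ultimately show ?case by (rule ssubst[where P = sum_homogeneous])
qed

text \<open>The Taylor coefficients on slices. They turn out to be the homogeneous parts of \<open>f\<close>.\<close>

definition slice_coeff :: "(complex^'N \<Rightarrow> complex) \<Rightarrow> nat \<Rightarrow> complex^'N \<Rightarrow> complex" where
  "slice_coeff f k z = (deriv ^^ k) (\<lambda>l. f (l *s z)) 0 / fact k"

lemma slice_ball:
  fixes z :: "complex^'N"
  assumes "norm z < 1"
  obtains R where "1 < R" "ball 0 R \<subseteq> {l. norm (l *s z) < 1}"
proof (cases "z = 0")
  case True then show ?thesis by (intro that[of 2]) auto
next
  case False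
  then show ?thesis using assms by (intro that[of "1 / norm z"]) (auto simp: less_divide_eq)
qed

lemma slice_coeff_sums:
  assumes f: "slice_holomorphic f" and z: "norm z < 1"
  shows "(\<lambda>k. slice_coeff f k z) sums f z"
proof -
  obtain R where R: "1 < R" "ball 0 R \<subseteq> {l. norm (l *s z) < 1}" using slice_ball[OF z] by blast
  have "(\<lambda>l. f (l *s z)) holomorphic_on ball 0 R"
    using f R(2) holomorphic_on_subset unfolding slice_holomorphic_def by blast
  from holomorphic_power_series[OF this, of 1] show ?thesis using R by (simp add: slice_coeff_def)
qed

lemma slice_coeff_smult:
  assumes f: "slice_holomorphic f"
  shows "slice_coeff f k (c *s z) = c ^ k * slice_coeff f k z"
proof -
  have "(deriv ^^ k) (\<lambda>w. (\<lambda>l. f (l *s z)) (c * w)) 0 = c ^ k * (deriv ^^ k) (\<lambda>l. f (l *s z)) (c * 0)"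
  proof (rule higher_deriv_compose_linear)
    show "(\<lambda>l. f (l *s z)) holomorphic_on {l. norm (l *s z) < 1}" using f unfolding slice_holomorphic_def by blast
    show "open {l. norm (l *s (c *s z)) < 1}" "open {l. norm (l *s z) < 1}" by (rule open_slice)+
    fix w assume "w \<in> {l. norm (l *s (c *s z)) < 1}"
    then show "c * w \<in> {l. norm (l *s z) < 1}" by (simp add: norm_mult mult_ac)
  qed simp
  then show ?thesis by (simp add: slice_coeff_def vector_smult_assoc mult.commute)
qed

lemma slice_coeff_has_integral:
  assumes f: "slice_holomorphic f" and r: "0 < r" "r * norm z < 1"
  shows "((\<lambda>u. f ((of_real r * circ u) *s z) / (of_real r * circ u) ^ k) has_integral slice_coeff f k z) {0..1}"
proof -
  have "norm (l *s z) < 1" if "norm l \<le> r" for l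
    using mult_right_mono[OF that norm_ge_zero[of z]] r by simp
  then have "cball 0 r \<subseteq> {l. norm (l *s z) < 1}" by (auto simp del: norm_vector_scalar_mult)
  then have hol: "(\<lambda>l. f (l *s z)) holomorphic_on cball 0 r"
    using f holomorphic_on_subset unfolding slice_holomorphic_def by blast
  show ?thesis unfolding slice_coeff_def
    by (rule Taylor_coeff_integral[OF holomorphic_on_imp_continuous_on[OF hol] holomorphic_on_subset[OF hol] r(1)]) auto
qed

text \<open>Cauchy's estimate with the circle of radius \<open>1 / (2 t)\<close>, on which the argument of \<open>f\<close> stays in the ball of
  radius \<open>1/2\<close>.\<close>

lemma slice_coeff_bound:
  assumes f: "slice_holomorphic f"
  shows "\<exists>C\<ge>0. \<forall>z t. norm z \<le> t \<longrightarrow> 0 < t \<longrightarrow> norm (slice_coeff f k z) \<le> C * (2 * t) ^ k"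
proof -
  have "compact (f ` cball 0 (1/2))"
    using f by (intro compact_continuous_image) (auto simp: slice_holomorphic_def intro: continuous_on_subset)
  then have "bounded (f ` cball 0 (1/2))" by (rule compact_imp_bounded)
  then obtain C where C: "0 < C" "\<And>z. norm z \<le> 1/2 \<Longrightarrow> norm (f z) \<le> C"
    unfolding bounded_pos by auto
  show ?thesis
  proof (intro exI[of _ C] conjI allI impI)
    fix z :: "complex^'a" and t assume t: "norm z \<le> t" "0 < t"
    define r where "r = 1 / (2 * t)"
    have r: "0 < r" "r * norm z \<le> 1/2" using t by (auto simp: r_def field_simps)
    have int: "((\<lambda>u. f ((of_real r * circ u) *s z) / (of_real r * circ u) ^ k) has_integral slice_coeff f k z) {0..1}"
      using r by (intro slice_coeff_has_integral f) auto
    have "norm (slice_coeff f k z) \<le> (C / r ^ k) * Henstock_Kurzweil_Integration.content {0..1::real}"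
    proof (rule has_integral_bound_real[of _ "{}", OF _ _ int])
      show "0 \<le> C / r ^ k" using C r by simp
      fix u :: real
      have "norm (f ((of_real r * circ u) *s z)) \<le> C" using r by (intro C) (simp add: norm_mult)
      then show "norm (f ((of_real r * circ u) *s z) / (of_real r * circ u) ^ k) \<le> C / r ^ k"
        using r by (simp add: norm_divide norm_power norm_mult divide_right_mono)
    qed simp
    also have "C / r ^ k = C * (2 * t) ^ k" by (simp add: r_def power_divide)
    finally show "norm (slice_coeff f k z) \<le> C * (2 * t) ^ k" by simp
  qed (use C in simp)
qed

text \<open>On a bounded set of parameters the coefficient is an integral of functions that are holomorphic in the
  parameter, hence a uniform limit of holomorphic Riemann sums.\<close>

lemma slice_coeff_line_holomorphic:
  assumes f: "holomorphic_several f (ball 0 1)"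
  shows "(\<lambda>w. slice_coeff f k (a + w *s b)) holomorphic_on UNIV"
proof -
  have sf: "slice_holomorphic f" by (rule holomorphic_several_slice[OF f])
  have "(\<lambda>w. slice_coeff f k (a + w *s b)) holomorphic_on ball 0 R" if R: "0 < R" for R
  proof -
    define r where "r = 1 / (2 * (1 + norm a + R * norm b))"
    have pos: "0 < 1 + norm a + R * norm b" using R by (simp add: add_pos_nonneg)
    have r: "0 < r" using pos by (simp add: r_def)
    have nr: "norm ((of_real r * circ u) *s (a + w *s b)) < 1" if "norm w \<le> R" for u w
    proof -
      have "norm (a + w *s b) \<le> norm a + norm w * norm b" using norm_triangle_ineq[of a "w *s b"] by simp
      also have "\<dots> \<le> norm a + R * norm b" using that by (intro add_left_mono mult_right_mono) auto
      also have "\<dots> < 2 * (1 + norm a + R * norm b)" using pos by (simp add: algebra_simps)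
      finally have "r * norm (a + w *s b) < r * (2 * (1 + norm a + R * norm b))" using r by (rule mult_strict_left_mono)
      also have "\<dots> = 1" using pos by (simp add: r_def)
      finally show ?thesis unfolding norm_vector_scalar_mult using r by (simp add: norm_mult)
    qed
    define k' where "k' = (\<lambda>u w. f ((of_real r * circ u) *s (a + w *s b)) / (of_real r * circ u) ^ k)"
    have hk: "k' u holomorphic_on ball 0 R" for u
    proof -
      have "(\<lambda>w. f ((of_real r * circ u) *s a + w *s ((of_real r * circ u) *s b))) holomorphic_on ball 0 R"
        by (rule holomorphic_on_subset[OF holomorphic_several_line[OF f]])
          (use nr[of _ u] in \<open>auto simp del: norm_vector_scalar_mult simp: vector_add_ldistrib vector_smult_assoc mult_ac\<close>)
      then have "(\<lambda>w. f ((of_real r * circ u) *s (a + w *s b))) holomorphic_on ball 0 R"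
        by (simp add: vector_add_ldistrib vector_smult_assoc mult_ac)
      then show ?thesis unfolding k'_def using r by (intro holomorphic_intros) auto
    qed
    have int: "slice_coeff f k (a + w *s b) = integral {0..1} (\<lambda>u. k' u w)" if "norm w \<le> R" for w
      unfolding k'_def
      by (rule integral_unique[symmetric], rule slice_coeff_has_integral[OF sf r]) (use nr[OF that, of 0, unfolded norm_vector_scalar_mult] r in \<open>simp add: norm_mult\<close>)
    show ?thesis
    proof (rule holomorphic_uniform_sequence[OF open_ball, where f = "\<lambda>m w. (\<Sum>j<m. k' (real j / real m) w) / of_nat m"])
      show "(\<lambda>w. (\<Sum>j<m. k' (real j / real m) w) / of_nat m) holomorphic_on ball 0 R" for m
        by (cases "m = 0") (auto intro!: holomorphic_intros hk)
      fix x :: complex assume "x \<in> ball 0 R"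
      then obtain d where d: "0 < d" "cball x d \<subseteq> ball 0 R" by (meson open_ball open_contains_cball)
      have cK: "continuous_on ({0..1} \<times> cball x d) (\<lambda>(u, w). k' u w)"
      proof -
        have "continuous_on ({0..1::real} \<times> cball x d) (\<lambda>p. f ((of_real r * circ (fst p)) *s (a + snd p *s b)) / (of_real r * circ (fst p)) ^ k)"
        proof (intro continuous_intros continuous_on_slice_param)
          show "continuous_on (ball 0 1) f" by (rule holomorphic_several_continuous[OF f])
          fix p :: "real \<times> complex" assume "p \<in> {0..1} \<times> cball x d"
          then have "norm (snd p) \<le> R" using d(2) by (auto simp: subset_eq less_imp_le)
          then show "norm ((of_real r * circ (fst p)) *s (a + snd p *s b)) < 1" by (rule nr)
        qed (use r in auto)
        then show ?thesis by (simp add: k'_def case_prod_unfold)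
      qed
      have "uniform_limit (cball x d) (\<lambda>m w. (\<Sum>j<m. k' (real j / real m) w) / of_nat m) (\<lambda>w. slice_coeff f k (a + w *s b)) sequentially"
      proof (rule uniform_limitI)
        fix e :: real assume e: "0 < e"
        obtain m0 where m0: "\<And>m w. m \<ge> m0 \<Longrightarrow> w \<in> cball x d \<Longrightarrow> norm (integral {0..1} (\<lambda>u. k' u w) - (\<Sum>j<m. k' (real j / real m) w) / of_nat m) \<le> e / 2"
          using uniform_riemann_sums[OF cK compact_cball half_gt_zero[OF e]] by blast
        have "\<forall>m\<ge>m0. \<forall>w\<in>cball x d. dist ((\<Sum>j<m. k' (real j / real m) w) / of_nat m) (slice_coeff f k (a + w *s b)) < e"
        proof (intro allI impI ballI)
          fix m w assume m: "m0 \<le> m" and w: "w \<in> cball x d"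
          then have "norm w \<le> R" using d(2) by (auto simp: subset_eq less_imp_le)
          then show "dist ((\<Sum>j<m. k' (real j / real m) w) / of_nat m) (slice_coeff f k (a + w *s b)) < e"
            using m0[OF m w] e by (simp add: int dist_norm norm_minus_commute)
        qed
        then show "\<forall>\<^sub>F m in sequentially. \<forall>w\<in>cball x d. dist ((\<Sum>j<m. k' (real j / real m) w) / of_nat m) (slice_coeff f k (a + w *s b)) < e"
          unfolding eventually_sequentially by blast
      qed
      then show "\<exists>d. 0 < d \<and> cball x d \<subseteq> ball 0 R \<and> uniform_limit (cball x d) (\<lambda>m w. (\<Sum>j<m. k' (real j / real m) w) / of_nat m) (\<lambda>w. slice_coeff f k (a + w *s b)) sequentially"
        using d by blast
    qed
  qed
  then have "(\<lambda>w. slice_coeff f k (a + w *s b)) field_differentiable at w" for w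
    by (rule holomorphic_on_imp_differentiable_at[of _ "ball 0 (norm w + 1)"]) (auto simp: add_nonneg_pos)
  then show ?thesis by (auto simp: holomorphic_on_def field_differentiable_at_within)
qed

text \<open>Along each coordinate the coefficient is an entire function of growth of order \<open>k\<close>, hence a polynomial of
  degree at most \<open>k\<close> by Liouville's theorem. So it is a polynomial, and it is homogeneous of degree \<open>k\<close>.\<close>

lemma homogeneous_poly_slice_coeff:
  fixes f :: "complex^'N \<Rightarrow> complex"
  assumes f: "holomorphic_several f (ball 0 1)"
  shows "homogeneous_poly k (slice_coeff f k)"
proof (rule homogeneous_of_sum_homogeneous)
  have sf: "slice_holomorphic f" by (rule holomorphic_several_slice[OF f])
  show "slice_coeff f k (c *s z) = c ^ k * slice_coeff f k z" for c z by (rule slice_coeff_smult[OF sf])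
  show "sum_homogeneous (slice_coeff f k)"
  proof (rule separately_polynomial[OF finite_class.finite_UNIV])
    fix z z' :: "complex^'N" assume "\<And>i. i \<in> UNIV \<Longrightarrow> z $ i = z' $ i"
    then have "z = z'" by (simp add: vec_eq_iff)
    then show "slice_coeff f k z = slice_coeff f k z'" by simp
  next
    fix z :: "complex^'N" and i
    define a where "a = vec_upd z i 0"
    define b :: "complex^'N" where "b = axis i 1"
    have u: "vec_upd z i w = a + w *s b" for w by (simp add: a_def b_def vec_upd_def axis_def vec_eq_iff)
    obtain C where C: "0 \<le> C" "\<And>z t. norm z \<le> t \<Longrightarrow> 0 < t \<Longrightarrow> norm (slice_coeff f k z) \<le> C * (2 * t) ^ k"
      using slice_coeff_bound[OF sf, of k] by auto
    let ?g = "\<lambda>w. slice_coeff f k (a + w *s b)"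
    define c where "c = (\<lambda>j. (deriv ^^ j) ?g 0 / fact j)"
    have "?g w = (\<Sum>j\<le>k. c j * w ^ j)" for w
      unfolding c_def
    proof (rule Liouville_polynomial[where A = 1 and B = "C * (2 * (1 + norm a + norm b)) ^ k"])
      show "?g holomorphic_on UNIV" by (rule slice_coeff_line_holomorphic[OF f])
      fix w :: complex assume w: "1 \<le> norm w"
      have "norm (a + w *s b) \<le> norm a + norm w * norm b" using norm_triangle_ineq[of a "w *s b"] by simp
      also have "\<dots> \<le> norm w * norm a + norm w * norm b" using w mult_right_mono[of 1 "norm w" "norm a"] by simp
      also have "\<dots> \<le> (1 + norm a + norm b) * norm w" using w by (simp add: algebra_simps)
      finally have n: "norm (a + w *s b) \<le> (1 + norm a + norm b) * norm w" .
      have p: "0 < (1 + norm a + norm b) * norm w" using w by (intro mult_pos_pos) (auto simp: add_pos_nonneg)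
      show "norm (?g w) \<le> C * (2 * (1 + norm a + norm b)) ^ k * norm w ^ k"
        using C(2)[OF n p] by (simp add: power_mult_distrib mult_ac)
    qed
    then have v: "slice_coeff f k (vec_upd z i w) = poly (\<Sum>j\<le>k. monom (c j) j) w" for w
      by (simp add: u poly_sum poly_monom)
    have d: "degree (\<Sum>j\<le>k. monom (c j) j) \<le> k"
    proof (rule degree_sum_le)
      fix j assume "j \<in> {..k}"
      then show "degree (monom (c j) j) \<le> k" using degree_monom_le[of "c j" j] by simp
    qed simp
    show "\<exists>q. degree q \<le> k \<and> (\<forall>w. slice_coeff f k (vec_upd z i w) = poly q w)"
      by (intro exI[of _ "\<Sum>j\<le>k. monom (c j) j"] conjI allI d v)
  qed
qed

lemma powser_eq_zero:
  fixes a :: "nat \<Rightarrow> complex"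
  assumes "0 < r" and s: "\<And>x. norm x < r \<Longrightarrow> (\<lambda>n. a n * x ^ n) sums 0"
  shows "a n = 0"
proof (rule ccontr)
  assume n: "a n \<noteq> 0"
  have "a 0 = 0" by (rule sums_unique2[OF powser_sums_zero]) (rule s, use assms(1) in simp)
  then have "0 < n" using n by (cases n) auto
  show False
  proof (rule powser_0_nonzero[of r 0 a "\<lambda>z. 0" n])
    fix t :: real assume t: "0 < t" and ne: "\<And>z :: complex. z \<in> cball 0 t - {0} \<Longrightarrow> (0 :: complex) \<noteq> 0"
    show False using ne[of "of_real t"] t by simp
  qed (use assms n \<open>0 < n\<close> in auto)
qed

text \<open>Uniqueness of the expansion: on a slice it is a power series, whose coefficients are determined in the ball;
  homogeneity extends the equality to all of space.\<close>

lemma hom_part_eq: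
  fixes f :: "complex^'N \<Rightarrow> complex"
  assumes f: "holomorphic_several f (ball 0 1)"
  shows "hom_part f = slice_coeff f"
  unfolding hom_part_def
proof (rule the_equality)
  have sf: "slice_holomorphic f" by (rule holomorphic_several_slice[OF f])
  show ex: "homogeneous_expansion f (slice_coeff f)"
    unfolding homogeneous_expansion_def using homogeneous_poly_slice_coeff[OF f] slice_coeff_sums[OF sf] by auto
  fix F assume F: "homogeneous_expansion f F"
  have hF: "F k (c *s z) = c ^ k * F k z" for k c z
    using F homogeneous_poly_smult unfolding homogeneous_expansion_def by blast
  have small: "F k z = slice_coeff f k z" if z: "norm z < 1" for k z
  proof -
    have "F k z - slice_coeff f k z = 0"
    proof (rule powser_eq_zero[where a = "\<lambda>k. F k z - slice_coeff f k z" and r = 1])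
      fix x :: complex assume "norm x < 1"
      then have "norm (x *s z) < 1" using mult_strict_mono[of "norm x" 1 "norm z" 1] z by simp
      then have "(\<lambda>k. F k (x *s z) - slice_coeff f k (x *s z)) sums (f (x *s z) - f (x *s z))"
        using F by (intro sums_diff slice_coeff_sums sf) (auto simp: homogeneous_expansion_def)
      then show "(\<lambda>k. (F k z - slice_coeff f k z) * x ^ k) sums 0"
        by (simp add: hF slice_coeff_smult[OF sf] algebra_simps)
    qed simp
    then show ?thesis by simp
  qed
  show "F = slice_coeff f"
  proof (intro ext)
    fix k and z :: "complex^'N"
    define t where "t = complex_of_real (1 + norm z)"
    have p: "0 < 1 + norm z" using norm_ge_zero[of z] by linarith
    then have t: "t \<noteq> 0" "norm t = 1 + norm z" unfolding t_def by (auto simp del: of_real_add)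
    define y where "y = (1 / t) *s z"
    have y: "z = t *s y" using t by (simp add: y_def vector_smult_assoc)
    have "norm y < 1" using t p by (simp add: y_def norm_divide)
    then show "F k z = slice_coeff f k z"
      using small[of y k] unfolding y hF slice_coeff_smult[OF sf] by simp
  qed
qed

lemma Rad_funpow_sums:
  assumes f: "slice_holomorphic f" and z: "norm z < 1"
  shows "(\<lambda>k. of_nat k ^ m * slice_coeff f k z) sums (Rad ^^ m) f z"
  using z
proof (induction m arbitrary: z)
  case 0 then show ?case using slice_coeff_sums[OF f] by simp
next
  case (Suc m)
  obtain R where R: "1 < R" "ball 0 R \<subseteq> {l. norm (l *s z) < 1}" using slice_ball[OF Suc.prems] by blast
  define c where "c = (\<lambda>k. of_nat k ^ m * slice_coeff f k z)"
  have sl: "(\<lambda>k. c k * l ^ k) sums (Rad ^^ m) f (l *s z)" if "norm l < R" for l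
  proof -
    have "norm (l *s z) < 1" using R(2) that by (auto simp: subset_eq)
    from Suc.IH[OF this] show ?thesis by (simp add: c_def slice_coeff_smult[OF f] mult_ac)
  qed
  have d: "((\<lambda>l. \<Sum>k. c k * l ^ k) has_field_derivative (\<Sum>k. diffs c k * 1 ^ k)) (at 1)"
    by (rule termdiffs_strong'[of R]) (use sl R in \<open>auto intro: sums_summable\<close>)
  have "\<forall>\<^sub>F l in nhds 1. (\<Sum>k. c k * l ^ k) = (Rad ^^ m) f (l *s z)"
    unfolding eventually_nhds
    by (intro exI[of _ "ball 0 R"]) (use sl R in \<open>auto intro: sums_unique[symmetric]\<close>)
  then have "deriv (\<lambda>l. \<Sum>k. c k * l ^ k) 1 = deriv (\<lambda>l. (Rad ^^ m) f (l *s z)) 1"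
    by (rule deriv_cong_ev) simp
  then have "(Rad ^^ Suc m) f z = (\<Sum>k. diffs c k)" using DERIV_imp_deriv[OF d] by (simp add: Rad_def)
  moreover have "summable (\<lambda>k. diffs c k * 1 ^ k)"
    by (rule termdiff_converges[of 1 R]) (use sl R in \<open>auto intro: sums_summable\<close>)
  ultimately have "(\<lambda>k. diffs c k) sums (Rad ^^ Suc m) f z" by (simp add: summable_sums)
  then have "(\<lambda>k. of_nat (Suc k) * c (Suc k)) sums (Rad ^^ Suc m) f z" by (simp add: diffs_def)
  then have "(\<lambda>k. of_nat k * c k) sums (Rad ^^ Suc m) f z"
    using sums_Suc_iff[of "\<lambda>k. of_nat k * c k"] by simp
  then show ?case by (simp add: c_def mult.assoc)
qed

lemma radial_deriv_eq:
  assumes f: "holomorphic_several f (ball 0 1)" and m: "1 \<le> m" and z: "norm z < 1"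
  shows "radial_deriv (real m) f z = (Rad ^^ m) f z"
proof -
  have sf: "slice_holomorphic f" by (rule holomorphic_several_slice[OF f])
  have "(\<lambda>k. of_nat (Suc k) ^ m * slice_coeff f (Suc k) z) sums (Rad ^^ m) f z"
    using Rad_funpow_sums[OF sf z, of m] m sums_Suc_iff[of "\<lambda>k. of_nat k ^ m * slice_coeff f k z" "(Rad ^^ m) f z"] by (simp add: power_0_left)
  then have "(\<Sum>k. of_nat (Suc k) ^ m * slice_coeff f (Suc k) z) = (Rad ^^ m) f z" by (rule sums_unique[symmetric])
  moreover have "complex_of_real (real (Suc k) powr real m) = of_nat (Suc k) ^ m" for k
    by (simp add: powr_realpow del: of_nat_Suc)
  ultimately show ?thesis by (simp add: radial_deriv_def hom_part_eq[OF f] del: of_nat_Suc)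
qed

section \<open>From moduli to derivatives and back, on dyadic scales\<close>

lemma half_power: "(1/2 :: real) ^ m = 2 powr (- real m)"
  by (simp add: powr_minus powr_realpow power_one_over inverse_eq_divide)

lemma powr_half_power: "((1/2 :: real) ^ m) powr a = 2 powr (- (real m * a))"
  by (simp add: half_power powr_powr)

lemma two_powr_less_1: "0 < a \<Longrightarrow> 2 powr (- a) < (1 :: real)"
  using powr_less_cancel_iff[of 2 "- a" 0] by simp

lemma two_powr_le_1: "0 \<le> a \<Longrightarrow> 2 powr (- a) \<le> (1 :: real)"
  using powr_mono[of "- a" 0 2] by simp

lemma two_powr_power: "((2 :: real) powr a) ^ m = 2 powr (real m * a)"
  by (simp add: powr_realpow[symmetric] powr_powr mult.commute)

lemma summable_powr_bounded:
  assumes "summable (\<lambda>j. b j powr q)" "0 < q" "\<And>j. 0 \<le> b j"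
  obtains M :: real where "0 \<le> M" "\<And>j. b j \<le> M"
proof -
  let ?S = "\<Sum>j. b j powr q"
  have "b j \<le> ?S powr (1/q)" for j
  proof -
    have "b j powr q \<le> ?S" using sum_le_suminf[OF assms(1), of "{j}"] by simp
    then have "(b j powr q) powr (1/q) \<le> ?S powr (1/q)" using assms(2) by (intro powr_mono2) auto
    then show ?thesis using assms by (simp add: powr_powr)
  qed
  then show ?thesis by (intro that[of "?S powr (1/q)"]) auto
qed

lemma summable_powr_add:
  fixes a b :: "nat \<Rightarrow> real"
  assumes "summable (\<lambda>j. a j powr q)" "summable (\<lambda>j. b j powr q)" "0 < q" "\<And>j. 0 \<le> a j" "\<And>j. 0 \<le> b j"
  shows "summable (\<lambda>j. (a j + b j) powr q)"
proof (rule summable_comparison_test'[of "\<lambda>j. 2 powr q * (a j powr q + b j powr q)" 0])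
  show "summable (\<lambda>j. 2 powr q * (a j powr q + b j powr q))" by (intro summable_mult summable_add assms)
  fix j
  have "(a j + b j) powr q \<le> (2 * max (a j) (b j)) powr q" using assms by (intro powr_mono2) auto
  also have "\<dots> = 2 powr q * max (a j) (b j) powr q" using assms by (simp add: powr_mult)
  also have "max (a j) (b j) powr q \<le> a j powr q + b j powr q" by (simp add: max_def)
  finally show "norm ((a j + b j) powr q) \<le> 2 powr q * (a j powr q + b j powr q)" by simp
qed

lemma summable_powr_single: "summable (\<lambda>j. (if j = (0::nat) then c else (0::real)) powr q)"
  by (rule summable_finite[of "{0}"]) auto

lemma summable_powr_shift:
  fixes c :: "nat \<Rightarrow> real"
  shows "summable (\<lambda>k. c k powr q) \<Longrightarrow> summable (\<lambda>k. c (k + m) powr q)"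
  using summable_iff_shift[of "\<lambda>k. c k powr q" m] by simp

context sphere_norm
begin

text \<open>The sequence whose \<open>q\<close>-summability is the discrete form of the finiteness of the mixed norm of the derivative
  of order \<open>m\<close>.\<close>

definition scaled_mean :: "real \<Rightarrow> nat \<Rightarrow> (complex^'N \<Rightarrow> complex) \<Rightarrow> nat \<Rightarrow> real" where
  "scaled_mean \<beta> m f k = 2 powr (- (real k * \<beta>)) * mean (radius k) ((Rad ^^ m) f)"

lemma scaled_mean_nonneg [simp]: "0 \<le> scaled_mean \<beta> m f k"
  by (simp add: scaled_mean_def)

text \<open>The absorption argument: the rotational difference with step \<open>u \<approx> 2\<^sup>-\<^sup>k\<^sup>-\<^sup>e\<close> gives the derivative of
  order \<open>n\<close> at scale \<open>k\<close> up to a small multiple of the derivative at scale \<open>k + 1\<close>; the factor is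
  small enough to beat the growth \<open>2\<^sup>k\<^sup>\<alpha>\<close> that is known for functions with bounded means.\<close>

lemma scaled_mean_from_rotations:
  assumes f: "hol f" and H: "\<And>r. 0 < r \<Longrightarrow> r < 1 \<Longrightarrow> mean r f \<le> H"
    and n: "1 \<le> n" and \<alpha>: "0 < \<alpha>" "\<alpha> < real n" and q: "0 < q"
    and u: "\<And>k. (1/2) ^ (k + 3) \<le> u k" "\<And>k. u k \<le> (1/2) ^ k"
    and a: "\<And>k. 0 \<le> a k" "summable (\<lambda>k. a k powr q)"
    and D: "\<And>k r. 0 < r \<Longrightarrow> r < 1 \<Longrightarrow> mean r ((diff_rot (u k) ^^ n) f) \<le> a k * 2 powr (- (real k * \<alpha>))"
  shows "summable (\<lambda>k. scaled_mean (real n - \<alpha>) n f k powr q)"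
proof -
  define A where "A = scaled_mean (real n - \<alpha>) n f"
  define \<phi> where "\<phi> = (\<lambda>k. mean (radius k) ((Rad ^^ n) f))"
  \<comment> \<open>The step is finer than the scale by \<open>2\<^sup>-\<^sup>e\<close>. This beats the factors \<open>n \<le> 2\<^sup>n\<close>, \<open>2\<^sup>n\<^sup>-\<^sup>\<alpha> \<le> 2\<^sup>n\<close> and 2, with \<open>2\<^sup>-\<^sup>n\<^sup>-\<^sup>1\<close> left over.\<close>
  define e where "e = 3 * n + 2"
  define K where "K = (2::real) ^ ((e + 3) * n)"
  have sf: "slice_holomorphic f" by (rule hol_slice[OF f])
  have \<phi>0: "0 \<le> \<phi> k" for k by (simp add: \<phi>_def)
  have A: "A k = 2 powr (- (real k * (real n - \<alpha>))) * \<phi> k" for k by (simp add: A_def scaled_mean_def \<phi>_def)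
  have u0: "0 < u k" for k using u(1)[of k] by (rule less_le_trans[rotated]) simp
  have step: "\<phi> k \<le> K * 2 powr (real k * (real n - \<alpha>)) * a (k + e) + real n * 2 ^ 1 * (1/2) ^ e * \<phi> (Suc k)" for k
  proof -
    let ?u = "u (k + e)"
    have "\<bar>?u\<bar> ^ n * \<phi> k \<le> mean (radius k) ((diff_rot ?u ^^ n) f) + real n * \<bar>?u\<bar> ^ Suc n * mean (radius k) ((Rad ^^ Suc n) f)"
      unfolding \<phi>_def by (rule mean_Rad_le_diff_rot[OF sf]) auto
    also have "mean (radius k) ((diff_rot ?u ^^ n) f) \<le> a (k + e) * 2 powr (- (real (k + e) * \<alpha>))"
      by (rule D) auto
    also have "mean (radius k) ((Rad ^^ Suc n) f) \<le> 2 ^ Suc k * \<phi> (Suc k)"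
      unfolding \<phi>_def using mean_radius_Cauchy[OF slice_holomorphic_Rad_funpow[OF sf], of k n] by simp
    finally have 1: "?u ^ n * \<phi> k \<le> a (k + e) * 2 powr (- (real (k + e) * \<alpha>)) + real n * ?u ^ Suc n * (2 ^ Suc k * \<phi> (Suc k))"
      using u0[of "k + e"] by (simp add: mult_left_mono)
    have "2 powr (- (real (k + e) * \<alpha>)) \<le> 2 powr (- (real k * \<alpha>))" using \<alpha> by (intro powr_mono) (auto simp: mult_right_mono)
    also have "2 powr (- (real k * \<alpha>)) \<le> ?u ^ n * (K * 2 powr (real k * (real n - \<alpha>)))"
    proof -
      have "K * 2 powr (real k * (real n - \<alpha>)) = 2 powr (real ((k + e + 3) * n)) * 2 powr (- (real k * \<alpha>))"
        unfolding K_def by (simp add: powr_realpow[symmetric] powr_add[symmetric] algebra_simps)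
      also have "2 powr (real ((k + e + 3) * n)) = 2 ^ ((k + e + 3) * n)" by (rule powr_realpow) simp
      also have "\<dots> = (2 ^ (k + e + 3)) ^ n" by (rule power_mult)
      finally have "?u ^ n * (K * 2 powr (real k * (real n - \<alpha>))) = (?u * 2 ^ (k + e + 3)) ^ n * 2 powr (- (real k * \<alpha>))"
        by (simp add: power_mult_distrib)
      moreover have "1 \<le> ?u * 2 ^ (k + e + 3)"
        using u(1)[of "k + e"] by (simp add: power_one_over divide_le_eq mult.commute)
      then have "1 \<le> (?u * 2 ^ (k + e + 3)) ^ n" by simp
      ultimately show ?thesis using mult_right_mono[of 1 "(?u * 2 ^ (k + e + 3)) ^ n" "2 powr (- (real k * \<alpha>))"] by simp
    qed
    finally have 2: "a (k + e) * 2 powr (- (real (k + e) * \<alpha>)) \<le> a (k + e) * (?u ^ n * (K * 2 powr (real k * (real n - \<alpha>))))"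
      by (intro mult_left_mono a)
    have "?u * 2 ^ Suc k \<le> (1/2) ^ (k + e) * 2 ^ Suc k" by (intro mult_right_mono u) auto
    also have "\<dots> = 2 ^ 1 * (1/2) ^ e" by (simp add: power_add power_one_over)
    finally have 3: "real n * ?u ^ Suc n * (2 ^ Suc k * \<phi> (Suc k)) \<le> ?u ^ n * (real n * (2 ^ 1 * (1/2) ^ e) * \<phi> (Suc k))"
      using mult_right_mono[of "?u * 2 ^ Suc k" "2 ^ 1 * (1/2) ^ e" "?u ^ n * real n * \<phi> (Suc k)"] u0[of "k + e"] \<phi>0[of "Suc k"]
      by (simp add: mult_ac)
    have "?u ^ n * \<phi> k \<le> ?u ^ n * (K * 2 powr (real k * (real n - \<alpha>)) * a (k + e) + real n * 2 ^ 1 * (1/2) ^ e * \<phi> (Suc k))"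
      using 1 2 3 by (simp add: algebra_simps)
    then show ?thesis using u0[of "k + e"] by (simp only: mult_le_cancel_left_pos zero_less_power)
  qed
  have small: "real n * 2 ^ 1 * (1/2) ^ e * 2 powr (real n - \<alpha>) \<le> (1/2) ^ Suc n"
  proof -
    have "2 powr (real n - \<alpha>) \<le> 2 powr (real n)" using \<alpha> by (intro powr_mono) auto
    also have "\<dots> = 2 ^ n" by (simp add: powr_realpow)
    finally have "real n * 2 ^ 1 * (1/2) ^ e * 2 powr (real n - \<alpha>) \<le> 2 ^ n * 2 ^ 1 * (1/2) ^ e * 2 ^ n"
      by (intro mult_mono) auto
    also have "\<dots> = (1/2) ^ Suc n" by (simp add: e_def power_add power_one_over power_mult eval_nat_numeral field_simps)
    finally show ?thesis .
  qed
  have Astep: "A k \<le> K * a (k + e) + (1/2) ^ Suc n * A (Suc k)" for k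
  proof -
    let ?p = "2 powr (- (real k * (real n - \<alpha>)))"
    have "A k \<le> ?p * (K * 2 powr (real k * (real n - \<alpha>)) * a (k + e) + real n * 2 ^ 1 * (1/2) ^ e * \<phi> (Suc k))"
      unfolding A by (intro mult_left_mono step) auto
    also have "\<dots> = K * a (k + e) + (real n * 2 ^ 1 * (1/2) ^ e * 2 powr (real n - \<alpha>)) * (2 powr (- (real (Suc k) * (real n - \<alpha>))) * \<phi> (Suc k))"
    proof -
      have "?p * 2 powr (real k * (real n - \<alpha>)) = 1" by (simp add: powr_add[symmetric])
      moreover have "?p = 2 powr (real n - \<alpha>) * 2 powr (- (real (Suc k) * (real n - \<alpha>)))"
        by (simp add: powr_add[symmetric] algebra_simps)
      ultimately show ?thesis by (simp add: distrib_left mult_ac)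
    qed
    also have "\<dots> \<le> K * a (k + e) + (1/2) ^ Suc n * A (Suc k)"
      unfolding A by (intro add_left_mono mult_right_mono small) (simp add: \<phi>0)
    finally show ?thesis .
  qed
  \<comment> \<open>Iterating the absorption \<open>m\<close> times; the last term is then removed by the a priori growth.\<close>
  have iter: "A k \<le> (\<Sum>i<m. K * ((1/2) ^ i * a (k + i + e))) + ((1/2) ^ Suc n) ^ m * A (k + m)" for k m
  proof (induction m)
    case (Suc m)
    have "((1/2) ^ Suc n) ^ m * A (k + m) \<le> ((1/2) ^ Suc n) ^ m * (K * a (k + m + e) + (1/2) ^ Suc n * A (Suc (k + m)))"
      by (intro mult_left_mono Astep) auto
    also have "\<dots> = ((1/2) ^ Suc n) ^ m * (K * a (k + m + e)) + ((1/2) ^ Suc n) ^ Suc m * A (k + Suc m)"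
      by (simp add: distrib_left mult_ac)
    also have "((1/2) ^ Suc n) ^ m * (K * a (k + m + e)) \<le> (1/2) ^ m * (K * a (k + m + e))"
      using a by (intro mult_right_mono) (auto simp: K_def power_mult[symmetric] intro!: power_decreasing simp del: power_Suc)
    finally show ?case using Suc by (simp add: mult_ac)
  qed simp
  have H0: "0 \<le> H" by (rule order_trans[OF mean_nonneg H[of "1/2"]]) simp_all
  have Agrow: "((1/2) ^ Suc n) ^ m * A (k + m) \<le> (2 ^ (n * (k + n)) * H) * (1/2) ^ m" for k m
  proof -
    have "A (k + m) \<le> 1 * (2 ^ (n * (k + m + n)) * H)"
      unfolding A \<phi>_def using \<alpha> H0
      by (intro mult_mono mean_Rad_funpow_le[OF sf H]) (auto intro!: two_powr_le_1)
    then have "((1/2) ^ Suc n) ^ m * A (k + m) \<le> ((1/2) ^ Suc n) ^ m * (1 * (2 ^ (n * (k + m + n)) * H))"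
      by (intro mult_left_mono) auto
    also have "\<dots> = (2 ^ (n * (k + n)) * H) * (1/2) ^ m"
      by (simp add: power_mult[symmetric] power_add power_one_over field_simps)
    finally show ?thesis .
  qed
  have "summable (\<lambda>k. A k powr q)"
  proof (rule summable_geom_convolution[where \<eta> = "sqrt (1/2)" and b = "\<lambda>k. a (k + e)" and C = K])
    show "summable (\<lambda>k. a (k + e) powr q)" by (rule summable_powr_shift[OF a(2)])
    show "0 \<le> A k" for k by (simp add: A_def)
    fix k and eps :: real assume eps: "0 < eps"
    have "(\<lambda>m. (2 ^ (n * (k + n)) * H) * (1/2) ^ m) \<longlonglongrightarrow> (2 ^ (n * (k + n)) * H) * 0"
      by (intro tendsto_mult tendsto_const LIMSEQ_realpow_zero) auto
    then have "\<forall>\<^sub>F m in sequentially. (2 ^ (n * (k + n)) * H) * (1/2) ^ m < eps"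
      using eps by (intro order_tendstoD) auto
    then obtain m where m: "(2 ^ (n * (k + n)) * H) * (1/2) ^ m < eps" using eventually_happens'[OF sequentially_bot] by blast
    have "A k \<le> (\<Sum>i<m. K * ((1/2) ^ i * a (k + i + e))) + eps"
      using iter[of k m] Agrow[of m k] m by linarith
    also have "(\<Sum>i<m. K * ((1/2) ^ i * a (k + i + e))) = K * (\<Sum>j\<in>{k..<k+m}. geom_kernel (1/2) k j * a (j + e))"
      unfolding sum_distrib_left
      by (rule sum.reindex_bij_witness[of _ "\<lambda>j. j - k" "\<lambda>i. k + i"]) (auto simp: geom_kernel_def)
    also have "\<dots> \<le> K * (\<Sum>j<k+m. geom_kernel (1/2) k j * a (j + e))"
      using a by (intro mult_left_mono sum_mono2) (auto simp: K_def geom_kernel_def)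
    finally show "\<exists>J. A k \<le> K * (\<Sum>j<J. geom_kernel ((sqrt (1/2))\<^sup>2) k j * a (j + e)) + eps"
      by (intro exI[of _ "k + m"]) simp
  qed (use a q in \<open>auto simp: K_def\<close>)
  then show ?thesis by (simp add: A_def)
qed

text \<open>A discrete Hardy inequality: the means of the derivative of order \<open>m\<close> grow from one dyadic radius to the
  next by at most a term of order \<open>m + 1\<close>, and the weight decays geometrically because of \<open>\<alpha> < m\<close>.\<close>

lemma scaled_mean_lower_order:
  assumes f: "hol f" and m: "\<alpha> < real m" and q: "0 < q"
    and S: "summable (\<lambda>k. scaled_mean (real (Suc m) - \<alpha>) (Suc m) f k powr q)"
  shows "summable (\<lambda>k. scaled_mean (real m - \<alpha>) m f k powr q)"
proof -
  define A where "A = scaled_mean (real m - \<alpha>) m f"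
  define B where "B = scaled_mean (real (Suc m) - \<alpha>) (Suc m) f"
  define \<theta> where "\<theta> = 2 powr (- (real m - \<alpha>))"
  have \<theta>: "0 < \<theta>" "\<theta> < 1" using m by (auto simp: \<theta>_def simp del: minus_diff_eq intro!: two_powr_less_1)
  have sf: "slice_holomorphic ((Rad ^^ m) f)" by (rule slice_holomorphic_Rad_funpow[OF hol_slice[OF f]])
  have step: "A (Suc k) \<le> \<theta> * A k + B (Suc k)" for k
  proof -
    let ?p = "2 powr (- (real (Suc k) * (real m - \<alpha>)))"
    have "A (Suc k) \<le> ?p * (mean (radius k) ((Rad ^^ m) f) + (1/2) ^ Suc k * mean (radius (Suc k)) (Rad ((Rad ^^ m) f)))"
      unfolding A_def scaled_mean_def by (intro mult_left_mono mean_radius_step[OF sf]) auto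
    also have "\<dots> = (?p * mean (radius k) ((Rad ^^ m) f)) + (?p * (1/2) ^ Suc k) * mean (radius (Suc k)) (Rad ((Rad ^^ m) f))"
      by (simp only: distrib_left mult.assoc)
    also have "?p = \<theta> * 2 powr (- (real k * (real m - \<alpha>)))" by (simp add: \<theta>_def powr_add[symmetric] algebra_simps)
    also have "\<theta> * 2 powr (- (real k * (real m - \<alpha>))) * (1/2) ^ Suc k = 2 powr (- (real (Suc k) * (real (Suc m) - \<alpha>)))"
      unfolding half_power \<theta>_def by (simp add: powr_add[symmetric] algebra_simps)
    finally show ?thesis by (simp add: A_def B_def scaled_mean_def mult_ac)
  qed
  define b where "b = (\<lambda>j. B j + (if j = 0 then A 0 else 0))"
  have b0: "0 \<le> b j" for j by (simp add: b_def A_def B_def)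
  have iter: "A k \<le> (\<Sum>j<Suc k. \<theta> ^ (k - j) * b j)" for k
  proof (induction k)
    case (Suc k)
    have "A (Suc k) \<le> \<theta> * (\<Sum>j<Suc k. \<theta> ^ (k - j) * b j) + B (Suc k)"
      using step[of k] mult_left_mono[OF Suc, of \<theta>] \<theta> by linarith
    also have "\<theta> * (\<Sum>j<Suc k. \<theta> ^ (k - j) * b j) = (\<Sum>j<Suc k. \<theta> ^ (Suc k - j) * b j)"
      unfolding sum_distrib_left by (intro sum.cong refl) (simp add: Suc_diff_le)
    finally show ?case by (simp add: b_def)
  qed (simp add: b_def B_def)
  have "summable (\<lambda>k. A k powr q)"
  proof (rule summable_geom_convolution[where \<eta> = "sqrt \<theta>" and b = b and C = 1])
    show "summable (\<lambda>j. b j powr q)"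
      unfolding b_def using S q
      by (intro summable_powr_add summable_powr_single) (auto simp: B_def A_def)
    fix k and e :: real assume "0 < e"
    have "A k \<le> (\<Sum>j<Suc k. geom_kernel \<theta> k j * b j)"
      using iter[of k] by (simp add: geom_kernel_def)
    then show "\<exists>J. A k \<le> 1 * (\<Sum>j<J. geom_kernel ((sqrt \<theta>)\<^sup>2) k j * b j) + e"
      using \<theta> \<open>0 < e\<close> by (intro exI[of _ "Suc k"]) simp
  qed (use \<theta> q b0 in \<open>auto simp: A_def\<close>)
  then show ?thesis by (simp add: A_def)
qed

lemma scaled_mean_lower_orders:
  assumes f: "hol f" and s: "\<alpha> < real s" "s \<le> n" and q: "0 < q"
    and S: "summable (\<lambda>k. scaled_mean (real n - \<alpha>) n f k powr q)"
  shows "summable (\<lambda>k. scaled_mean (real s - \<alpha>) s f k powr q)"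
  using s(2)
proof (induction s rule: inc_induct)
  case base show ?case by (rule S)
next
  case (step m)
  have "real s \<le> real m" using step.hyps by simp
  then have "\<alpha> < real m" using s(1) by linarith
  then show ?case by (rule scaled_mean_lower_order[OF f _ q step.IH])
qed

text \<open>The moduli are controlled by the derivatives: the sum over the pieces becomes a convolution with a
  two-sided geometric sequence, decaying because of \<open>\<alpha> > 0\<close> on one side and \<open>\<alpha> < n\<close> on the other.\<close>

lemma moduli_from_scaled_mean:
  assumes f: "hol f" and s: "1 \<le> s" and n: "1 \<le> n" and \<alpha>: "0 < \<alpha>" "\<alpha> < real n" and q: "0 < q"
    and S: "summable (\<lambda>k. scaled_mean (real s - \<alpha>) s f k powr q)"
  shows "\<exists>E :: nat \<Rightarrow> real. (\<forall>k. 0 \<le> E k) \<and> summable (\<lambda>k. (2 powr (real k * \<alpha>) * E k) powr q) \<and>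
    (\<forall>k U r. linear_contraction U \<longrightarrow> (\<forall>z. norm (U z - z) \<le> (1/2) ^ k * norm z) \<longrightarrow> 0 < r \<longrightarrow> r < 1 \<longrightarrow>
      mean r ((diff_op U ^^ n) f) \<le> E k)"
    and "\<exists>H. \<forall>r. 0 < r \<longrightarrow> r < 1 \<longrightarrow> mean r f \<le> H"
proof -
  define b where "b = (\<lambda>j. (1/2) ^ (j * s) * mean (radius (Suc (Suc j))) ((Rad ^^ s) f))"
  define B where "B = (\<lambda>j. 2 powr (real j * \<alpha>) * b j)"
  have b0: "0 \<le> b j" for j by (simp add: b_def)
  have B0: "0 \<le> B j" for j using b0 by (simp add: B_def)
  have bB: "b j = 2 powr (- (real j * \<alpha>)) * B j" for j by (simp add: B_def powr_minus)
  have B: "B j = 2 powr (2 * (real s - \<alpha>)) * scaled_mean (real s - \<alpha>) s f (j + 2)" for j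
    unfolding B_def b_def half_power scaled_mean_def
    by (simp add: powr_add[symmetric] mult.assoc[symmetric] algebra_simps)
  have SB: "summable (\<lambda>j. B j powr q)"
  proof -
    have "summable (\<lambda>j. (2 powr (2 * (real s - \<alpha>))) powr q * scaled_mean (real s - \<alpha>) s f (j + 2) powr q)"
      by (intro summable_mult summable_powr_shift S)
    then show ?thesis unfolding B by (simp add: powr_mult)
  qed
  obtain M where M: "0 \<le> M" "\<And>j. B j \<le> M" using summable_powr_bounded[OF SB q B0] by blast
  define x where "x = 2 powr (- \<alpha>)"
  have x: "0 < x" "x < 1" using \<alpha> by (auto simp: x_def intro!: two_powr_less_1)
  have xp: "2 powr (- (real j * \<alpha>)) = x ^ j" for j
    using x by (simp add: x_def powr_realpow[symmetric] powr_powr mult.commute)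
  have sb: "summable b"
  proof (rule summable_comparison_test'[of "\<lambda>j. x ^ j * M" 0])
    show "summable (\<lambda>j. x ^ j * M)" using x by (intro summable_mult2 summable_geometric) auto
    show "norm (b j) \<le> x ^ j * M" for j using M(2)[of j] x b0[of j] by (simp add: bB xp)
  qed
  define K0 where "K0 = mean (radius 1) f"
  have K0: "0 \<le> K0" by (simp add: K0_def)
  define C where "C = (16 * real n) ^ n * (real s * 2 ^ s)"
  have C: "0 \<le> C" by (simp add: C_def)
  define E where "E = (\<lambda>k. C * ((1/2) ^ (k * n) * K0 + (\<Sum>j<k. (1/2) ^ ((k - j) * n) * b j) + (\<Sum>j. b (j + k))))"
  have sbk: "summable (\<lambda>j. b (j + k))" for k using sb by (simp only: summable_iff_shift)
  have E0: "0 \<le> E k" for k unfolding E_def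
    using C K0 b0 sbk by (intro mult_nonneg_nonneg add_nonneg_nonneg sum_nonneg suminf_nonneg) auto
  define \<theta> where "\<theta> = max x (2 powr (- (real n - \<alpha>)))"
  have y: "2 powr (- (real n - \<alpha>)) < 1" using \<alpha> by (intro two_powr_less_1) simp
  have \<theta>: "0 < \<theta>" "\<theta> < 1" using x y by (auto simp: \<theta>_def)
  have p1: "2 powr (real k * \<alpha>) * (1/2) ^ ((k - j) * n) * 2 powr (- (real j * \<alpha>)) \<le> geom_kernel \<theta> k j" if "j \<le> k" for k j
  proof -
    have "2 powr (real k * \<alpha>) * (1/2) ^ ((k - j) * n) * 2 powr (- (real j * \<alpha>)) = 2 powr (- (real (k - j) * (real n - \<alpha>)))"
      unfolding half_power using that by (simp add: powr_add[symmetric] of_nat_diff algebra_simps)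
    also have "\<dots> = (2 powr (- (real n - \<alpha>))) ^ (k - j)" unfolding two_powr_power by (simp add: algebra_simps)
    also have "\<dots> \<le> \<theta> ^ (k - j)" by (intro power_mono) (auto simp: \<theta>_def)
    finally show ?thesis using that by (simp add: geom_kernel_def)
  qed
  have p2: "2 powr (real k * \<alpha>) * 2 powr (- (real j * \<alpha>)) \<le> geom_kernel \<theta> k j" if "k \<le> j" for k j
  proof -
    have "2 powr (real k * \<alpha>) * 2 powr (- (real j * \<alpha>)) = 2 powr (- (real (j - k) * \<alpha>))"
      using that by (simp add: powr_add[symmetric] of_nat_diff algebra_simps)
    also have "\<dots> \<le> \<theta> ^ (j - k)" unfolding xp using x by (intro power_mono) (auto simp: \<theta>_def)
    finally show ?thesis using that by (simp add: geom_kernel_def)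
  qed
  define B' where "B' = (\<lambda>j. B j + (if j = 0 then K0 else 0))"
  have F1: "summable (\<lambda>k. (2 powr (real k * \<alpha>) * E k) powr q)"
  proof (rule summable_geom_convolution[where \<eta> = "sqrt \<theta>" and b = B' and C = C])
    show "0 \<le> B' j" for j using B0 K0 by (simp add: B'_def)
    show "summable (\<lambda>j. B' j powr q)"
      unfolding B'_def using SB q B0 K0 by (intro summable_powr_add summable_powr_single) auto
    fix k and eps :: real assume eps: "0 < eps"
    let ?p = "2 powr (real k * \<alpha>)"
    \<comment> \<open>The error that may be made in truncating the tail \<open>\<Sum>\<^sub>j b (j + k)\<close>.\<close>
    define d where "d = eps / (C * ?p + 1)"
    have Cp: "0 < C * ?p + 1" using C by (simp add: add_nonneg_pos)
    have d: "0 < d" using eps Cp by (simp add: d_def)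
    have "(\<lambda>J. \<Sum>j<J. b (j + k)) \<longlonglongrightarrow> (\<Sum>j. b (j + k))" using sbk by (rule summable_LIMSEQ)
    then have "\<forall>\<^sub>F J in sequentially. (\<Sum>j. b (j + k)) - d < (\<Sum>j<J. b (j + k))"
      using d by (intro order_tendstoD) auto
    then obtain J where J: "(\<Sum>j. b (j + k)) - d < (\<Sum>j<J. b (j + k))" using eventually_happens'[OF sequentially_bot] by blast
    have "?p * ((1/2) ^ (k * n) * K0 + (\<Sum>j<k. (1/2) ^ ((k - j) * n) * b j) + (\<Sum>j<J. b (j + k)))
      \<le> geom_kernel \<theta> k 0 * K0 + (\<Sum>j<k. geom_kernel \<theta> k j * B j) + (\<Sum>j=k..<k+J. geom_kernel \<theta> k j * B j)"
      unfolding distrib_left sum_distrib_left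
    proof (intro add_mono)
      show "?p * ((1/2) ^ (k * n) * K0) \<le> geom_kernel \<theta> k 0 * K0"
        using mult_right_mono[OF p1[of 0 k] K0] by (simp add: mult_ac)
      show "(\<Sum>j<k. ?p * ((1/2) ^ ((k - j) * n) * b j)) \<le> (\<Sum>j<k. geom_kernel \<theta> k j * B j)"
      proof (rule sum_mono)
        fix j assume "j \<in> {..<k}"
        then show "?p * ((1/2) ^ ((k - j) * n) * b j) \<le> geom_kernel \<theta> k j * B j"
          using mult_right_mono[OF p1[of j k] B0[of j]] by (simp add: bB mult_ac)
      qed
      have "(\<Sum>j<J. ?p * b (j + k)) = (\<Sum>j=k..<k+J. ?p * b j)"
        by (rule sum.reindex_bij_witness[of _ "\<lambda>j. j - k" "\<lambda>j. j + k"]) auto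
      also have "\<dots> \<le> (\<Sum>j=k..<k+J. geom_kernel \<theta> k j * B j)"
      proof (rule sum_mono)
        fix j assume "j \<in> {k..<k+J}"
        then show "?p * b j \<le> geom_kernel \<theta> k j * B j"
          using mult_right_mono[OF p2[of k j] B0[of j]] by (simp add: bB mult_ac)
      qed
      finally show "(\<Sum>j<J. ?p * b (j + k)) \<le> (\<Sum>j=k..<k+J. geom_kernel \<theta> k j * B j)" .
    qed
    also have "\<dots> = geom_kernel \<theta> k 0 * K0 + (\<Sum>j<k+J. geom_kernel \<theta> k j * B j)"
      using sum.atLeastLessThan_concat[of 0 k "k + J" "\<lambda>j. geom_kernel \<theta> k j * B j"] by (simp add: atLeast0LessThan)
    also have "\<dots> \<le> (\<Sum>j<Suc (k+J). geom_kernel \<theta> k j * B' j)"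
    proof -
      have "(\<Sum>j<Suc (k+J). geom_kernel \<theta> k j * (if j = 0 then K0 else 0)) = geom_kernel \<theta> k 0 * K0"
        by (simp add: if_distrib cong: if_cong)
      moreover have "(\<Sum>j<k+J. geom_kernel \<theta> k j * B j) \<le> (\<Sum>j<Suc (k+J). geom_kernel \<theta> k j * B j)"
        using \<theta> B0 by (intro sum_mono2) (auto simp: geom_kernel_def)
      ultimately show ?thesis by (simp only: B'_def distrib_left sum.distrib)
    qed
    finally have main: "?p * ((1/2) ^ (k * n) * K0 + (\<Sum>j<k. (1/2) ^ ((k - j) * n) * b j) + (\<Sum>j<J. b (j + k)))
      \<le> (\<Sum>j<Suc (k+J). geom_kernel \<theta> k j * B' j)" .
    have "?p * E k \<le> C * (?p * ((1/2) ^ (k * n) * K0 + (\<Sum>j<k. (1/2) ^ ((k - j) * n) * b j) + ((\<Sum>j<J. b (j + k)) + d)))"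
    proof -
      have "?p * E k = C * (?p * ((1/2) ^ (k * n) * K0 + (\<Sum>j<k. (1/2) ^ ((k - j) * n) * b j) + (\<Sum>j. b (j + k))))"
        by (simp only: E_def mult.left_commute)
      also have "\<dots> \<le> C * (?p * ((1/2) ^ (k * n) * K0 + (\<Sum>j<k. (1/2) ^ ((k - j) * n) * b j) + ((\<Sum>j<J. b (j + k)) + d)))"
        using J C by (intro mult_left_mono add_left_mono) auto
      finally show ?thesis .
    qed
    also have "\<dots> = C * (?p * ((1/2) ^ (k * n) * K0 + (\<Sum>j<k. (1/2) ^ ((k - j) * n) * b j) + (\<Sum>j<J. b (j + k)))) + C * ?p * d"
      by (simp only: distrib_left mult.assoc add.assoc)
    also have "\<dots> \<le> C * (\<Sum>j<Suc (k+J). geom_kernel \<theta> k j * B' j) + C * ?p * d"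
      by (intro add_right_mono mult_left_mono main C)
    also have "C * ?p * d \<le> eps"
    proof -
      have "C * ?p * d \<le> (C * ?p + 1) * d" using d by (intro mult_right_mono) auto
      also have "\<dots> = eps" using Cp by (simp add: d_def)
      finally show ?thesis .
    qed
    finally show "\<exists>J. ?p * E k \<le> C * (\<Sum>j<J. geom_kernel ((sqrt \<theta>)\<^sup>2) k j * B' j) + eps"
      using \<theta> by (intro exI[of _ "Suc (k + J)"]) simp
  qed (use \<theta> q C E0 in auto)
  have F2: "mean r ((diff_op U ^^ n) f) \<le> E k"
    if "linear_contraction U" "\<And>z. norm (U z - z) \<le> (1/2) ^ k * norm z" "0 < r" "r < 1" for k U r
    unfolding E_def C_def K0_def
    by (rule mean_diff_op_dyadic[OF that(1) f less_imp_le[OF that(3)] that(4) s n that(2) _ sb]) (simp add: b_def)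
  show "\<exists>E :: nat \<Rightarrow> real. (\<forall>k. 0 \<le> E k) \<and> summable (\<lambda>k. (2 powr (real k * \<alpha>) * E k) powr q) \<and>
    (\<forall>k U r. linear_contraction U \<longrightarrow> (\<forall>z. norm (U z - z) \<le> (1/2) ^ k * norm z) \<longrightarrow> 0 < r \<longrightarrow> r < 1 \<longrightarrow>
      mean r ((diff_op U ^^ n) f) \<le> E k)"
    using E0 F1 F2 by (intro exI[of _ E] conjI allI impI) (assumption | simp)+
  show "\<exists>H. \<forall>r. 0 < r \<longrightarrow> r < 1 \<longrightarrow> mean r f \<le> H"
  proof (intro exI allI impI)
    fix r :: real assume r: "0 < r" "r < 1"
    show "mean r f \<le> real s * 2 ^ s * (mean (radius 1) f + (\<Sum>j. b j))"
      by (rule mean_le_dyadic[OF f less_imp_le[OF r(1)] r(2) s _ sb]) (simp add: b_def)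
  qed
qed

end

section \<open>Weighted integrals as dyadic sums\<close>

lemma nn_integral_ge_step:
  fixes J :: "nat \<Rightarrow> real set" and c :: "nat \<Rightarrow> ennreal"
  assumes d: "disjoint_family J" and J [measurable]: "\<And>k. J k \<in> sets borel"
    and le: "\<And>k x. x \<in> J k \<Longrightarrow> c k \<le> g x"
  shows "(\<Sum>k. c k * emeasure lborel (J k)) \<le> (\<integral>\<^sup>+x. g x \<partial>lborel)"
proof -
  have "(\<Sum>k. c k * emeasure lborel (J k)) = (\<Sum>k. \<integral>\<^sup>+x. c k * indicator (J k) x \<partial>lborel)"
    by (simp add: nn_integral_cmult_indicator)
  also have "\<dots> = (\<integral>\<^sup>+x. (\<Sum>k. c k * indicator (J k) x) \<partial>lborel)"
    by (rule nn_integral_suminf[symmetric]) measurable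
  also have "\<dots> \<le> (\<integral>\<^sup>+x. g x \<partial>lborel)"
  proof (rule nn_integral_mono)
    fix x :: real
    show "(\<Sum>k. c k * indicator (J k) x) \<le> g x"
    proof (cases "\<exists>k. x \<in> J k")
      case True
      then obtain k where k: "x \<in> J k" by blast
      have "(\<Sum>k. c k * indicator (J k) x) = c k" by (rule suminf_cmult_indicator[OF d k])
      then show ?thesis using le[OF k] by simp
    next
      case False
      then have "(\<lambda>k. c k * indicator (J k) x) = (\<lambda>k. 0)" by auto
      then show ?thesis by simp
    qed
  qed
  finally show ?thesis .
qed

lemma nn_integral_le_step:
  fixes J :: "nat \<Rightarrow> real set" and c :: "nat \<Rightarrow> ennreal"
  assumes d: "disjoint_family J" and J [measurable]: "\<And>k. J k \<in> sets borel"
    and le: "\<And>k x. x \<in> J k \<Longrightarrow> g x \<le> c k" and cov: "\<And>x. g x \<noteq> 0 \<Longrightarrow> \<exists>k. x \<in> J k"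
  shows "(\<integral>\<^sup>+x. g x \<partial>lborel) \<le> (\<Sum>k. c k * emeasure lborel (J k))"
proof -
  have "(\<integral>\<^sup>+x. g x \<partial>lborel) \<le> (\<integral>\<^sup>+x. (\<Sum>k. c k * indicator (J k) x) \<partial>lborel)"
  proof (rule nn_integral_mono)
    fix x :: real
    show "g x \<le> (\<Sum>k. c k * indicator (J k) x)"
    proof (cases "g x = 0")
      case False
      then obtain k where k: "x \<in> J k" using cov by blast
      have "(\<Sum>k. c k * indicator (J k) x) = c k" by (rule suminf_cmult_indicator[OF d k])
      then show ?thesis using le[OF k] by simp
    qed simp
  qed
  also have "\<dots> = (\<Sum>k. \<integral>\<^sup>+x. c k * indicator (J k) x \<partial>lborel)"
    by (rule nn_integral_suminf) measurable
  also have "\<dots> = (\<Sum>k. c k * emeasure lborel (J k))" by (simp add: nn_integral_cmult_indicator)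
  finally show ?thesis .
qed

lemma disjoint_family_halfopen:
  fixes x :: "nat \<Rightarrow> real"
  assumes "\<And>i j. i \<le> j \<Longrightarrow> x i \<le> x j"
  shows "disjoint_family (\<lambda>k. {x k<..x (Suc k)})"
proof -
  have *: "{x i<..x (Suc i)} \<inter> {x j<..x (Suc j)} = {}" if "i < j" for i j
    using assms[of "Suc i" j] that by auto
  show ?thesis unfolding disjoint_family_on_def
  proof (intro ballI impI)
    fix i j :: nat assume "i \<noteq> j"
    then consider "i < j" | "j < i" by linarith
    then show "{x i<..x (Suc i)} \<inter> {x j<..x (Suc j)} = {}"
      by cases (rule *, assumption, subst Int_commute, rule *)
  qed
qed

definition dyadic_interval :: "nat \<Rightarrow> real set" where
  "dyadic_interval k = {(1/2) ^ Suc k<..(1/2) ^ k}"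

lemma disjoint_dyadic_interval: "disjoint_family dyadic_interval"
proof -
  have *: "dyadic_interval i \<inter> dyadic_interval j = {}" if "i < j" for i j
  proof -
    have "(1/2 :: real) ^ j \<le> (1/2) ^ Suc i" using that by (intro power_decreasing) auto
    then show ?thesis by (auto simp: dyadic_interval_def)
  qed
  show ?thesis unfolding disjoint_family_on_def
  proof (intro ballI impI)
    fix i j :: nat assume "i \<noteq> j"
    then consider "i < j" | "j < i" by linarith
    then show "dyadic_interval i \<inter> dyadic_interval j = {}"
      by cases (rule *, assumption, subst Int_commute, rule *)
  qed
qed

lemma dyadic_interval_cover:
  assumes "0 < t" "t \<le> 1"
  shows "\<exists>k. t \<in> dyadic_interval k"
proof -
  obtain m where m: "(1/2) ^ m < t" using real_arch_pow_inv[of t "1/2"] assms by auto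
  define k where "k = (LEAST m. (1/2) ^ m < t)"
  have k: "(1/2) ^ k < t" unfolding k_def by (rule LeastI[of "\<lambda>m. (1/2) ^ m < t", OF m])
  have "k \<noteq> 0" using k assms(2) by (intro notI) simp
  then obtain k' where k': "k = Suc k'" by (cases k) auto
  have "\<not> (1/2) ^ k' < t" using not_less_Least[of k' "\<lambda>m. (1/2) ^ m < t"] by (simp add: k_def[symmetric] k')
  then show ?thesis using k k' by (intro exI[of _ k']) (auto simp: dyadic_interval_def)
qed

lemma emeasure_dyadic_interval: "emeasure lborel (dyadic_interval k) = ennreal ((1/2) ^ Suc k)"
  by (simp add: dyadic_interval_def)

definition smoothness_integrand :: "real \<Rightarrow> real \<Rightarrow> (real \<Rightarrow> ennreal) \<Rightarrow> real \<Rightarrow> ennreal" where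
  "smoothness_integrand q \<alpha> \<Psi> t = enn_powr (\<Psi> t / ennreal (t powr \<alpha>)) q * ennreal (1 / t)"

lemma smoothness_integral_finite_iff:
  "smoothness_integral q \<alpha> \<Psi> < \<infinity> \<longleftrightarrow> (\<integral>\<^sup>+t. smoothness_integrand q \<alpha> \<Psi> t * indicator {0<..<1} t \<partial>lborel) < \<infinity>"
  by (simp add: smoothness_integral_def enn_powr_less_top_iff[unfolded infinity_ennreal_def] smoothness_integrand_def)

lemma smoothness_integral_finite:
  assumes q: "0 < q" and \<alpha>: "0 < \<alpha>" and E0: "\<And>k. 0 \<le> E k"
    and E: "\<And>k t. t \<in> dyadic_interval k \<Longrightarrow> t < 1 \<Longrightarrow> \<Psi> t \<le> ennreal (E k)"
    and S: "summable (\<lambda>k. (2 powr (real k * \<alpha>) * E k) powr q)"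
  shows "smoothness_integral q \<alpha> \<Psi> < \<infinity>"
proof -
  define c where "c = (\<lambda>k. (E k / ((1/2) ^ Suc k) powr \<alpha>) powr q * 2 ^ Suc k)"
  have c0: "0 \<le> c k" for k by (simp add: c_def)
  have "(\<integral>\<^sup>+t. smoothness_integrand q \<alpha> \<Psi> t * indicator {0<..<1} t \<partial>lborel) \<le> (\<Sum>k. ennreal (c k) * emeasure lborel (dyadic_interval k))"
  proof (rule nn_integral_le_step[OF disjoint_dyadic_interval])
    show "dyadic_interval k \<in> sets borel" for k by (simp add: dyadic_interval_def)
    fix k and t :: real assume t: "t \<in> dyadic_interval k"
    then have t': "(1/2) ^ Suc k < t" by (simp add: dyadic_interval_def)
    then have t0: "0 < t" by (rule less_trans[rotated]) simp
    show "smoothness_integrand q \<alpha> \<Psi> t * indicator {0<..<1} t \<le> ennreal (c k)"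
    proof (cases "t < 1")
      case True
      have "\<Psi> t / ennreal (t powr \<alpha>) \<le> ennreal (E k) / ennreal (t powr \<alpha>)"
        by (intro divide_right_mono_ennreal E t True)
      also have "\<dots> = ennreal (E k / t powr \<alpha>)" using t0 E0 by (intro divide_ennreal) auto
      also have "\<dots> \<le> ennreal (E k / ((1/2) ^ Suc k) powr \<alpha>)"
        using t' t0 \<alpha> E0 by (intro ennreal_leI divide_left_mono powr_mono2 mult_pos_pos) auto
      finally have "enn_powr (\<Psi> t / ennreal (t powr \<alpha>)) q \<le> enn_powr (ennreal (E k / ((1/2) ^ Suc k) powr \<alpha>)) q"
        using q by (intro enn_powr_mono) auto
      also have "\<dots> = ennreal ((E k / ((1/2) ^ Suc k) powr \<alpha>) powr q)" using E0 by (intro enn_powr_ennreal) auto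
      finally have 1: "enn_powr (\<Psi> t / ennreal (t powr \<alpha>)) q \<le> ennreal ((E k / ((1/2) ^ Suc k) powr \<alpha>) powr q)" .
      have "1 / t \<le> 1 / (1/2) ^ Suc k" using t' t0 by (intro divide_left_mono) auto
      then have 2: "ennreal (1 / t) \<le> ennreal (2 ^ Suc k)" by (intro ennreal_leI) (simp add: power_one_over)
      have "smoothness_integrand q \<alpha> \<Psi> t \<le> ennreal ((E k / ((1/2) ^ Suc k) powr \<alpha>) powr q) * ennreal (2 ^ Suc k)"
        unfolding smoothness_integrand_def by (intro mult_mono 1 2) auto
      also have "\<dots> = ennreal (c k)" by (simp only: c_def) (rule ennreal_mult[symmetric], auto)
      finally show ?thesis using True t0 by simp
    qed (simp add: t0)
  next
    fix t assume "smoothness_integrand q \<alpha> \<Psi> t * indicator {0<..<1} t \<noteq> 0"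
    then have "0 < t" "t \<le> 1" by (auto simp: indicator_def split: if_splits)
    then show "\<exists>k. t \<in> dyadic_interval k" by (rule dyadic_interval_cover)
  qed
  also have "\<dots> = (\<Sum>k. ennreal ((2 powr \<alpha>) powr q * (2 powr (real k * \<alpha>) * E k) powr q))"
  proof (rule suminf_cong)
    fix k
    have "E k / ((1/2) ^ Suc k) powr \<alpha> = 2 powr \<alpha> * (2 powr (real k * \<alpha>) * E k)"
    proof -
      have "2 powr (real (Suc k) * \<alpha>) = 2 powr \<alpha> * 2 powr (real k * \<alpha>)"
        by (simp add: powr_add[symmetric] algebra_simps)
      then show ?thesis unfolding powr_half_power powr_minus by (simp add: divide_inverse)
    qed
    then have "c k * (1/2) ^ Suc k = (2 powr \<alpha>) powr q * (2 powr (real k * \<alpha>) * E k) powr q"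
      by (simp add: c_def powr_mult E0 power_one_over)
    then show "ennreal (c k) * emeasure lborel (dyadic_interval k) = ennreal ((2 powr \<alpha>) powr q * (2 powr (real k * \<alpha>) * E k) powr q)"
      unfolding emeasure_dyadic_interval by (subst ennreal_mult[symmetric]) (auto simp: c0)
  qed
  also have "\<dots> < \<infinity>"
    unfolding infinity_ennreal_def top.not_eq_extremum[symmetric]
    by (rule ennreal_suminf_neq_top[OF summable_mult[OF S]]) simp
  finally show ?thesis unfolding smoothness_integral_finite_iff .
qed

text \<open>Since \<open>\<Psi>\<close> need not be monotone, the integral only gives good sample points: in each dyadic interval
  there is a point at which the integrand nearly attains its infimum.\<close>

lemma smoothness_integral_sample:
  assumes q: "0 < q" and fin: "smoothness_integral q \<alpha> \<Psi> < \<infinity>"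
  shows "\<exists>a t. (\<forall>k. 0 \<le> a k \<and> t k \<in> dyadic_interval (Suc k) \<and> \<Psi> (t k) \<le> ennreal (a k * t k powr \<alpha>)) \<and>
    summable (\<lambda>k. a k powr q)"
proof -
  define c where "c = (\<lambda>k. INF t\<in>dyadic_interval (Suc k). smoothness_integrand q \<alpha> \<Psi> t)"
  have sub: "dyadic_interval (Suc k) \<subseteq> {0<..<1}" for k
  proof
    fix t assume "t \<in> dyadic_interval (Suc k)"
    then have "(1/2) ^ Suc (Suc k) < t" "t \<le> (1/2) ^ Suc k" by (auto simp: dyadic_interval_def)
    moreover have "(1/2 :: real) ^ Suc k < 1" by (rule power_Suc_less_one) auto
    moreover have "(0 :: real) < (1/2) ^ Suc (Suc k)" by simp
    ultimately show "t \<in> {0<..<1}" by auto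
  qed
  have "(\<Sum>k. c k * emeasure lborel (dyadic_interval (Suc k))) \<le> (\<integral>\<^sup>+t. smoothness_integrand q \<alpha> \<Psi> t * indicator {0<..<1} t \<partial>lborel)"
  proof (rule nn_integral_ge_step)
    show "disjoint_family (\<lambda>k. dyadic_interval (Suc k))"
      using disjoint_dyadic_interval unfolding disjoint_family_on_def by auto
    show "dyadic_interval (Suc k) \<in> sets borel" for k by (simp add: dyadic_interval_def)
    fix k t assume t: "t \<in> dyadic_interval (Suc k)"
    then have "c k \<le> smoothness_integrand q \<alpha> \<Psi> t" unfolding c_def by (rule INF_lower)
    then show "c k \<le> smoothness_integrand q \<alpha> \<Psi> t * indicator {0<..<1} t" using sub[of k] t by auto
  qed
  also have "\<dots> < \<infinity>" using fin by (simp only: smoothness_integral_finite_iff)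
  finally have S: "(\<Sum>k. c k * ennreal ((1/2) ^ Suc (Suc k))) < top"
    by (simp only: emeasure_dyadic_interval infinity_ennreal_def)
  have cfin: "c k < \<infinity>" for k
  proof -
    have "c k * ennreal ((1/2) ^ Suc (Suc k)) < top" by (rule ennreal_suminf_lessD[OF S])
    moreover have "ennreal ((1/2) ^ Suc (Suc k)) \<noteq> 0" by (simp del: power_Suc)
    ultimately show ?thesis by (auto simp: ennreal_mult_less_top simp del: power_Suc)
  qed
  \<comment> \<open>The error 1 is harmless: after the weight \<open>t\<close> it contributes a geometric series.\<close>
  have ex: "\<exists>t\<in>dyadic_interval (Suc k). smoothness_integrand q \<alpha> \<Psi> t < c k + 1" for k
  proof -
    have "c k < c k + 1" using cfin[of k] by (cases "c k") (auto simp: ennreal_less_iff simp flip: ennreal_1 ennreal_plus)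
    then have "(INF t\<in>dyadic_interval (Suc k). smoothness_integrand q \<alpha> \<Psi> t) < c k + 1" by (simp only: c_def)
    then show ?thesis unfolding INF_less_iff .
  qed
  then obtain t where t: "\<And>k. t k \<in> dyadic_interval (Suc k)" "\<And>k. smoothness_integrand q \<alpha> \<Psi> (t k) < c k + 1" by metis
  have t0: "0 < t k" for k using sub[of k] t(1)[of k] by auto
  define v where "v = (\<lambda>k. \<Psi> (t k) / ennreal (t k powr \<alpha>))"
  define a where "a = (\<lambda>k. enn2real (v k))"
  define cr where "cr = (\<lambda>k. enn2real (c k))"
  have c: "c k = ennreal (cr k)" "0 \<le> cr k" for k using cfin[of k] by (simp_all add: cr_def)
  have lt: "enn_powr (v k) q * ennreal (1 / t k) < ennreal (cr k + 1)" for k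
    using t(2)[of k] by (simp add: smoothness_integrand_def v_def c)
  have vfin: "v k \<noteq> \<infinity>" for k
  proof
    assume "v k = \<infinity>"
    then have "enn_powr (v k) q * ennreal (1 / t k) = \<infinity>" using t0[of k] by (simp add: enn_powr_def ennreal_top_mult)
    then show False using lt[of k] by simp
  qed
  have v: "v k = ennreal (a k)" for k using vfin[of k] by (simp add: a_def top.not_eq_extremum)
  have a0: "0 \<le> a k" for k by (simp add: a_def)
  have \<Psi>: "\<Psi> (t k) \<le> ennreal (a k * t k powr \<alpha>)" for k
  proof -
    have "v k * ennreal (t k powr \<alpha>) = ennreal (t k powr \<alpha>) * \<Psi> (t k) / ennreal (t k powr \<alpha>)"
      unfolding v_def by (subst mult.commute) (rule ennreal_times_divide)
    also have "\<dots> = \<Psi> (t k)"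
      by (subst mult.commute, rule mult_divide_eq_ennreal) (use t0[of k] in auto)
    finally have "\<Psi> (t k) = v k * ennreal (t k powr \<alpha>)" by simp
    also have "\<dots> = ennreal (a k * t k powr \<alpha>)" unfolding v using a0 by (simp add: ennreal_mult)
    finally show ?thesis by simp
  qed
  have ak: "a k powr q \<le> 2 * (cr k * (1/2) ^ Suc (Suc k)) + (1/2) ^ Suc k" for k
  proof -
    have "ennreal (a k powr q * (1 / t k)) < ennreal (cr k + 1)"
    proof -
      have "ennreal (a k powr q * (1 / t k)) = ennreal (a k powr q) * ennreal (1 / t k)"
        by (rule ennreal_mult) (use t0[of k] in auto)
      then show ?thesis using lt[of k] by (simp only: v enn_powr_ennreal[OF a0])
    qed
    moreover have "0 \<le> a k powr q * (1 / t k)" using t0[of k] by simp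
    ultimately have "a k powr q * (1 / t k) \<le> cr k + 1" by (simp only: ennreal_less_iff less_imp_le)
    then have "a k powr q \<le> (cr k + 1) * t k" using t0[of k] by (simp add: field_simps)
    also have "\<dots> \<le> (cr k + 1) * (1/2) ^ Suc k" using t(1)[of k] c(2)[of k] by (intro mult_left_mono) (auto simp: dyadic_interval_def)
    finally show ?thesis by (simp add: algebra_simps)
  qed
  have "summable (\<lambda>k. cr k * (1/2) ^ Suc (Suc k))"
  proof (rule summable_suminf_not_top)
    show "(\<Sum>k. ennreal (cr k * (1/2) ^ Suc (Suc k))) \<noteq> top"
      using less_imp_neq[OF S] unfolding c(1) by (simp add: ennreal_mult c(2) del: power_Suc)
  qed (use c(2) in auto)
  then have "summable (\<lambda>k. 2 * (cr k * (1/2) ^ Suc (Suc k)) + (1/2) ^ Suc k)"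
    by (intro summable_add summable_mult summable_Suc_iff[THEN iffD2] summable_geometric) auto
  then have "summable (\<lambda>k. a k powr q)" by (rule summable_comparison_test'[of _ 0]) (use ak in auto)
  then show ?thesis using a0 t(1) \<Psi> by blast
qed

section \<open>The mixed norm on dyadic scales\<close>

text \<open>On the annulus between two consecutive radii, \<open>1 - r\<^sup>2\<close> is comparable to \<open>2\<^sup>-\<^sup>k\<close>, and the
  width of the annulus is comparable to \<open>2\<^sup>-\<^sup>k\<close> as well.\<close>

lemma one_minus_exp_bounds:
  fixes x :: real
  assumes "0 \<le> x"
  shows "x / (1 + x) \<le> 1 - exp (- x)" "1 - exp (- x) \<le> x"
proof -
  have "exp (- x) \<le> 1 / (1 + x)"
    using exp_ge_add_one_self[of x] assms by (simp add: exp_minus inverse_eq_divide divide_left_mono)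
  then show "x / (1 + x) \<le> 1 - exp (- x)" using assms by (simp add: field_simps)
  show "1 - exp (- x) \<le> x" using exp_ge_add_one_self[of "- x"] by simp
qed

lemma annulus_weight:
  assumes r: "radius k \<le> r" "r \<le> radius (Suc k)"
  shows "(1/2) ^ k / 3 \<le> 1 - r\<^sup>2" "1 - r\<^sup>2 \<le> 2 * (1/2) ^ k"
proof -
  let ?u = "(1/2 :: real) ^ k"
  have u: "0 < ?u" "?u \<le> 1" by (auto simp: power_le_one)
  have sq: "(radius j)\<^sup>2 = exp (- (2 * (1/2) ^ j))" for j
    by (simp add: radius_def power2_eq_square exp_add[symmetric])
  have "0 \<le> r" using r(1) radius_nonneg[of k] by linarith
  then have "(radius k)\<^sup>2 \<le> r\<^sup>2" "r\<^sup>2 \<le> (radius (Suc k))\<^sup>2" using r by (auto intro!: power_mono)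
  then have 1: "exp (- (2 * ?u)) \<le> r\<^sup>2" "r\<^sup>2 \<le> exp (- ?u)" by (auto simp: sq)
  show "1 - r\<^sup>2 \<le> 2 * ?u" using one_minus_exp_bounds(2)[of "2 * ?u"] u 1 by linarith
  have "?u / 3 \<le> ?u / (1 + ?u)"
  proof (rule divide_left_mono)
    have "0 < 1 + ?u" using u by linarith
    then show "0 < 3 * (1 + ?u)" by (rule mult_pos_pos[rotated]) simp
  qed (use u in linarith)+
  then show "?u / 3 \<le> 1 - r\<^sup>2" using one_minus_exp_bounds(1)[of ?u] u 1 by linarith
qed

lemma annulus_width:
  "(1/2) ^ k / 18 \<le> radius (Suc k) - radius k" "radius (Suc k) - radius k \<le> (1/2) ^ k"
proof -
  define v where "v = (1/2 :: real) ^ Suc k"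
  have v: "0 < v" "v \<le> 1" unfolding v_def by (auto simp del: power_Suc intro: power_le_one)
  have kv: "(1/2 :: real) ^ k = 2 * v" by (simp add: v_def)
  have d: "radius (Suc k) - radius k = exp (- v) * (1 - exp (- v))"
    by (subst radius_square) (simp add: radius_def v_def[symmetric] right_diff_distrib del: power_Suc)
  have "exp (- v) * (1 - exp (- v)) \<le> 1 * v" using v by (intro mult_mono one_minus_exp_bounds) auto
  then show "radius (Suc k) - radius k \<le> (1/2) ^ k" using v by (simp add: d kv)
  have e: "1 / 3 \<le> exp (- v)"
  proof -
    have "exp v \<le> exp 1" using v by simp
    then have "exp v \<le> 3" using exp_le by linarith
    then show ?thesis by (simp add: exp_minus field_simps)
  qed
  have "v / 2 \<le> v / (1 + v)" using v by (intro divide_left_mono) auto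
  then have "v / 2 \<le> 1 - exp (- v)" using one_minus_exp_bounds(1)[of v] v by linarith
  then have "1 / 3 * (v / 2) \<le> exp (- v) * (1 - exp (- v))" using e v by (intro mult_mono) auto
  then show "(1/2) ^ k / 18 \<le> radius (Suc k) - radius k" using v by (simp add: d kv)
qed

text \<open>The constants depend on the sign of the exponent, which is arbitrary for the weight of the mixed norm.\<close>

lemma powr_comparable:
  assumes "0 < lo" "lo \<le> hi"
  obtains m M :: real where "0 < m" "0 < M"
    "\<And>x y. 0 < x \<Longrightarrow> lo * x \<le> y \<Longrightarrow> y \<le> hi * x \<Longrightarrow> m * x powr a \<le> y powr a"
    "\<And>x y. 0 < x \<Longrightarrow> lo * x \<le> y \<Longrightarrow> y \<le> hi * x \<Longrightarrow> y powr a \<le> M * x powr a"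
proof (cases "0 \<le> a")
  case True
  show ?thesis
  proof (rule that[of "lo powr a" "hi powr a"])
    fix x y :: real assume x: "0 < x" "lo * x \<le> y" "y \<le> hi * x"
    have "(lo * x) powr a \<le> y powr a" using x assms True by (intro powr_mono2) auto
    then show "lo powr a * x powr a \<le> y powr a" using x assms by (simp add: powr_mult)
    have "0 < y" using x(2) by (rule less_le_trans[rotated]) (use x assms in auto)
    then have "y powr a \<le> (hi * x) powr a" using x True by (intro powr_mono2) auto
    then show "y powr a \<le> hi powr a * x powr a" using x assms by (simp add: powr_mult)
  qed (use assms in auto)
next
  case False
  show ?thesis
  proof (rule that[of "hi powr a" "lo powr a"])
    fix x y :: real assume x: "0 < x" "lo * x \<le> y" "y \<le> hi * x"
    have y: "0 < y" using x(2) by (rule less_le_trans[rotated]) (use x assms in auto)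
    have "(hi * x) powr a \<le> y powr a" using x y False by (intro powr_mono2') auto
    then show "hi powr a * x powr a \<le> y powr a" using x assms by (simp add: powr_mult)
    have "y powr a \<le> (lo * x) powr a" using x assms False by (intro powr_mono2') auto
    then show "y powr a \<le> lo powr a * x powr a" using x assms by (simp add: powr_mult)
  qed (use assms in auto)
qed

lemma radius_interval_cover:
  assumes "radius 0 < r" "r < 1"
  shows "\<exists>k. r \<in> {radius k<..radius (Suc k)}"
proof -
  have r0: "0 < r" using assms(1) radius_pos[of 0] by linarith
  have "0 < - ln r" using assms r0 by simp
  moreover have "- ln r \<le> 1"
  proof -
    have "exp (- 1) < r" using assms(1) by (simp add: radius_def)
    then have "exp (- 1) < exp (ln r)" using r0 by simp
    then have "- 1 < ln r" by (simp only: exp_less_cancel_iff)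
    then show ?thesis by simp
  qed
  ultimately obtain k where k: "- ln r \<in> dyadic_interval k" using dyadic_interval_cover by blast
  have "(1/2) ^ Suc k \<le> - ln r" "- ln r \<le> (1/2) ^ k"
    using k unfolding dyadic_interval_def by auto
  then have "ln r \<le> - ((1/2) ^ Suc k)" "- ((1/2) ^ k) \<le> ln r" by linarith+
  then have "exp (ln r) \<le> radius (Suc k)" "radius k \<le> exp (ln r)"
    unfolding radius_def by (simp_all only: exp_le_cancel_iff)
  then have kk: "radius k \<le> r" "r \<le> radius (Suc k)" using r0 by simp_all
  show ?thesis
  proof (cases "r = radius k")
    case False then show ?thesis using kk by (intro exI[of _ k]) auto
  next
    case True
    then have "k \<noteq> 0" using assms(1) by (intro notI) auto
    then obtain j where "k = Suc j" by (cases k) auto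
    moreover have "radius j < radius (Suc j)"
      using annulus_width(1)[of j] zero_less_power[of "1/2 :: real" j] by linarith
    ultimately show ?thesis using True by (intro exI[of _ j]) auto
  qed
qed

text \<open>Membership of a monotone function in the weighted space is equivalent to a condition on its values
  at the dyadic radii.\<close>

lemma weighted_integral_dyadic:
  fixes \<phi> :: "real \<Rightarrow> real" and \<beta> :: real and L :: nat
  assumes q: "0 < q" and \<phi>0: "\<And>r. 0 \<le> \<phi> r" and mono: "\<And>r R. 0 < r \<Longrightarrow> r \<le> R \<Longrightarrow> R < 1 \<Longrightarrow> \<phi> r \<le> \<phi> R"
  defines "g \<equiv> \<lambda>r. ennreal (\<phi> r powr q * ((1 - r\<^sup>2) powr (q * \<beta> - 1) * r ^ L)) * indicator {0<..<1} r"
  shows "(\<integral>\<^sup>+r. g r \<partial>lborel) < \<infinity> \<longleftrightarrow> summable (\<lambda>k. (2 powr (- (real k * \<beta>)) * \<phi> (radius k)) powr q)"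
proof -
  define c where "c = (\<lambda>k. (2 powr (- (real k * \<beta>)) * \<phi> (radius k)) powr q)"
  define a where "a = q * \<beta> - 1"
  define J where "J = (\<lambda>k. {radius k<..radius (Suc k)})"
  obtain m M where m: "0 < m" and M: "0 < M"
    and lo: "\<And>x y. 0 < x \<Longrightarrow> 1/3 * x \<le> y \<Longrightarrow> y \<le> 2 * x \<Longrightarrow> m * x powr a \<le> y powr a"
    and hi: "\<And>x y. 0 < x \<Longrightarrow> 1/3 * x \<le> y \<Longrightarrow> y \<le> 2 * x \<Longrightarrow> y powr a \<le> M * x powr a"
    using powr_comparable[of "1/3" 2 a] by auto
  have dJ: "disjoint_family J" unfolding J_def by (rule disjoint_family_halfopen[OF radius_mono])
  have mJ: "J k \<in> sets borel" for k by (simp add: J_def)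
  have eJ: "emeasure lborel (J k) = ennreal (radius (Suc k) - radius k)" for k
    by (simp add: J_def radius_mono)
  have h: "0 < (1/2 :: real) ^ k" for k by simp
  have cw: "\<phi> (radius k) powr q * (((1/2) ^ k) powr a * (1/2) ^ k) = c k" for k
  proof -
    have "((1/2) ^ k) powr a * (1/2) ^ k = (2 powr (- (real k * \<beta>))) powr q"
      unfolding powr_half_power unfolding half_power by (simp add: powr_add[symmetric] powr_powr a_def algebra_simps)
    then show ?thesis using \<phi>0 by (simp add: c_def powr_mult)
  qed
  have c0: "0 \<le> c k" for k by (simp add: c_def)
  have rL: "r ^ L \<le> 1" "0 \<le> r ^ L" if "0 < r" "r < 1" for r :: real using that by (auto intro: power_le_one)
  show ?thesis
  proof
    assume fin: "(\<integral>\<^sup>+r. g r \<partial>lborel) < \<infinity>"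
    define K where "K = m * (radius 0) ^ L / 18"
    have K: "0 < K" using m by (simp add: K_def)
    define d where "d = (\<lambda>k. \<phi> (radius k) powr q * (m * ((1/2) ^ k) powr a * (radius 0) ^ L))"
    have d0: "0 \<le> d k" for k unfolding d_def using m by (intro mult_nonneg_nonneg) auto
    have "(\<Sum>k. ennreal (d k) * emeasure lborel (J k)) \<le> (\<integral>\<^sup>+r. g r \<partial>lborel)"
    proof (rule nn_integral_ge_step[OF dJ mJ])
      fix k r assume "r \<in> J k"
      then have r: "radius k < r" "r \<le> radius (Suc k)" by (auto simp: J_def)
      have r01: "0 < r" "r < 1" using r radius_pos[of k] radius_less_1[of "Suc k"] by linarith+
      have "d k \<le> \<phi> r powr q * ((1 - r\<^sup>2) powr a * r ^ L)"
        unfolding d_def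
      proof (intro mult_mono powr_mono2)
        show "\<phi> (radius k) \<le> \<phi> r" using r r01 by (intro mono) auto
        show "m * ((1/2) ^ k) powr a \<le> (1 - r\<^sup>2) powr a"
          using annulus_weight[of k r] r by (intro lo h) auto
        have "radius 0 \<le> r" using radius_mono[of 0 k] r(1) by linarith
        then show "radius 0 ^ L \<le> r ^ L" by (intro power_mono) auto
      qed (use q \<phi>0 m r01 in auto)
      then show "ennreal (d k) \<le> g r" using r01 by (simp add: g_def a_def ennreal_leI)
    qed
    then have "(\<Sum>k. ennreal (d k) * emeasure lborel (J k)) < \<infinity>" using fin by (rule le_less_trans)
    moreover have "ennreal (K * c k) \<le> ennreal (d k) * emeasure lborel (J k)" for k
    proof -
      have "K * c k = d k * ((1/2) ^ k / 18)" by (simp add: K_def d_def cw[symmetric] mult_ac)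
      also have "\<dots> \<le> d k * (radius (Suc k) - radius k)" by (intro mult_left_mono annulus_width d0)
      finally show ?thesis unfolding eJ by (subst ennreal_mult[symmetric]) (auto simp: d0 radius_mono intro!: ennreal_leI)
    qed
    ultimately have "(\<Sum>k. ennreal (K * c k)) < \<infinity>"
      by (rule le_less_trans[OF suminf_le[OF _ summableI summableI], rotated])
    then have "summable (\<lambda>k. K * c k)"
      using K c0 by (intro summable_suminf_not_top) (auto simp: top.not_eq_extremum)
    then have "summable c" using K by simp
    then show "summable (\<lambda>k. (2 powr (- (real k * \<beta>)) * \<phi> (radius k)) powr q)" by (simp only: c_def)
  next
    assume S: "summable (\<lambda>k. (2 powr (- (real k * \<beta>)) * \<phi> (radius k)) powr q)"
    \<comment> \<open>The annuli are preceded by the ball of radius \<open>radius 0\<close>.\<close>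
    define J' where "J' = (\<lambda>k. case k of 0 \<Rightarrow> {0<..radius 0} | Suc k \<Rightarrow> J k)"
    define d where "d = (\<lambda>k. case k of 0 \<Rightarrow> \<phi> (radius 0) powr q * M | Suc k \<Rightarrow> \<phi> (radius (Suc k)) powr q * (M * ((1/2) ^ k) powr a))"
    have d0: "0 \<le> d k" for k unfolding d_def using M by (auto split: nat.split)
    have dJ': "disjoint_family J'"
    proof -
      have 1: "{0<..radius 0} \<inter> J k = {}" for k using radius_mono[of 0 k] by (auto simp: J_def)
      show ?thesis unfolding disjoint_family_on_def J'_def
        using 1 dJ by (auto simp: disjoint_family_on_def split: nat.split)
    qed
    have "(\<integral>\<^sup>+r. g r \<partial>lborel) \<le> (\<Sum>k. ennreal (d k) * emeasure lborel (J' k))"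
    proof (rule nn_integral_le_step[OF dJ'])
      show "J' k \<in> sets borel" for k by (simp add: J'_def mJ split: nat.split)
      fix k r assume r: "r \<in> J' k"
      show "g r \<le> ennreal (d k)"
      proof (cases k)
        case 0
        then have r: "0 < r" "r \<le> radius 0" using r by (auto simp: J'_def)
        then have r1: "r < 1" using radius_less_1[of 0] by linarith
        have "\<phi> r powr q * ((1 - r\<^sup>2) powr a * r ^ L) \<le> \<phi> (radius 0) powr q * ((M * 1 powr a) * 1)"
        proof (intro mult_mono powr_mono2)
          show "\<phi> r \<le> \<phi> (radius 0)" using r by (intro mono) auto
          have "r\<^sup>2 \<le> (radius 0)\<^sup>2" using r by (intro power_mono) auto
          then have "1/3 * 1 \<le> 1 - r\<^sup>2" using annulus_weight(1)[of 0 "radius 0"] radius_mono[of 0 1] by simp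
          then show "(1 - r\<^sup>2) powr a \<le> M * 1 powr a" using zero_le_power2[of r] by (intro hi) linarith+
        qed (use q \<phi>0 M r r1 rL in auto)
        then show ?thesis using r r1 by (simp add: g_def a_def d_def 0 ennreal_leI)
      next
        case (Suc j)
        then have r: "radius j < r" "r \<le> radius (Suc j)" using r by (auto simp: J'_def J_def)
        have r01: "0 < r" "r < 1" using r radius_pos[of j] radius_less_1[of "Suc j"] by linarith+
        have "\<phi> r powr q * ((1 - r\<^sup>2) powr a * r ^ L) \<le> \<phi> (radius (Suc j)) powr q * ((M * ((1/2) ^ j) powr a) * 1)"
        proof (intro mult_mono powr_mono2)
          show "\<phi> r \<le> \<phi> (radius (Suc j))" using r r01 by (intro mono) auto
          show "(1 - r\<^sup>2) powr a \<le> M * ((1/2) ^ j) powr a"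
            using annulus_weight[of j r] r by (intro hi h) auto
        qed (use q \<phi>0 M r01 rL in auto)
        then show ?thesis using r01 by (simp add: g_def a_def d_def Suc ennreal_leI)
      qed
    next
      fix r assume "g r \<noteq> 0"
      then have r: "0 < r" "r < 1" by (auto simp: g_def indicator_def split: if_splits)
      show "\<exists>k. r \<in> J' k"
      proof (cases "r \<le> radius 0")
        case True then show ?thesis using r by (intro exI[of _ 0]) (simp add: J'_def)
      next
        case False
        then obtain k where "r \<in> J k" using radius_interval_cover[of r] r unfolding J_def by auto
        then show ?thesis by (intro exI[of _ "Suc k"]) (simp add: J'_def)
      qed
    qed
    also have "\<dots> \<le> (\<Sum>k. ennreal (M * (2 powr \<beta>) powr q * c k + d 0 * (if k = 0 then 1 else 0)))"
    proof (intro suminf_le summableI)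
      fix k
      show "ennreal (d k) * emeasure lborel (J' k) \<le> ennreal (M * (2 powr \<beta>) powr q * c k + d 0 * (if k = 0 then 1 else 0))"
      proof (cases k)
        case 0
        have "d 0 * radius 0 \<le> d 0 * 1" by (intro mult_left_mono d0) auto
        also have "\<dots> \<le> M * (2 powr \<beta>) powr q * c k + d 0" using M c0[of k] by simp
        finally show ?thesis using 0 d0[of 0] by (simp add: J'_def ennreal_mult[symmetric] ennreal_leI)
      next
        case (Suc j)
        have "d k * (radius (Suc j) - radius j) \<le> d k * (1/2) ^ j" by (intro mult_left_mono annulus_width d0)
        also have "\<dots> = M * (\<phi> (radius k) powr q * (((1/2) ^ j) powr a * (1/2) ^ j))" by (simp add: d_def Suc)
        also have "((1/2) ^ j) powr a * (1/2) ^ j = (2 powr \<beta>) powr q * (((1/2) ^ k) powr a * (1/2) ^ k)"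
          unfolding powr_half_power unfolding half_power Suc by (simp add: powr_add[symmetric] powr_powr a_def algebra_simps)
        also have "M * (\<phi> (radius k) powr q * \<dots>) = M * (2 powr \<beta>) powr q * c k"
          by (simp add: cw[symmetric] mult_ac)
        finally show ?thesis using Suc d0[of k] eJ[of j]
          by (simp add: J'_def ennreal_mult[symmetric] radius_mono ennreal_leI)
      qed
    qed
    also have "\<dots> < \<infinity>"
      unfolding infinity_ennreal_def top.not_eq_extremum[symmetric]
    proof (rule ennreal_suminf_neq_top)
      show "summable (\<lambda>k. M * (2 powr \<beta>) powr q * c k + d 0 * (if k = 0 then 1 else 0))"
      proof (intro summable_add summable_mult)
        show "summable c" using S by (simp only: c_def)
        show "summable (\<lambda>k. if k = 0 then 1 else 0 :: real)" by (rule summable_finite[of "{0}"]) auto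
      qed
      show "0 \<le> M * (2 powr \<beta>) powr q * c k + d 0 * (if k = 0 then 1 else 0)" for k using M c0[of k] d0[of 0] by simp
    qed
    finally show "(\<integral>\<^sup>+r. g r \<partial>lborel) < \<infinity>" .
  qed
qed

section \<open>The equivalence\<close>

lemma sphere_norm_Lp: "1 \<le> p \<Longrightarrow> sphere_norm (Lp_norm p :: (complex^'N \<Rightarrow> complex) \<Rightarrow> real)"
  by unfold_locales (auto intro: Lp_norm_triangle Lp_norm_cmult_le Lp_norm_bound Lp_norm_orthogonal)

lemma int_mean_eq_mean:
  fixes g :: "complex^'N \<Rightarrow> complex"
  assumes p: "1 \<le> p" and g: "continuous_on (ball 0 1) g" and r: "0 \<le> r" "r < 1"
  shows "int_mean p r g = ennreal (sphere_norm.mean (Lp_norm p) r g)"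
proof -
  interpret sphere_norm "Lp_norm p :: (complex^'N \<Rightarrow> complex) \<Rightarrow> real" by (rule sphere_norm_Lp[OF p])
  show ?thesis unfolding int_mean_unit[of p r] mean_def
    by (rule int_mean_Lp_norm[OF p continuous_on_mean[OF g r]])
qed

lemma hardy_norm_le_iff:
  fixes g :: "complex^'N \<Rightarrow> complex"
  assumes p: "1 \<le> p" and g: "continuous_on (ball 0 1) g"
  shows "hardy_norm p g \<le> C \<longleftrightarrow> (\<forall>r. 0 < r \<longrightarrow> r < 1 \<longrightarrow> ennreal (sphere_norm.mean (Lp_norm p) r g) \<le> C)"
  unfolding hardy_norm_def SUP_le_iff using int_mean_eq_mean[OF p g] by auto

lemma mixed_norm_finite_iff:
  fixes f :: "complex^'N \<Rightarrow> complex"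
  assumes p: "1 \<le> p" and q: "0 < q" and f: "hol f" and s: "1 \<le> s"
  shows "mixed_norm p q \<beta> (radial_deriv (real s) f) < \<infinity> \<longleftrightarrow>
    summable (\<lambda>k. sphere_norm.scaled_mean (Lp_norm p) \<beta> s f k powr q)"
proof -
  interpret sphere_norm "Lp_norm p :: (complex^'N \<Rightarrow> complex) \<Rightarrow> real" by (rule sphere_norm_Lp[OF p])
  let ?R = "(Rad ^^ s) f" and ?L = "2 * CARD('N) - 1"
  have sR: "slice_holomorphic ?R" by (rule slice_holomorphic_Rad_funpow[OF hol_slice[OF f]])
  have eq: "radial_deriv (real s) f z = ?R z" if "norm z < 1" for z by (rule radial_deriv_eq[OF f s that])
  have cont: "continuous_on (ball 0 1) (radial_deriv (real s) f)"
    using slice_cont[OF sR] by (rule continuous_on_eq) (simp add: eq)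
  have mean: "int_mean p r (radial_deriv (real s) f) = ennreal (mean r ?R)" if "0 < r" "r < 1" for r
    unfolding int_mean_eq_mean[OF p cont less_imp_le[OF that(1)] that(2)]
    using mean_cong[OF cont less_imp_le[OF that(1)] that(2) eq] by simp
  let ?I = "\<integral>\<^sup>+r\<in>{0<..<1}. enn_powr (int_mean p r (radial_deriv (real s) f)) q *
             ennreal ((1 - r\<^sup>2) powr (q * \<beta> - 1) * r ^ ?L) \<partial>lborel"
  have "mixed_norm p q \<beta> (radial_deriv (real s) f) < \<infinity> \<longleftrightarrow> ennreal (2 * real CARD('N)) * ?I < \<infinity>"
    unfolding mixed_norm_def by (rule enn_powr_less_top_iff)
  also have "\<dots> \<longleftrightarrow> ?I < \<infinity>"
  proof -
    have "ennreal (2 * real CARD('N)) \<noteq> 0" by simp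
    then show ?thesis by (auto simp: ennreal_mult_less_top)
  qed
  also have "?I = (\<integral>\<^sup>+r. ennreal (mean r ?R powr q * ((1 - r\<^sup>2) powr (q * \<beta> - 1) * r ^ ?L)) * indicator {0<..<1} r \<partial>lborel)"
  proof (rule nn_integral_cong)
    fix r :: real
    show "enn_powr (int_mean p r (radial_deriv (real s) f)) q * ennreal ((1 - r\<^sup>2) powr (q * \<beta> - 1) * r ^ ?L) * indicator {0<..<1} r
      = ennreal (mean r ?R powr q * ((1 - r\<^sup>2) powr (q * \<beta> - 1) * r ^ ?L)) * indicator {0<..<1} r"
    proof (cases "r \<in> {0<..<1}")
      case True
      then have "enn_powr (int_mean p r (radial_deriv (real s) f)) q = ennreal (mean r ?R powr q)"
        by (simp add: mean enn_powr_ennreal)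
      then show ?thesis using True by (simp add: ennreal_mult)
    qed simp
  qed
  also have "\<dots> < \<infinity> \<longleftrightarrow> summable (\<lambda>k. (2 powr (- (real k * \<beta>)) * mean (radius k) ?R) powr q)"
    by (rule weighted_integral_dyadic[OF q]) (auto intro: mean_mono[OF sR])
  finally show ?thesis by (simp only: scaled_mean_def)
qed

text \<open>If \<open>|z| < |U z|\<close>, then \<open>z / |U z|\<close> is a point of the ball that \<open>U\<close> maps to the sphere.\<close>

lemma linear_contraction_ball_operators:
  assumes "U \<in> ball_operators"
  shows "linear_contraction U"
proof (rule linear_contraction.intro)
  show lin: "Vector_Spaces.linear (*s) (*s) U" using assms by (simp add: ball_operators_def)
  fix z :: "complex^'a"
  show "norm (U z) \<le> norm z"
  proof (rule ccontr)
    assume "\<not> norm (U z) \<le> norm z"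
    then have lt: "norm z < norm (U z)" by simp
    then have pos: "0 < norm (U z)" by (rule le_less_trans[OF norm_ge_zero])
    let ?c = "of_real (1 / norm (U z)) :: complex"
    have n: "norm (?c *s w) = norm w / norm (U z)" for w :: "complex^'a"
      using pos by (simp add: norm_vector_scalar_mult norm_divide)
    have "?c *s z \<in> ball 0 1" using lt pos by (simp only: mem_ball_0 n) simp
    then have "U (?c *s z) \<in> ball 0 1" using assms unfolding ball_operators_def by blast
    then have "norm (?c *s U z) < 1" by (simp only: smult_linear[OF lin] mem_ball_0)
    then show False using pos unfolding n by simp
  qed
qed

lemma linear_displacement_bound:
  assumes U: "Vector_Spaces.linear (*s) (*s) (U :: complex^'N \<Rightarrow> complex^'N)"
  shows "norm (U z - z) \<le> onorm (\<lambda>z. U z - z) * norm z"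
proof (rule onorm)
  interpret U: Vector_Spaces.linear "(*s)" "(*s)" U by (rule U)
  have "linear (\<lambda>z. U z - z)" by (rule linearI) (simp_all only: U.add U.scale scaleR_eq_smult vector_ssub_ldistrib add_diff_add)
  then show "bounded_linear (\<lambda>z. U z - z)" by (simp add: linear_conv_bounded_linear)
qed

definition rotation :: "real \<Rightarrow> complex^'N \<Rightarrow> complex^'N" where
  "rotation t = (\<lambda>z. exp (\<i> * of_real t) *s z)"

lemma diff_op_rotation: "diff_op (rotation t) = diff_rot t"
  by (simp add: diff_op_def diff_rot_def rotation_def fun_eq_iff)

lemma linear_rotation: "Vector_Spaces.linear (*s) (*s) (rotation t)"
  unfolding rotation_def
  by unfold_locales (simp_all add: vector_add_ldistrib vector_smult_assoc mult_ac vector_ssub_ldistrib vector_sadd_rdistrib)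

lemma norm_rotation: "norm (rotation t z) = norm z"
  unfolding rotation_def norm_vector_scalar_mult by (simp add: norm_exp_eq_Re)

lemma linear_contraction_rotation: "linear_contraction (rotation t)"
  by (rule linear_contraction.intro) (simp_all add: linear_rotation norm_rotation)

lemma norm_exp_i_minus_1_le: "norm (exp (\<i> * of_real t) - 1) \<le> \<bar>t\<bar>"
proof -
  have "(norm (exp (\<i> * of_real t) - 1))\<^sup>2 = (2 * sin (t / 2))\<^sup>2"
  proof -
    have "(norm (exp (\<i> * of_real t) - 1))\<^sup>2 = (cos t - 1)\<^sup>2 + (sin t)\<^sup>2"
      by (simp add: cmod_power2 cis_conv_exp[symmetric])
    also have "\<dots> = 2 * (1 - cos t)" using sin_cos_squared_add[of t] by (simp add: power2_eq_square algebra_simps)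
    also have "cos t = 1 - 2 * (sin (t / 2))\<^sup>2" using cos_double_sin[of "t / 2"] by simp
    finally show ?thesis by (simp add: power2_eq_square)
  qed
  then have "norm (exp (\<i> * of_real t) - 1) = \<bar>2 * sin (t / 2)\<bar>"
    using power2_eq_iff_nonneg[of "norm (exp (\<i> * of_real t) - 1)" "\<bar>2 * sin (t / 2)\<bar>"] by simp
  also have "\<dots> \<le> \<bar>t\<bar>" using abs_sin_x_le_abs_x[of "t / 2"] by (simp add: abs_mult)
  finally show ?thesis .
qed

lemma rotation_displacement: "norm (rotation t z - z) \<le> \<bar>t\<bar> * norm z"
proof -
  have "rotation t z - z = (exp (\<i> * of_real t) - 1) *s z" by (simp add: rotation_def vector_sub_rdistrib)
  then have "norm (rotation t z - z) = norm (exp (\<i> * of_real t) - 1) * norm z" by (simp only: norm_vector_scalar_mult)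
  also have "\<dots> \<le> \<bar>t\<bar> * norm z" by (intro mult_right_mono norm_exp_i_minus_1_le) simp
  finally show ?thesis .
qed

lemma onorm_rotation: "onorm (\<lambda>z. rotation t z - z) \<le> \<bar>t\<bar>"
  by (rule onorm_bound) (simp_all add: rotation_displacement)

lemma unitary_subset_ball_operators: "unitary_operators \<subseteq> (ball_operators :: (complex^'N \<Rightarrow> complex^'N) set)"
proof
  fix U :: "complex^'N \<Rightarrow> complex^'N" assume U: "U \<in> unitary_operators"
  have "herm_inner (U z) (U z) = herm_inner z z" for z using U by (simp add: unitary_operators_def herm_inner_def)
  then have "(norm (U z))\<^sup>2 = (norm z)\<^sup>2" for z by (simp add: norm_eq_herm_inner)
  then have "norm (U z) = norm z" for z by (simp add: power2_eq_iff_nonneg)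
  then show "U \<in> ball_operators" using U by (auto simp: unitary_operators_def ball_operators_def)
qed

lemma rotation_unitary: "rotation t \<in> unitary_operators"
proof -
  have c: "e * a * cnj (e * b) = a * cnj b" if "e * cnj e = 1" for e a b :: complex
    by (metis that complex_cnj_mult mult.left_neutral mult.assoc mult.left_commute)
  have "exp (\<i> * of_real t) * cnj (exp (\<i> * of_real t)) = 1"
    unfolding complex_norm_square[symmetric] by (simp add: norm_exp_eq_Re)
  then show ?thesis
    unfolding unitary_operators_def rotation_def
    using linear_rotation[unfolded rotation_def, of t] by (simp only: mem_Collect_eq vector_smult_component c) simp
qed

lemma least_int_greater: "(LEAST m::int. \<alpha> < real_of_int m) = \<lfloor>\<alpha>\<rfloor> + 1"
proof (rule Least_equality)
  show "\<alpha> < real_of_int (\<lfloor>\<alpha>\<rfloor> + 1)" by linarith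
  show "\<lfloor>\<alpha>\<rfloor> + 1 \<le> m" if "\<alpha> < real_of_int m" for m using that by linarith
qed

text \<open>The order \<open>s = \<lfloor>\<alpha>\<rfloor> + 1\<close> of the derivative that defines the space is at most \<open>n\<close>, which allows passing
  from the derivative of order \<open>n\<close> down to it.\<close>

lemma besov_lipschitz_iff:
  assumes p: "1 \<le> p" and q: "0 < q" and \<alpha>: "0 < \<alpha>" "\<alpha> < real n"
  obtains s where "1 \<le> s" "s \<le> n" "\<alpha> < real s"
    "\<And>f :: complex^'N \<Rightarrow> complex. f \<in> besov_lipschitz p q \<alpha> \<longleftrightarrow>
      hol f \<and> summable (\<lambda>k. sphere_norm.scaled_mean (Lp_norm p) (real s - \<alpha>) s f k powr q)"
proof
  define s where "s = nat (\<lfloor>\<alpha>\<rfloor> + 1)"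
  have "0 \<le> \<lfloor>\<alpha>\<rfloor>" using \<alpha> by simp
  then have s: "int s = \<lfloor>\<alpha>\<rfloor> + 1" by (simp add: s_def)
  then have sr: "real s = real_of_int (\<lfloor>\<alpha>\<rfloor> + 1)" by (metis of_int_of_nat_eq)
  show s1: "1 \<le> s" using s \<open>0 \<le> \<lfloor>\<alpha>\<rfloor>\<close> by linarith
  have "\<lfloor>\<alpha>\<rfloor> < int n" using \<alpha>(2) by (simp add: floor_less_iff)
  then show "s \<le> n" using s by linarith
  show "\<alpha> < real s" unfolding sr by linarith
  show "f \<in> besov_lipschitz p q \<alpha> \<longleftrightarrow>
      hol f \<and> summable (\<lambda>k. sphere_norm.scaled_mean (Lp_norm p) (real s - \<alpha>) s f k powr q)" for f :: "complex^'N \<Rightarrow> complex"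
    unfolding besov_lipschitz_def least_int_greater Let_def sr[symmetric] mem_Collect_eq
    using mixed_norm_finite_iff[OF p q _ s1] by blast
qed

text \<open>The function \<open>\<Psi>\<close> stands for the size of rotational differences and for each of the three moduli: all of them
  are bounded by any bound for the differences along linear contractions with displacement at most \<open>\<delta>\<close>.\<close>

lemma besov_lipschitz_moduli:
  fixes f :: "complex^'N \<Rightarrow> complex"
  assumes p: "1 \<le> p" and q: "0 < q" and \<alpha>: "0 < \<alpha>" "\<alpha> < real n" and n: "1 \<le> n"
    and f: "f \<in> besov_lipschitz p q \<alpha>"
  shows "f \<in> hardy_space p"
    and "(\<And>\<delta> B. 0 < \<delta> \<Longrightarrow> (\<And>U. linear_contraction U \<Longrightarrow> (\<And>z. norm (U z - z) \<le> \<delta> * norm z) \<Longrightarrow>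
            hardy_norm p ((diff_op U ^^ n) f) \<le> B) \<Longrightarrow> \<Psi> \<delta> \<le> B) \<Longrightarrow>
      smoothness_integral q \<alpha> \<Psi> < \<infinity>"
proof -
  interpret sphere_norm "Lp_norm p :: (complex^'N \<Rightarrow> complex) \<Rightarrow> real" by (rule sphere_norm_Lp[OF p])
  obtain s where s: "1 \<le> s" "s \<le> n" "\<alpha> < real s" and iff: "\<And>f :: complex^'N \<Rightarrow> complex. f \<in> besov_lipschitz p q \<alpha> \<longleftrightarrow>
      hol f \<and> summable (\<lambda>k. scaled_mean (real s - \<alpha>) s f k powr q)"
    by (rule besov_lipschitz_iff[OF p q \<alpha>, where ?'N = 'N]) blast
  have hf: "hol f" and S: "summable (\<lambda>k. scaled_mean (real s - \<alpha>) s f k powr q)" using f iff by auto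
  note M = moduli_from_scaled_mean[OF hf s(1) n \<alpha> q S]
  obtain H where "\<And>r. 0 < r \<Longrightarrow> r < 1 \<Longrightarrow> mean r f \<le> H" using M(2) by blast
  then have "hardy_norm p f \<le> ennreal H"
    using hardy_norm_le_iff[OF p hol_cont[OF hf]] by (simp add: ennreal_leI)
  then have "hardy_norm p f < \<infinity>" by (rule le_less_trans) simp
  then show "f \<in> hardy_space p" using hf by (simp add: hardy_space_def)
  obtain E where E0: "\<And>k. 0 \<le> E k" and SE: "summable (\<lambda>k. (2 powr (real k * \<alpha>) * E k) powr q)"
    and E: "\<And>k U r. linear_contraction U \<Longrightarrow> (\<And>z. norm (U z - z) \<le> (1/2) ^ k * norm z) \<Longrightarrow> 0 < r \<Longrightarrow> r < 1 \<Longrightarrow>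
      mean r ((diff_op U ^^ n) f) \<le> E k" using M(1) by blast
  assume \<Psi>: "\<And>\<delta> B. 0 < \<delta> \<Longrightarrow> (\<And>U. linear_contraction U \<Longrightarrow> (\<And>z. norm (U z - z) \<le> \<delta> * norm z) \<Longrightarrow>
            hardy_norm p ((diff_op U ^^ n) f) \<le> B) \<Longrightarrow> \<Psi> \<delta> \<le> B"
  show "smoothness_integral q \<alpha> \<Psi> < \<infinity>"
  proof (rule smoothness_integral_finite[OF q \<alpha>(1) E0 _ SE])
    fix k and \<delta> :: real assume "\<delta> \<in> dyadic_interval k"
    then have \<delta>: "(1/2) ^ Suc k < \<delta>" "\<delta> \<le> (1/2) ^ k" by (auto simp: dyadic_interval_def)
    show "\<Psi> \<delta> \<le> ennreal (E k)"
    proof (rule \<Psi>)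
      show "0 < \<delta>" using \<delta>(1) by (rule less_trans[rotated]) simp
      fix U :: "complex^'N \<Rightarrow> complex^'N"
      assume U: "linear_contraction U" and d: "\<And>z. norm (U z - z) \<le> \<delta> * norm z"
      have d': "norm (U z - z) \<le> (1/2) ^ k * norm z" for z
        using d[of z] mult_right_mono[OF \<delta>(2) norm_ge_zero[of z]] by (rule order_trans)
      have "continuous_on (ball 0 1) ((diff_op U ^^ n) f)"
        by (intro hol_cont linear_contraction.hol_diff_op_funpow[OF U] hf)
      then show "hardy_norm p ((diff_op U ^^ n) f) \<le> ennreal (E k)"
        unfolding hardy_norm_le_iff[OF p \<open>continuous_on (ball 0 1) ((diff_op U ^^ n) f)\<close>]
        using E[OF U d'] by (intro allI impI ennreal_leI)
    qed
  qed
qed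

text \<open>Again \<open>\<Psi>\<close> stands for all four quantities. The moduli are suprema over displacements strictly smaller than
  \<open>t\<close>, so they dominate the rotation by \<open>t / 2\<close> but possibly not the one by \<open>t\<close>.\<close>

lemma besov_lipschitz_from_rotations:
  fixes f :: "complex^'N \<Rightarrow> complex"
  assumes p: "1 \<le> p" and q: "0 < q" and \<alpha>: "0 < \<alpha>" "\<alpha> < real n" and n: "1 \<le> n"
    and f: "f \<in> hardy_space p"
    and \<Psi>: "\<And>t. 0 < t \<Longrightarrow> \<exists>u. t / 2 \<le> u \<and> u \<le> t \<and> hardy_norm p ((diff_rot u ^^ n) f) \<le> \<Psi> t"
    and fin: "smoothness_integral q \<alpha> \<Psi> < \<infinity>"
  shows "f \<in> besov_lipschitz p q \<alpha>"
proof -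
  interpret sphere_norm "Lp_norm p :: (complex^'N \<Rightarrow> complex) \<Rightarrow> real" by (rule sphere_norm_Lp[OF p])
  have hf: "hol f" and hn: "hardy_norm p f < \<infinity>" using f by (auto simp: hardy_space_def)
  obtain s where s: "1 \<le> s" "s \<le> n" "\<alpha> < real s"
    and iff: "\<And>f :: complex^'N \<Rightarrow> complex. f \<in> besov_lipschitz p q \<alpha> \<longleftrightarrow>
      hol f \<and> summable (\<lambda>k. scaled_mean (real s - \<alpha>) s f k powr q)"
    by (rule besov_lipschitz_iff[OF p q \<alpha>, where ?'N = 'N]) blast
  obtain a t where a: "\<And>k. 0 \<le> a k" "summable (\<lambda>k. a k powr q)"
    and t: "\<And>k. t k \<in> dyadic_interval (Suc k)" and le: "\<And>k. \<Psi> (t k) \<le> ennreal (a k * t k powr \<alpha>)"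
    using smoothness_integral_sample[OF q fin] by blast
  have t1: "(1/2) ^ (k + 2) < t k" "t k \<le> (1/2) ^ (k + 1)" for k
    using t[of k] by (simp_all add: dyadic_interval_def)
  have t0: "0 < t k" for k using t1(1)[of k] by (rule less_trans[rotated]) simp
  obtain u where u: "\<And>k. t k / 2 \<le> u k" "\<And>k. u k \<le> t k"
    and uD: "\<And>k. hardy_norm p ((diff_rot (u k) ^^ n) f) \<le> \<Psi> (t k)"
    using \<Psi>[OF t0] by metis
  have "summable (\<lambda>k. scaled_mean (real n - \<alpha>) n f k powr q)"
  proof (rule scaled_mean_from_rotations[OF hf _ n \<alpha> q _ _ a])
    show "mean r f \<le> enn2real (hardy_norm p f)" if "0 < r" "r < 1" for r
    proof -
      have "ennreal (mean r f) \<le> hardy_norm p f"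
        using hardy_norm_le_iff[OF p hol_cont[OF hf], of "hardy_norm p f"] that by blast
      then show ?thesis using enn2real_mono[of "ennreal (mean r f)"] hn by simp
    qed
    fix k
    have "(1/2 :: real) ^ (k + 3) = (1/2) ^ (k + 2) / 2" by (simp add: power_add power_numeral_reduce)
    then show "(1/2) ^ (k + 3) \<le> u k" using t1(1)[of k] u(1)[of k] by linarith
    have "(1/2 :: real) ^ (k + 1) \<le> (1/2) ^ k" by simp
    then show "u k \<le> (1/2) ^ k" using t1(2)[of k] u(2)[of k] by linarith
    fix r :: real assume r: "0 < r" "r < 1"
    have cont: "continuous_on (ball 0 1) ((diff_rot (u k) ^^ n) f)"
      unfolding diff_op_rotation[symmetric]
      by (intro hol_cont linear_contraction.hol_diff_op_funpow[OF linear_contraction_rotation] hf)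
    have "hardy_norm p ((diff_rot (u k) ^^ n) f) \<le> ennreal (a k * t k powr \<alpha>)" using uD le by (rule order_trans)
    then have "ennreal (mean r ((diff_rot (u k) ^^ n) f)) \<le> ennreal (a k * t k powr \<alpha>)"
      unfolding hardy_norm_le_iff[OF p cont] using r by blast
    then have "mean r ((diff_rot (u k) ^^ n) f) \<le> a k * t k powr \<alpha>" using a(1) by simp
    also have "\<dots> \<le> a k * ((1/2) ^ k) powr \<alpha>"
      using t0[of k] \<alpha>(1) u(2)[of k] t1(2)[of k] \<open>(1/2 :: real) ^ (k + 1) \<le> (1/2) ^ k\<close> a(1)[of k]
      by (intro mult_left_mono powr_mono2) linarith+
    finally show "mean r ((diff_rot (u k) ^^ n) f) \<le> a k * 2 powr (- (real k * \<alpha>))" by (simp only: powr_half_power)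
  qed
  then show ?thesis unfolding iff using scaled_mean_lower_orders[OF hf s(3,2) q] hf by blast
qed

theorem theorem1p2:
  fixes n :: nat and p :: ennreal and q \<alpha> :: real
  assumes "1 \<le> n" and "1 \<le> p" and "1 \<le> q" and "0 < \<alpha>" and "\<alpha> < real n"
  shows "(besov_lipschitz p q \<alpha> :: (complex ^ 'N \<Rightarrow> complex) set) \<subseteq> hardy_space p \<and>
    (\<forall>f :: complex ^ 'N \<Rightarrow> complex. f \<in> hardy_space p \<longrightarrow>
      (f \<in> besov_lipschitz p q \<alpha> \<longleftrightarrow>
         smoothness_integral q \<alpha> (\<lambda>t. hardy_norm p ((diff_rot t ^^ n) f)) < \<infinity>) \<and>
      (f \<in> besov_lipschitz p q \<alpha> \<longleftrightarrow>
         smoothness_integral q \<alpha> (\<lambda>\<delta>. modulus_minus n \<delta> f p) < \<infinity>) \<and>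
      (f \<in> besov_lipschitz p q \<alpha> \<longleftrightarrow>
         smoothness_integral q \<alpha> (\<lambda>\<delta>. modulus n \<delta> f p) < \<infinity>) \<and>
      (f \<in> besov_lipschitz p q \<alpha> \<longleftrightarrow>
         smoothness_integral q \<alpha> (\<lambda>\<delta>. modulus_plus n \<delta> f p) < \<infinity>))"
proof -
  have q: "0 < q" using assms(3) by simp
  note to = besov_lipschitz_moduli[OF assms(2) q assms(4,5,1), where ?'N = 'N]
  note from_rot = besov_lipschitz_from_rotations[OF assms(2) q assms(4,5,1)]
  have rot: "linear_contraction (rotation t :: complex^'N \<Rightarrow> complex^'N)"
    "norm (rotation t z - z) \<le> \<delta> * norm z" if "\<bar>t\<bar> \<le> \<delta>" for t \<delta> and z :: "complex^'N"
  proof -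
    show "linear_contraction (rotation t :: complex^'N \<Rightarrow> complex^'N)" by (rule linear_contraction_rotation)
    show "norm (rotation t z - z) \<le> \<delta> * norm z"
      using rotation_displacement[of t z] mult_right_mono[OF that norm_ge_zero[of z]] by (rule order_trans)
  qed
  have ball: "linear_contraction U" "norm (U z - z) \<le> \<delta> * norm z"
    if "U \<in> ball_operators" "onorm (\<lambda>z. U z - z) < \<delta>" for U and \<delta> and z :: "complex^'N"
  proof -
    show U: "linear_contraction U" by (rule linear_contraction_ball_operators[OF that(1)])
    have "norm (U z - z) \<le> onorm (\<lambda>z. U z - z) * norm z"
      using that(1) by (intro linear_displacement_bound) (simp add: ball_operators_def)
    also have "\<dots> \<le> \<delta> * norm z" using that(2) by (intro mult_right_mono) auto
    finally show "norm (U z - z) \<le> \<delta> * norm z" .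
  qed
  show ?thesis
  proof (intro conjI allI impI subsetI)
    show "f \<in> hardy_space p" if "f \<in> besov_lipschitz p q \<alpha>" for f :: "complex^'N \<Rightarrow> complex" by (rule to(1)[OF that])
    fix f :: "complex^'N \<Rightarrow> complex" assume f: "f \<in> hardy_space p"
    let ?D = "\<lambda>U. hardy_norm p ((diff_op U ^^ n) f)"
    have half: "t / 2 \<le> t / 2" "t / 2 \<le> t" "\<bar>t / 2\<bar> < t" if "0 < t" for t :: real using that by auto
    have half_unitary: "rotation (t / 2) \<in> {U \<in> unitary_operators. onorm (\<lambda>z :: complex^'N. U z - z) < t}" if "0 < t" for t
      using rotation_unitary[of "t / 2"] le_less_trans[OF onorm_rotation half(3)[OF that]] by simp
    have half_ball: "rotation (t / 2) \<in> {U \<in> ball_operators. onorm (\<lambda>z :: complex^'N. U z - z) < t}" if "0 < t" for t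
      using half_unitary[OF that] unitary_subset_ball_operators by blast
    show "f \<in> besov_lipschitz p q \<alpha> \<longleftrightarrow> smoothness_integral q \<alpha> (\<lambda>t. hardy_norm p ((diff_rot t ^^ n) f)) < \<infinity>"
    proof
      assume b: "f \<in> besov_lipschitz p q \<alpha>"
      show "smoothness_integral q \<alpha> (\<lambda>t. hardy_norm p ((diff_rot t ^^ n) f)) < \<infinity>"
      proof (rule to(2)[OF b])
        fix \<delta> B assume "0 < (\<delta> :: real)" and B: "\<And>U :: complex^'N \<Rightarrow> complex^'N. linear_contraction U \<Longrightarrow> (\<And>z. norm (U z - z) \<le> \<delta> * norm z) \<Longrightarrow> ?D U \<le> B"
        then show "hardy_norm p ((diff_rot \<delta> ^^ n) f) \<le> B"
          unfolding diff_op_rotation[symmetric] by (intro B rot) auto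
      qed
    next
      assume fin: "smoothness_integral q \<alpha> (\<lambda>t. hardy_norm p ((diff_rot t ^^ n) f)) < \<infinity>"
      show "f \<in> besov_lipschitz p q \<alpha>" by (rule from_rot[OF f _ fin]) (use order_refl in force)
    qed
    show "f \<in> besov_lipschitz p q \<alpha> \<longleftrightarrow> smoothness_integral q \<alpha> (\<lambda>\<delta>. modulus_minus n \<delta> f p) < \<infinity>"
    proof
      assume b: "f \<in> besov_lipschitz p q \<alpha>"
      show "smoothness_integral q \<alpha> (\<lambda>\<delta>. modulus_minus n \<delta> f p) < \<infinity>"
      proof (rule to(2)[OF b])
        fix \<delta> B assume "0 < (\<delta> :: real)" and B: "\<And>U :: complex^'N \<Rightarrow> complex^'N. linear_contraction U \<Longrightarrow> (\<And>z. norm (U z - z) \<le> \<delta> * norm z) \<Longrightarrow> ?D U \<le> B"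
        show "modulus_minus n \<delta> f p \<le> B"
          unfolding modulus_minus_def diff_op_rotation[symmetric] by (intro SUP_least B rot) auto
      qed
    next
      assume fin: "smoothness_integral q \<alpha> (\<lambda>\<delta>. modulus_minus n \<delta> f p) < \<infinity>"
      show "f \<in> besov_lipschitz p q \<alpha>"
      proof (rule from_rot[OF f _ fin], intro exI conjI)
        fix t :: real assume t: "0 < t"
        show "t / 2 \<le> t / 2" "t / 2 \<le> t" by (rule half[OF t])+
        show "hardy_norm p ((diff_rot (t / 2) ^^ n) f) \<le> modulus_minus n t f p"
          unfolding modulus_minus_def by (rule SUP_upper) (simp only: mem_Collect_eq half[OF t])
      qed
    qed
    show "f \<in> besov_lipschitz p q \<alpha> \<longleftrightarrow> smoothness_integral q \<alpha> (\<lambda>\<delta>. modulus n \<delta> f p) < \<infinity>"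
    proof
      assume b: "f \<in> besov_lipschitz p q \<alpha>"
      show "smoothness_integral q \<alpha> (\<lambda>\<delta>. modulus n \<delta> f p) < \<infinity>"
      proof (rule to(2)[OF b])
        fix \<delta> B assume "0 < (\<delta> :: real)" and B: "\<And>U :: complex^'N \<Rightarrow> complex^'N. linear_contraction U \<Longrightarrow> (\<And>z. norm (U z - z) \<le> \<delta> * norm z) \<Longrightarrow> ?D U \<le> B"
        show "modulus n \<delta> f p \<le> B"
          unfolding modulus_def using unitary_subset_ball_operators by (intro SUP_least B ball) auto
      qed
    next
      assume fin: "smoothness_integral q \<alpha> (\<lambda>\<delta>. modulus n \<delta> f p) < \<infinity>"
      show "f \<in> besov_lipschitz p q \<alpha>"
      proof (rule from_rot[OF f _ fin], intro exI conjI)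
        fix t :: real assume t: "0 < t"
        show "t / 2 \<le> t / 2" "t / 2 \<le> t" by (rule half[OF t])+
        show "hardy_norm p ((diff_rot (t / 2) ^^ n) f) \<le> modulus n t f p"
          unfolding modulus_def diff_op_rotation[symmetric] by (rule SUP_upper[OF half_unitary[OF t]])
      qed
    qed
    show "f \<in> besov_lipschitz p q \<alpha> \<longleftrightarrow> smoothness_integral q \<alpha> (\<lambda>\<delta>. modulus_plus n \<delta> f p) < \<infinity>"
    proof
      assume b: "f \<in> besov_lipschitz p q \<alpha>"
      show "smoothness_integral q \<alpha> (\<lambda>\<delta>. modulus_plus n \<delta> f p) < \<infinity>"
      proof (rule to(2)[OF b])
        fix \<delta> B assume "0 < (\<delta> :: real)" and B: "\<And>U :: complex^'N \<Rightarrow> complex^'N. linear_contraction U \<Longrightarrow> (\<And>z. norm (U z - z) \<le> \<delta> * norm z) \<Longrightarrow> ?D U \<le> B"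
        show "modulus_plus n \<delta> f p \<le> B"
          unfolding modulus_plus_def by (intro SUP_least B ball) auto
      qed
    next
      assume fin: "smoothness_integral q \<alpha> (\<lambda>\<delta>. modulus_plus n \<delta> f p) < \<infinity>"
      show "f \<in> besov_lipschitz p q \<alpha>"
      proof (rule from_rot[OF f _ fin], intro exI conjI)
        fix t :: real assume t: "0 < t"
        show "t / 2 \<le> t / 2" "t / 2 \<le> t" by (rule half[OF t])+
        show "hardy_norm p ((diff_rot (t / 2) ^^ n) f) \<le> modulus_plus n t f p"
          unfolding modulus_plus_def diff_op_rotation[symmetric] by (rule SUP_upper[OF half_ball[OF t]])
      qed
    qed
  qed
qed

end
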